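(* Let $\psi_*\in\mathcal K'$ (i.e. $f(\psi_* )=\psi_*$), $\mathcal A'\subset\mathbb H$ and $\alpha\in[0,1)$ be such that for all $\psi\in\mathcal A'$, $$\|f(\psi)-\psi_*\|_{\mathbb H}\leqslant\alpha\|\psi-\psi_*\|_{\mathbb H}.$$ Then: (i) For any $\psi\in\mathcal A'$, $\|\psi-\psi_*\|_{\mathbb H}\leqslant\frac{1}{1-\alpha}\|f(\psi)-\psi\|_{\mathbb H}$. (ii) Assuming moreover that $\varphi$ is $\ell$-Lipschitz continuous, for all $\rho\in\mathcal P_2(\mathbb R^d)$ such that $\varphi(\rho)\in\mathcal A'$, $$\|\varphi(\rho)-\psi_*\|_{\mathbb H}\leqslant\frac{\ell}{1-\alpha}\mathcal W_2(\rho,\Gamma(\rho)).$$ (iii) Assuming furthermore that there is $\eta>0$ such that $\mathcal H(\nu|\Gamma(\rho))\leqslant\eta\,\mathcal I(\nu|\Gamma(\rho))$ for all $\nu,\rho\in\mathcal P_2(\mathbb R^d)$, and that $R+\theta\|\cdot\|_{\mathbb H}^2$ is convex for some $\theta>0$, for all $\rho\in\mathcal P_2(\mathbb R^d)$ such that $\varphi(\rho)\in\mathcal A'$, $$\mathcal F(\rho)-\mathcal F(\rho_{\psi_*})\leqslant\eta\left(\sigma^2+\frac{4\eta\theta\ell^2}{(1-\alpha)^2}\right)\mathcal I(\rho|\Gamma(\rho)).$$ In particular, provided $\mathcal F(\rho_{\psi_*})$ is the minimum of $\mathcal F$ over $\mathcal A=\{\rho\in\mathcal P_2(\mathbb R^d):\varphi(\rho)\in\mathcal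 A'\}$, there exists $\overline\eta>0$ such that $\mathcal F(\rho)-\inf_{\mu\in\mathcal A}\mathcal F(\mu)\leqslant\overline\eta\sigma^4\mathcal I(\rho|\Gamma(\rho))$ for all $\rho\in\mathcal A$.
   Context: $\mathcal P_2(\mathbb R^d)$: probability measures on $\mathbb R^d$ with finite second moment, with the $L^2$ Wasserstein distance $\mathcal W_2$. $\mathcal H(\nu|\mu)=\int\ln\frac{\mathrm d\nu}{\mathrm d\mu}\mathrm d\nu$ and $\mathcal I(\nu|\mu)=\int|\nabla\ln\frac{\mathrm d\nu}{\mathrm d\mu}|^2\mathrm d\nu$ ($+\infty$ when not defined); $\mathcal H(\rho)=\int\rho\ln\rho$ ($+\infty$ if $\rho$ is not absolutely continuous). Setting: $\mathbb H$ is a Hilbert space, $V_0\in\mathcal C^2(\mathbb R^d,\mathbb R)$, $R\in\mathcal C^1(\mathbb H,\mathbb R)$, $\varphi\in\mathcal C^2(\mathbb R^d,\mathbb H)$, $\sigma^2>0$. For a probability measure $\mu$, $\varphi(\mu):=\int\varphi\,\mathrm d\mu\in\mathbb H$ (Bochner integral), and $$\mathcal E(\mu)=\int_{\mathbb R^d}V_0\,\mathrm d\mu+R(\varphi(\mu)),\qquad\mathcal F(\mu)=\mathcal E(\mu)+\sigma^2\mathcal H(\mu),$$ with $\mathcal E(\mu)=\infty$ if $\int\|\varphi\|_{\mathbb H}\mathrm d\mu=\infty$. The linear functional derivative of $\mathcal E$ is $E_\rho(x)=V_0(x)+\langle\nabla_{\mathbb H}R(\varphi(\rho)),\varphi(x)\rangle_{\mathbb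 H}$. For $\psi\in\mathbb H$, $\rho_\psi$ is the probability density $\rho_\psi(x)\propto\exp\left(-\frac1{\sigma^2}[V_0(x)+\langle\nabla_{\mathbb H}R(\psi),\varphi(x)\rangle_{\mathbb H}]\right)$; $\Gamma(\rho)=\rho_{\varphi(\rho)}$; $f(\psi)=\varphi(\rho_\psi)=\int\varphi\rho_\psi$; $\mathcal K'=\{\psi\in\mathbb H:f(\psi)=\psi\}$. Standing assumptions: $\mathcal F(\rho_\psi)<\infty$ for all $\psi\in\mathbb H$; $\mathcal F$ is bounded from below; $E_\rho$ is indeed a linear functional derivative of $\mathcal E$, i.e. $\mathcal E(\mu_1)-\mathcal E(\mu_0)=\int_0^1\int E_{\mu_t}\,\mathrm d(\mu_1-\mu_0)\mathrm dt$ with $\mu_t=t\mu_1+(1-t)\mu_0$ whenever $\mathcal E(\mu_0)+\mathcal E(\mu_1)<\infty$, with $(x,\rho)\mapsto E_\rho(x)$ continuous on $\mathbb R^d\times(\mathcal P_2(\mathbb R^d),\mathcal W_2)$, $E_\rho\in\mathcal C^2(\mathbb R^d)$ and $\sup_{t\in[0,1]}|E_{\mu_t}|\in L^1(\mu_0)\cap L^1(\mu_1)$; $\int e^{-E_\rho/\sigma^2}<\infty$ for all $\rho\in\mathcal P_2(\mathbb R^d)$. *)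

theory Defs
  imports "HOL-Probability.Probability"
begin

section \<open>Differentiability classes and gradients\<close>

definition C1_fun :: "('a::real_normed_vector \<Rightarrow> 'b::real_normed_vector) \<Rightarrow> bool" where
  "C1_fun f \<longleftrightarrow> (\<exists>f'. (\<forall>x. (f has_derivative blinfun_apply (f' x)) (at x)) \<and> continuous_on UNIV f')"

definition C2_fun :: "('a::real_normed_vector \<Rightarrow> 'b::real_normed_vector) \<Rightarrow> bool" where
  "C2_fun f \<longleftrightarrow> (\<exists>f'. (\<forall>x. (f has_derivative blinfun_apply (f' x)) (at x)) \<and> C1_fun f')"

definition grad :: "('a::real_inner \<Rightarrow> real) \<Rightarrow> 'a \<Rightarrow> 'a" where
  "grad f x = (THE g. GDERIV f x :> g)"

section \<open>Integrals\<close>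

text \<open>Bochner integral in a normed space that need not be separable: the clauses are those of the
  library's \<^const>\<open>has_bochner_integral\<close>, whose type demands a second countable target.\<close>

definition has_bochner :: "'s measure \<Rightarrow> ('s \<Rightarrow> 'b::real_normed_vector) \<Rightarrow> 'b \<Rightarrow> bool" where
  "has_bochner M f v \<longleftrightarrow> f \<in> borel_measurable M \<and>
     (\<exists>s. (\<forall>i. Bochner_Integration.simple_bochner_integrable M (s i)) \<and>
          (\<lambda>i. \<integral>\<^sup>+x. ennreal (norm (f x - s i x)) \<partial>M) \<longlonglongrightarrow> 0 \<and>
          (\<lambda>i. Bochner_Integration.simple_bochner_integral M (s i)) \<longlonglongrightarrow> v)"

lemma has_bochner_eq_has_bochner_integral:
  fixes f :: "'s \<Rightarrow> 'b::{real_normed_vector,second_countable_topology}"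
  shows "has_bochner M f v \<longleftrightarrow> has_bochner_integral M f v"
  unfolding has_bochner_def has_bochner_integral.simps by auto

definition mean :: "('s \<Rightarrow> 'b::real_normed_vector) \<Rightarrow> 's measure \<Rightarrow> 'b" where
  "mean f \<mu> = (if \<exists>v. has_bochner \<mu> f v then THE v. has_bochner \<mu> f v else 0)"

text \<open>Extended integral of a real function; since \<open>ennreal\<close> sends negative reals to 0, this is
  the integral of the positive part minus that of the negative part.  As \<open>\<infinity> - \<infinity> = \<infinity>\<close> in
  \<^typ>\<open>ereal\<close>, an undefined integral has the value \<open>\<infinity>\<close>.\<close>

definition ereal_integral :: "'s measure \<Rightarrow> ('s \<Rightarrow> real) \<Rightarrow> ereal" where
  "ereal_integral M g =
     enn2ereal (\<integral>\<^sup>+x. ennreal (g x) \<partial>M) - enn2ereal (\<integral>\<^sup>+x. ennreal (- g x) \<partial>M)"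

section \<open>The Wasserstein space\<close>

definition P2 :: "'a::euclidean_space measure set" where
  "P2 = {\<mu>. prob_space \<mu> \<and> sets \<mu> = sets borel \<and> (\<integral>\<^sup>+x. ennreal ((norm x)\<^sup>2) \<partial>\<mu>) < \<infinity>}"

definition couplings ::
    "'a::euclidean_space measure \<Rightarrow> 'a measure \<Rightarrow> ('a \<times> 'a) measure set" where
  "couplings \<mu> \<nu> = {\<pi>. sets \<pi> = sets borel \<and> distr \<pi> borel fst = \<mu> \<and> distr \<pi> borel snd = \<nu>}"

definition transport_cost :: "'a::euclidean_space measure \<Rightarrow> 'a measure \<Rightarrow> ennreal" where
  "transport_cost \<mu> \<nu> = (INF \<pi>\<in>couplings \<mu> \<nu>. \<integral>\<^sup>+(x, y). ennreal ((dist x y)\<^sup>2) \<partial>\<pi>)"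

text \<open>The value is \<open>\<infinity>\<close> when no coupling has finite cost, which can only happen outside \<^const>\<open>P2\<close>.\<close>

definition W2 :: "'a::euclidean_space measure \<Rightarrow> 'a measure \<Rightarrow> ennreal" where
  "W2 \<mu> \<nu> = (if transport_cost \<mu> \<nu> = \<infinity> then \<infinity>
              else ennreal (sqrt (enn2real (transport_cost \<mu> \<nu>))))"

definition mixture :: "real \<Rightarrow> 's measure \<Rightarrow> 's measure \<Rightarrow> 's measure" where
  "mixture t \<mu>\<^sub>0 \<mu>\<^sub>1 = measure_of (space \<mu>\<^sub>0) (sets \<mu>\<^sub>0)
     (\<lambda>A. ennreal t * emeasure \<mu>\<^sub>1 A + ennreal (1 - t) * emeasure \<mu>\<^sub>0 A)"

section \<open>Entropy and Fisher information\<close>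

definition rel_density :: "'s measure \<Rightarrow> 's measure \<Rightarrow> 's \<Rightarrow> real" where
  "rel_density \<mu> \<nu> x = enn2real (RN_deriv \<mu> \<nu> x)"

definition entropy :: "'a::euclidean_space measure \<Rightarrow> ereal" where
  "entropy \<rho> = (if absolutely_continuous lborel \<rho>
     then ereal_integral lborel (\<lambda>x. rel_density lborel \<rho> x * ln (rel_density lborel \<rho> x))
     else \<infinity>)"

definition relative_entropy :: "'s measure \<Rightarrow> 's measure \<Rightarrow> ereal" where
  "relative_entropy \<nu> \<mu> = (if absolutely_continuous \<mu> \<nu>
     then ereal_integral \<nu> (\<lambda>x. ln (rel_density \<mu> \<nu> x))
     else \<infinity>)"

text \<open>Weak (distributional) gradient.  For locally integrable functions, testing against \<open>C\<^sup>1\<close> or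
  against \<open>C\<^sup>\<infinity>\<close> functions of compact support is the same, by mollification.\<close>

definition locally_integrable :: "('a::euclidean_space \<Rightarrow> 'b::euclidean_space) \<Rightarrow> bool" where
  "locally_integrable h \<longleftrightarrow> (\<forall>K. compact K \<longrightarrow> set_integrable lborel K h)"

definition has_weak_grad :: "('a::euclidean_space \<Rightarrow> real) \<Rightarrow> ('a \<Rightarrow> 'a) \<Rightarrow> bool" where
  "has_weak_grad h g \<longleftrightarrow> locally_integrable h \<and> locally_integrable g \<and>
     (\<forall>u. C1_fun u \<and> (\<exists>K. compact K \<and> (\<forall>x. x \<notin> K \<longrightarrow> u x = 0)) \<longrightarrow>
        (\<integral>x. h x *\<^sub>R grad u x \<partial>lborel) = - (\<integral>x. u x *\<^sub>R g x \<partial>lborel))"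

definition weak_grad :: "('a::euclidean_space \<Rightarrow> real) \<Rightarrow> 'a \<Rightarrow> 'a" where
  "weak_grad h = (SOME g. has_weak_grad h g)"

text \<open>With \<open>h = d\<nu>/d\<mu>\<close>, the integrand \<open>|\<nabla> ln h|\<^sup>2 = |\<nabla>h / h|\<^sup>2\<close> is needed only where \<open>h > 0\<close>, which
  is \<open>\<nu>\<close>-almost everywhere.  This is meant for \<open>\<mu>\<close> with a positive Lebesgue density: then \<open>h\<close> and its
  weak gradient are determined up to Lebesgue null sets, so the value does not depend on the choices
  of versions.\<close>

definition fisher_information ::
    "'a::euclidean_space measure \<Rightarrow> 'a measure \<Rightarrow> ennreal" where
  "fisher_information \<nu> \<mu> =
     (if absolutely_continuous \<mu> \<nu> \<and> (\<exists>g. has_weak_grad (rel_density \<mu> \<nu>) g)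
      then \<integral>\<^sup>+x. ennreal ((norm (weak_grad (rel_density \<mu> \<nu>) x /\<^sub>R rel_density \<mu> \<nu> x))\<^sup>2) \<partial>\<nu>
      else \<infinity>)"

section \<open>The mean-field free energy\<close>

definition energy ::
    "('a::euclidean_space \<Rightarrow> real) \<Rightarrow> ('h::{real_inner,complete_space} \<Rightarrow> real) \<Rightarrow> ('a \<Rightarrow> 'h) \<Rightarrow>
     'a measure \<Rightarrow> ereal" where
  "energy V\<^sub>0 R \<phi> \<mu> = (if (\<integral>\<^sup>+x. ennreal (norm (\<phi> x)) \<partial>\<mu>) = \<infinity> then \<infinity>
     else ereal_integral \<mu> V\<^sub>0 + ereal (R (mean \<phi> \<mu>)))"

definition free_energy ::
    "('a::euclidean_space \<Rightarrow> real) \<Rightarrow> ('h::{real_inner,complete_space} \<Rightarrow> real) \<Rightarrow> ('a \<Rightarrow> 'h) \<Rightarrow>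
     real \<Rightarrow> 'a measure \<Rightarrow> ereal" where
  "free_energy V\<^sub>0 R \<phi> \<sigma> \<mu> = energy V\<^sub>0 R \<phi> \<mu> + ereal (\<sigma>\<^sup>2) * entropy \<mu>"

definition potential ::
    "('a::euclidean_space \<Rightarrow> real) \<Rightarrow> ('h::{real_inner,complete_space} \<Rightarrow> real) \<Rightarrow> ('a \<Rightarrow> 'h) \<Rightarrow>
     'h \<Rightarrow> 'a \<Rightarrow> real" where
  "potential V\<^sub>0 R \<phi> \<psi> x = V\<^sub>0 x + inner (grad R \<psi>) (\<phi> x)"

definition energy_derivative ::
    "('a::euclidean_space \<Rightarrow> real) \<Rightarrow> ('h::{real_inner,complete_space} \<Rightarrow> real) \<Rightarrow> ('a \<Rightarrow> 'h) \<Rightarrow>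
     'a measure \<Rightarrow> 'a \<Rightarrow> real" where
  "energy_derivative V\<^sub>0 R \<phi> \<rho> = potential V\<^sub>0 R \<phi> (mean \<phi> \<rho>)"

definition gibbs_weight ::
    "('a::euclidean_space \<Rightarrow> real) \<Rightarrow> ('h::{real_inner,complete_space} \<Rightarrow> real) \<Rightarrow> ('a \<Rightarrow> 'h) \<Rightarrow>
     real \<Rightarrow> 'h \<Rightarrow> 'a \<Rightarrow> real" where
  "gibbs_weight V\<^sub>0 R \<phi> \<sigma> \<psi> x = exp (- (1 / \<sigma>\<^sup>2) * potential V\<^sub>0 R \<phi> \<psi> x)"

definition gibbs ::
    "('a::euclidean_space \<Rightarrow> real) \<Rightarrow> ('h::{real_inner,complete_space} \<Rightarrow> real) \<Rightarrow> ('a \<Rightarrow> 'h) \<Rightarrow>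
     real \<Rightarrow> 'h \<Rightarrow> 'a measure" where
  "gibbs V\<^sub>0 R \<phi> \<sigma> \<psi> = density lborel (\<lambda>x. ennreal
     (gibbs_weight V\<^sub>0 R \<phi> \<sigma> \<psi> x / (\<integral>y. gibbs_weight V\<^sub>0 R \<phi> \<sigma> \<psi> y \<partial>lborel)))"

definition local_equilibrium ::
    "('a::euclidean_space \<Rightarrow> real) \<Rightarrow> ('h::{real_inner,complete_space} \<Rightarrow> real) \<Rightarrow> ('a \<Rightarrow> 'h) \<Rightarrow>
     real \<Rightarrow> 'a measure \<Rightarrow> 'a measure" where
  "local_equilibrium V\<^sub>0 R \<phi> \<sigma> \<rho> = gibbs V\<^sub>0 R \<phi> \<sigma> (mean \<phi> \<rho>)"

definition mean_map ::
    "('a::euclidean_space \<Rightarrow> real) \<Rightarrow> ('h::{real_inner,complete_space} \<Rightarrow> real) \<Rightarrow> ('a \<Rightarrow> 'h) \<Rightarrow>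
     real \<Rightarrow> 'h \<Rightarrow> 'h" where
  "mean_map V\<^sub>0 R \<phi> \<sigma> \<psi> = mean \<phi> (gibbs V\<^sub>0 R \<phi> \<sigma> \<psi>)"

definition stationary_params ::
    "('a::euclidean_space \<Rightarrow> real) \<Rightarrow> ('h::{real_inner,complete_space} \<Rightarrow> real) \<Rightarrow> ('a \<Rightarrow> 'h) \<Rightarrow>
     real \<Rightarrow> 'h set" where
  "stationary_params V\<^sub>0 R \<phi> \<sigma> = {\<psi>. mean_map V\<^sub>0 R \<phi> \<sigma> \<psi> = \<psi>}"

text \<open>The elements of \<^const>\<open>P2\<close> at which the mean of \<open>\<phi>\<close>, and hence the functional derivative of
  the energy, is defined.  This is all of \<^const>\<open>P2\<close> as soon as \<open>\<phi>\<close> grows at most quadratically,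
  in particular if \<open>\<phi>\<close> is Lipschitz.\<close>

definition P2_mean :: "('a::euclidean_space \<Rightarrow> 'h::real_normed_vector) \<Rightarrow> 'a measure set" where
  "P2_mean \<phi> = {\<rho> \<in> P2. (\<integral>\<^sup>+x. ennreal (norm (\<phi> x)) \<partial>\<rho>) < \<infinity>}"

definition P2_with_mean_in ::
    "('a::euclidean_space \<Rightarrow> 'h::real_normed_vector) \<Rightarrow> 'h set \<Rightarrow> 'a measure set" where
  "P2_with_mean_in \<phi> S = {\<rho> \<in> P2. mean \<phi> \<rho> \<in> S}"

text \<open>\<open>dE\<close> is a linear functional derivative of the functional \<open>En\<close>, where \<open>D\<close> is the set of measures
  at which \<open>dE\<close> is defined.  The supremum over \<open>t\<close> is taken in \<^typ>\<open>ennreal\<close>, so its integrability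
  is the finiteness of the integral.\<close>

definition linear_functional_derivative ::
    "'a::euclidean_space measure set \<Rightarrow> ('a measure \<Rightarrow> ereal) \<Rightarrow> ('a measure \<Rightarrow> 'a \<Rightarrow> real) \<Rightarrow> bool"
where
  "linear_functional_derivative D En dE \<longleftrightarrow>
     (\<forall>\<mu>\<^sub>0\<in>P2. \<forall>\<mu>\<^sub>1\<in>P2. En \<mu>\<^sub>0 + En \<mu>\<^sub>1 < \<infinity> \<longrightarrow>
        (\<integral>\<^sup>+x. (SUP t\<in>{0..1}. ennreal \<bar>dE (mixture t \<mu>\<^sub>0 \<mu>\<^sub>1) x\<bar>) \<partial>\<mu>\<^sub>0) < \<infinity> \<and>
        (\<integral>\<^sup>+x. (SUP t\<in>{0..1}. ennreal \<bar>dE (mixture t \<mu>\<^sub>0 \<mu>\<^sub>1) x\<bar>) \<partial>\<mu>\<^sub>1) < \<infinity> \<and>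
        En \<mu>\<^sub>1 - En \<mu>\<^sub>0 = ereal (LBINT t:{0..1}.
          (\<integral>x. dE (mixture t \<mu>\<^sub>0 \<mu>\<^sub>1) x \<partial>\<mu>\<^sub>1) - (\<integral>x. dE (mixture t \<mu>\<^sub>0 \<mu>\<^sub>1) x \<partial>\<mu>\<^sub>0))) \<and>
     (\<forall>\<rho>\<in>D. \<forall>x. \<forall>\<epsilon>>0. \<exists>\<delta>>0. \<forall>\<rho>'\<in>D. \<forall>y.
        dist x y < \<delta> \<and> W2 \<rho> \<rho>' < ennreal \<delta> \<longrightarrow> \<bar>dE \<rho>' y - dE \<rho> x\<bar> < \<epsilon>) \<and>
     (\<forall>\<rho>\<in>D. C2_fun (dE \<rho>))"

end

theory Submission
  imports Defs
begin

text \<open>Contraction towards \<open>\<psi>\<^sub>s\<close> makes \<open>\<psi> - \<psi>\<^sub>s\<close> comparable with the defect \<open>f \<psi> - \<psi>\<close>: this is (i), by the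
triangle inequality.  For \<open>\<psi> = \<phi>(\<rho>)\<close> the defect is the difference of the means of \<open>\<phi>\<close> under
\<open>\<Gamma>(\<rho>)\<close> and \<open>\<rho>\<close>.  Integrating the Lipschitz bound against a coupling estimates it by the Wasserstein
distance (\<open>mean_difference_le_W2\<close>), which is (ii).

For (iii), a quadratic transport inequality would bound \<open>W2\<close> by the relative entropy, but only the mean
of \<open>\<phi>\<close> matters, and testing it against a direction \<open>u\<close> leaves the scalar Lipschitz function
\<open>\<langle>u, \<phi>\<rangle>\<close>.  For such functions the transport-entropy bound has an elementary proof.  Applied to
densities proportional to \<open>exp (l g)\<close>, the log-Sobolev inequality is a differential inequality for
\<open>l \<mapsto> ln \<integral> exp (l g) d\<mu>\<close>, which integrates to a Gaussian bound on the exponential moments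
(\<open>herbst\<close>); the variational formula for the relative entropy \<open>H\<close> (\<open>donsker_varadhan\<close>) then gives
\<open>|\<phi>(\<nu>) - \<phi>(\<mu>)|\<^sup>2 \<le> 4 \<eta> L\<^sup>2 H(\<nu>|\<mu>)\<close> (\<open>mean_transport_entropy\<close>), with the constant that
the quadratic transport inequality would give.

The other half of (iii) compares free energies.  With \<open>Z \<psi>\<close> the normalising constant of the Gibbs
weight at \<open>\<psi> = \<phi>(\<rho>)\<close>, the free energy of \<open>\<rho>\<close> is
\<open>\<sigma>\<^sup>2 H(\<rho>|\<Gamma>(\<rho>)) + R \<psi> - \<langle>\<nabla>R \<psi>, \<psi>\<rangle> - \<sigma>\<^sup>2 ln (Z \<psi>)\<close> (\<open>free_energy_eq_relative_entropy\<close>), and the same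
formula without relative entropy holds at the equilibrium.  Jensen's inequality compares the two
normalising constants (\<open>log_partition_le\<close>), and the convexity of \<open>R + \<theta> |\<cdot>|\<^sup>2\<close> bounds what is left by
\<open>\<theta> |\<psi> - \<psi>\<^sub>s|\<^sup>2\<close> (\<open>free_energy_gap\<close>).

Four points need care.  The Fisher information is defined by weak gradients, so the weak gradient of a
continuously differentiable density must be shown to exist and to be unique almost everywhere
(\<open>weak_grad_C1\<close>).  The log-Sobolev inequality is available only for laws with a second moment, which
the Gibbs measures are not assumed to have; the test densities are therefore damped at infinity
by a factor whose logarithmic gradient is arbitrarily small (\<open>entropy_exp_le\<close>).  The formula for the
free energy presupposes that \<open>V\<^sub>0\<close> is integrable, whereas finite relative entropy only makes
\<open>\<sigma>\<^sup>2 ln (d\<rho>/dx) + V\<^sub>0\<close> integrable: the second moment of \<open>\<rho>\<close> controls the positive part of \<open>V\<^sub>0\<close>, and the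
integrability that is part of the definition of a linear functional derivative controls the negative
part.  Finally, gradients of \<open>R\<close> and means of \<open>\<phi>\<close> in a Hilbert space that need not be separable are both
obtained from the Riesz representation theorem.\<close>

section \<open>Gradients in Hilbert spaces\<close>

text \<open>A representer is a minimiser of \<open>|x|\<^sup>2 - 2 l(x)\<close>.  The parallelogram law makes minimising sequences
  Cauchy, and the first variation at the minimiser \<open>g\<close> is \<open>2 (\<langle>u, g\<rangle> - l u)\<close>.\<close>

lemma riesz_representation:
  fixes l :: "'h::{real_inner,complete_space} \<Rightarrow> real"
  assumes l: "bounded_linear l"
  shows "\<exists>g. \<forall>u. l u = inner u g"
proof -
  interpret bounded_linear l by fact
  define J where "J = (\<lambda>x. (norm x)\<^sup>2 - 2 * l x)"
  obtain K where K: "\<And>x. norm (l x) \<le> norm x * K" using bounded by blast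
  have J_lower: "- K\<^sup>2 \<le> J x" for x
  proof -
    have "l x \<le> norm x * K" using K[of x] by simp
    moreover have "0 \<le> (norm x - K)\<^sup>2" by simp
    ultimately show ?thesis unfolding J_def by (simp add: power2_diff)
  qed
  define m where "m = Inf (range J)"
  have bdd: "bdd_below (range J)" using J_lower by (auto intro!: bdd_belowI)
  have m_le: "m \<le> J x" for x unfolding m_def using bdd by (auto intro: cInf_lower)
  have "\<exists>x. J x < m + 1 / real (Suc n)" for n
    using cInf_less_iff[of "range J" "m + 1 / real (Suc n)"] bdd
    unfolding m_def by auto
  then obtain X where X: "\<And>n. J (X n) < m + 1 / real (Suc n)" by metis
  have mid: "J x + J y - 2 * J ((1/2) *\<^sub>R (x + y)) = (norm (x - y))\<^sup>2 / 2" for x y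
    unfolding J_def power2_norm_eq_inner
    by (simp add: scaleR add inner_add_left inner_add_right
        inner_diff_left inner_diff_right inner_commute[of y x] algebra_simps)
  have dist_bound: "(norm (X i - X j))\<^sup>2 \<le> 2 * (1 / real (Suc i) + 1 / real (Suc j))" for i j
  proof -
    have arith: "n \<le> 2 * (a + b)"
      if "p + q - 2 * r = n / 2" "p < k + a" "q < k + b" "k \<le> r" for p q r n a b k :: real
      using that by argo
    show ?thesis
      using mid[of "X i" "X j"] X[of i] X[of j] m_le[of "(1/2) *\<^sub>R (X i + X j)"] by (rule arith)
  qed
  have "Cauchy X"
  proof (rule metric_CauchyI)
    fix e :: real assume e: "e > 0"
    obtain N :: nat where N: "4 / e\<^sup>2 < real N" using reals_Archimedean2 by blast
    have "dist (X i) (X j) < e" if "N \<le> i" "N \<le> j" for i j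
    proof -
      have pos: "0 < real N" using N e by (smt (verit) divide_nonneg_nonneg zero_le_power2)
      have "1 / real (Suc i) \<le> 1 / real N" "1 / real (Suc j) \<le> 1 / real N"
        using that pos by (auto simp: frac_le)
      then have "(norm (X i - X j))\<^sup>2 \<le> 4 / real N" using dist_bound[of i j] by simp
      also have "\<dots> < e\<^sup>2" using N e pos by (simp add: field_simps)
      finally show ?thesis using e by (simp add: dist_norm power_less_imp_less_base)
    qed
    then show "\<exists>M. \<forall>m\<ge>M. \<forall>n\<ge>M. dist (X m) (X n) < e" by blast
  qed
  then obtain g where g: "X \<longlonglongrightarrow> g" using Cauchy_convergent_iff convergent_def by blast
  have "(\<lambda>n. J (X n)) \<longlonglongrightarrow> J g"
    unfolding J_def by (intro tendsto_intros g tendsto)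
  moreover have "(\<lambda>n. m + 1 / real (Suc n)) \<longlonglongrightarrow> m"
    using LIMSEQ_inverse_real_of_nat_add[of m] by (simp add: inverse_eq_divide)
  ultimately have J_min: "J g \<le> m"
    by (rule LIMSEQ_le) (use X in \<open>auto intro!: less_imp_le\<close>)
  have "l u = inner u g" for u
  proof -
    have quad: "0 \<le> 2 * t * (inner u g - l u) + t\<^sup>2 * (norm u)\<^sup>2" for t
    proof -
      have "J g \<le> J (g + t *\<^sub>R u)" using J_min m_le order_trans by blast
      then show ?thesis unfolding J_def power2_norm_eq_inner
        by (simp add: scaleR add inner_add_left inner_add_right
            inner_commute[of g u] algebra_simps power2_eq_square)
    qed
    \<comment> \<open>At \<open>t = - d / c\<close> the quadratic is at most \<open>- d\<^sup>2 / c\<close>; the summand \<open>1\<close> in \<open>c\<close> covers \<open>u = 0\<close>.\<close>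
    define d where "d = inner u g - l u"
    define c where "c = (norm u)\<^sup>2 + 1"
    have c: "c > 0" unfolding c_def by (simp add: add_nonneg_pos)
    have "0 \<le> 2 * (- d / c) * d + (- d / c)\<^sup>2 * (norm u)\<^sup>2" using quad[of "- d / c"] d_def by simp
    also have "\<dots> \<le> 2 * (- d / c) * d + (- d / c)\<^sup>2 * c"
      unfolding c_def by (intro add_left_mono mult_left_mono) auto
    also have "\<dots> = - (d\<^sup>2 / c)" using c by (simp add: field_simps power2_eq_square)
    finally have "d = 0" using c by (simp add: divide_le_0_iff zero_less_mult_iff)
    then show ?thesis by (simp add: d_def)
  qed
  then show ?thesis by blast
qed

lemma GDERIV_unique:
  assumes "GDERIV f x :> D" "GDERIV f x :> E"
  shows "D = E"
proof -
  have "(\<lambda>h. inner h D) = (\<lambda>h. inner h E)"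
    using assms has_derivative_unique unfolding gderiv_def by blast
  then have "inner (D - E) D = inner (D - E) E" by meson
  then have "inner (D - E) (D - E) = 0" by (simp add: inner_diff_right)
  then show ?thesis by simp
qed

lemma grad_eqI: "GDERIV f x :> D \<Longrightarrow> grad f x = D"
  unfolding grad_def using GDERIV_unique by blast

text \<open>In a complete space a derivative is represented by a gradient, so the definite description in
  \<^const>\<open>grad\<close> denotes.\<close>

lemma GDERIV_grad:
  fixes f :: "'h::{real_inner,complete_space} \<Rightarrow> real"
  assumes "(f has_derivative f') (at x)"
  shows "GDERIV f x :> grad f x"
proof -
  obtain g where "\<forall>u. f' u = inner u g"
    using riesz_representation[OF has_derivative_bounded_linear[OF assms]] by blast
  then have "f' = (\<lambda>h. inner h g)" by (simp add: fun_eq_iff)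
  then have "GDERIV f x :> g" using assms unfolding gderiv_def by simp
  then show ?thesis using grad_eqI by metis
qed

lemma convex_above_tangent:
  fixes f :: "'h::{real_inner,complete_space} \<Rightarrow> real"
  assumes f: "convex_on UNIV f" and d: "GDERIV f x :> g"
  shows "f x + inner (y - x) g \<le> f y"
proof -
  define p where "p = (\<lambda>t::real. x + t *\<^sub>R (y - x))"
  have "((\<lambda>t. f (p t)) has_derivative (\<lambda>t. inner (t *\<^sub>R (y - x)) g)) (at 0)"
  proof (rule has_derivative_compose[where f = p and g = f and g' = "\<lambda>h. inner h g"])
    show "(p has_derivative (\<lambda>t. t *\<^sub>R (y - x))) (at 0)"
      unfolding p_def by (auto intro!: derivative_eq_intros)
    show "(f has_derivative (\<lambda>h. inner h g)) (at (p 0))"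
      using d unfolding gderiv_def p_def by simp
  qed
  then have D: "((\<lambda>t. f (p t)) has_real_derivative inner (y - x) g) (at 0)"
    unfolding has_field_derivative_def by (rule has_derivative_eq_rhs) (simp add: fun_eq_iff)
  have "((\<lambda>t. (f (p t) - f x) / t) \<longlongrightarrow> inner (y - x) g) (at_right 0)"
    using D unfolding has_field_derivative_iff p_def
    by (auto intro: tendsto_mono[OF at_le])
  moreover have "\<forall>\<^sub>F t in at_right 0. (f (p t) - f x) / t \<le> f y - f x"
    unfolding eventually_at_right_field
  proof (intro exI[of _ 1] conjI allI impI)
    fix t :: real assume t: "0 < t" "t < 1"
    have "f ((1 - t) *\<^sub>R x + t *\<^sub>R y) \<le> (1 - t) * f x + t * f y"
      using t by (intro convex_onD[OF f]) auto
    moreover have "(1 - t) *\<^sub>R x + t *\<^sub>R y = p t" by (simp add: p_def algebra_simps)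
    ultimately show "(f (p t) - f x) / t \<le> f y - f x" using t by (simp add: field_simps)
  qed simp
  ultimately have "inner (y - x) g \<le> f y - f x"
    by (intro tendsto_upperbound) (auto simp: trivial_limit_at_right_real)
  then show ?thesis by simp
qed

section \<open>The mean of a continuous map into a Hilbert space\<close>

text \<open>Scalar products turn the vector-valued mean into ordinary Lebesgue integrals.  This is the only
  access to means that the later arguments use.\<close>

lemma has_bochner_inner:
  fixes f :: "'s \<Rightarrow> 'h::real_inner"
  assumes "has_bochner M f v"
  shows "has_bochner_integral M (\<lambda>x. inner u (f x)) (inner u v)"
proof -
  obtain s where [measurable]: "f \<in> borel_measurable M"
    and s: "\<And>i. Bochner_Integration.simple_bochner_integrable M (s i)"
    and lim: "(\<lambda>i. \<integral>\<^sup>+x. ennreal (norm (f x - s i x)) \<partial>M) \<longlonglongrightarrow> 0"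
    and val: "(\<lambda>i. Bochner_Integration.simple_bochner_integral M (s i)) \<longlonglongrightarrow> v"
    using assms unfolding has_bochner_def by blast
  have [measurable]: "(\<lambda>x. inner u (f x)) \<in> borel_measurable M"
    using measurable_comp[of f M borel "inner u" borel]
    by (simp add: comp_def borel_measurable_continuous_onI continuous_on_inner continuous_on_const continuous_on_id)
  show ?thesis
  proof (rule has_bochner_integral.intros)
    fix i show "Bochner_Integration.simple_bochner_integrable M (\<lambda>x. inner u (s i x))"
      using simple_bochner_integrable_compose2[where p = "\<lambda>x y. inner u x", OF _ s s] by simp
  next
    have nd: "(\<lambda>x. ennreal (norm (f x - s i x))) \<in> borel_measurable M" for i
    proof (rule measurable_compose_countable'[where I = "s i ` space M" and g = "s i"
          and f = "\<lambda>y x. ennreal (norm (f x - y))"])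
      have sf: "simple_function M (s i)" using s by (auto elim: simple_bochner_integrable.cases)
      show "s i \<in> measurable M (count_space (s i ` space M))"
        using sf by (subst measurable_count_space_eq2) (auto simp: simple_function_def)
      show "countable (s i ` space M)" using sf by (simp add: simple_function_def countable_finite)
    next
      fix y :: 'h
      have "(\<lambda>z. norm (z - y)) \<in> borel_measurable borel"
        by (intro borel_measurable_continuous_onI continuous_intros)
      then have "(\<lambda>x. norm (f x - y)) \<in> borel_measurable M"
        by (rule measurable_compose[rotated]) fact
      then show "(\<lambda>x. ennreal (norm (f x - y))) \<in> borel_measurable M"
        by simp
    qed
    have le: "(\<integral>\<^sup>+x. norm (inner u (f x) - inner u (s i x)) \<partial>M)
        \<le> ennreal (norm u) * (\<integral>\<^sup>+x. ennreal (norm (f x - s i x)) \<partial>M)" for i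
    proof -
      have "(\<integral>\<^sup>+x. norm (inner u (f x) - inner u (s i x)) \<partial>M)
          \<le> (\<integral>\<^sup>+x. ennreal (norm u) * ennreal (norm (f x - s i x)) \<partial>M)"
      proof (rule nn_integral_mono)
        fix x
        have "norm (inner u (f x) - inner u (s i x)) \<le> norm u * norm (f x - s i x)"
          using Cauchy_Schwarz_ineq2[of u "f x - s i x"] by (simp add: inner_diff_right)
        then have "ennreal (norm (inner u (f x) - inner u (s i x)))
            \<le> ennreal (norm u * norm (f x - s i x))"
          by (rule ennreal_leI)
        then show "ennreal (norm (inner u (f x) - inner u (s i x)))
            \<le> ennreal (norm u) * ennreal (norm (f x - s i x))"
          by (simp only: ennreal_mult[OF norm_ge_zero norm_ge_zero])
      qed
      also have "\<dots> = ennreal (norm u) * (\<integral>\<^sup>+x. ennreal (norm (f x - s i x)) \<partial>M)"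
        by (rule nn_integral_cmult) (rule nd)
      finally show ?thesis .
    qed
    show "(\<lambda>i. \<integral>\<^sup>+x. norm (inner u (f x) - inner u (s i x)) \<partial>M) \<longlonglongrightarrow> 0"
    proof (rule tendsto_sandwich[OF _ _ tendsto_const])
      show "(\<lambda>i. ennreal (norm u) * (\<integral>\<^sup>+x. ennreal (norm (f x - s i x)) \<partial>M)) \<longlonglongrightarrow> 0"
        using ennreal_tendsto_cmult[OF _ lim, of "ennreal (norm u)"] by simp
    qed (auto intro!: always_eventually le[unfolded real_norm_def])
  next
    have "Bochner_Integration.simple_bochner_integral M (\<lambda>x. inner u (s i x)) = inner u (Bochner_Integration.simple_bochner_integral M (s i))" for i
      by (rule simple_bochner_integral_linear[OF _ s])
        (simp add: bounded_linear.linear bounded_linear_inner_right)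
    then show "(\<lambda>i. Bochner_Integration.simple_bochner_integral M (\<lambda>x. inner u (s i x))) \<longlonglongrightarrow> inner u v"
      using tendsto_inner[OF tendsto_const val] by simp
  qed fact
qed

text \<open>The range of a continuous map on a Euclidean space is separable.  The approximation takes the first
  best value among finitely many members of a countable dense subset of the range; the value \<open>0\<close> is put
  in front so that the error never exceeds the norm of the function.\<close>

lemma simple_approximation:
  fixes f :: "'a::euclidean_space \<Rightarrow> 'h::real_normed_vector"
  assumes f: "continuous_on UNIV f" and M: "sets M = sets borel"
  shows "\<exists>s. (\<forall>i. simple_function M (s i)) \<and> (\<forall>x. (\<lambda>i. s i x) \<longlonglongrightarrow> f x) \<and>
    (\<forall>i x. norm (f x - s i x) \<le> norm (f x)) \<and>
    (\<forall>i. (\<lambda>x. norm (f x - s i x)) \<in> borel_measurable M)"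
proof -
  note [measurable_cong] = M
  obtain D :: "'a set" where D: "countable D" "\<And>X. open X \<Longrightarrow> X \<noteq> {} \<Longrightarrow> \<exists>d\<in>D. d \<in> X"
    by (rule countable_dense_setE) blast
  have "D \<noteq> {}" using D(2)[of UNIV] by auto
  define c where "c = (\<lambda>n. case n of 0 \<Rightarrow> 0 | Suc k \<Rightarrow> f (from_nat_into D k))"
  define P where "P = (\<lambda>n x j. j \<le> n \<and> (\<forall>i\<in>{..n}. norm (f x - c j) \<le> norm (f x - c i)))"
  define J where "J = (\<lambda>n x. LEAST j. P n x j)"
  have [measurable]: "(\<lambda>x. norm (f x - y)) \<in> borel_measurable M" for y
  proof -
    have "(\<lambda>x. norm (f x - y)) \<in> borel_measurable borel"
      by (intro borel_measurable_continuous_onI continuous_intros f)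
    then show ?thesis by simp
  qed
  have ex: "\<exists>j. P n x j" for n x
  proof -
    have "\<exists>j\<in>{..n}. \<forall>i\<in>{..n}. norm (f x - c j) \<le> norm (f x - c i)"
      using ex_is_arg_min_if_finite[of "{..n}" "\<lambda>j. norm (f x - c j)"]
      by (auto simp: is_arg_min_linorder)
    then show ?thesis unfolding P_def by auto
  qed
  have PJ: "P n x (J n x)" for n x unfolding J_def using ex by (rule LeastI_ex)
  have [measurable]: "J n \<in> measurable M (count_space UNIV)" for n
    unfolding J_def P_def by measurable
  have J_simple: "simple_function M (J n)" for n
    unfolding simple_function_def
  proof (intro conjI ballI)
    show "finite (J n ` space M)"
      by (rule finite_subset[of _ "{..n}"]) (use PJ in \<open>auto simp: P_def\<close>)
  qed measurable
  have min: "norm (f x - c (J n x)) \<le> norm (f x - c i)" if "i \<le> n" for i n x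
    using PJ[of n x] that unfolding P_def by auto
  define s where "s = (\<lambda>n x. c (J n x))"
  have 1: "simple_function M (s n)" for n
    unfolding s_def by (rule simple_function_compose1[OF J_simple])
  have 2: "norm (f x - s n x) \<le> norm (f x)" for n x
    using min[of 0 n x] by (simp add: s_def c_def)
  have 3: "(\<lambda>n. s n x) \<longlonglongrightarrow> f x" for x
  proof (rule metric_LIMSEQ_I)
    fix e :: real assume e: "0 < e"
    have "open (f -` ball (f x) e)"
      using f by (simp add: continuous_on_open_vimage)
    then obtain d where d: "d \<in> D" "d \<in> f -` ball (f x) e"
      using D(2)[of "f -` ball (f x) e"] e by (metis centre_in_ball empty_iff vimageI)
    obtain k where "d = from_nat_into D k" using from_nat_into_surj[OF D(1) d(1)] by metis
    then have k: "norm (f x - c (Suc k)) < e" using d(2) by (simp add: c_def dist_norm)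
    have "dist (s n x) (f x) < e" if "Suc k \<le> n" for n
      using min[OF that, of x] k by (simp add: s_def dist_norm norm_minus_commute)
    then show "\<exists>no. \<forall>n\<ge>no. dist (s n x) (f x) < e" by blast
  qed
  have 4: "(\<lambda>x. norm (f x - s n x)) \<in> borel_measurable M" for n
    unfolding s_def
    by (rule measurable_compose_countable[where f = "\<lambda>j x. norm (f x - c j)"]) measurable
  show ?thesis using 1 2 3 4 by blast
qed

text \<open>The limit of the simple integrals is identified beforehand, as the Riesz representer of
  \<open>u \<mapsto> \<integral> \<langle>u, f\<rangle> dM\<close>; testing the error against itself shows that its norm is at most the integral of
  the norm of the difference.\<close>

lemma has_bochner_exists:
  fixes f :: "'a::euclidean_space \<Rightarrow> 'h::{real_inner,complete_space}"
  assumes "finite_measure M" and M: "sets M = sets borel"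
    and f: "continuous_on UNIV f" and fin: "(\<integral>\<^sup>+x. ennreal (norm (f x)) \<partial>M) < \<infinity>"
  shows "\<exists>v. has_bochner M f v"
proof -
  interpret finite_measure M by fact
  note [measurable_cong] = M
  have f_meas [measurable]: "f \<in> borel_measurable M"
    using borel_measurable_continuous_onI[OF f] by simp
  have [measurable]: "(\<lambda>x. norm (f x)) \<in> borel_measurable M"
    using borel_measurable_continuous_onI[OF continuous_on_norm[OF f]] by simp
  have [measurable]: "(\<lambda>x. inner u (f x)) \<in> borel_measurable M" for u
    using borel_measurable_continuous_onI[OF continuous_on_inner[OF continuous_on_const f]] by simp
  obtain s where s: "\<And>i. simple_function M (s i)" and lim: "\<And>x. (\<lambda>i. s i x) \<longlonglongrightarrow> f x"
    and bound: "\<And>i x. norm (f x - s i x) \<le> norm (f x)"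
    and diff [measurable]: "\<And>i. (\<lambda>x. norm (f x - s i x)) \<in> borel_measurable M"
    using simple_approximation[OF f M] by blast
  have s_int: "Bochner_Integration.simple_bochner_integrable M (s i)" for i
    using s by (auto intro: simple_bochner_integrable.intros)
  have conv: "(\<lambda>i. \<integral>\<^sup>+x. ennreal (norm (f x - s i x)) \<partial>M) \<longlonglongrightarrow> (\<integral>\<^sup>+x. 0 \<partial>M)"
  proof (rule nn_integral_dominated_convergence[where w = "\<lambda>x. ennreal (norm (f x))"])
    show "AE x in M. (\<lambda>i. ennreal (norm (f x - s i x))) \<longlonglongrightarrow> 0"
    proof (rule AE_I2)
      fix x
      have "(\<lambda>i. norm (f x - s i x)) \<longlonglongrightarrow> norm (f x - f x)" by (intro tendsto_intros lim)
      then have "(\<lambda>i. norm (f x - s i x)) \<longlonglongrightarrow> 0" by simp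
      then have "(\<lambda>i. ennreal (norm (f x - s i x))) \<longlonglongrightarrow> ennreal 0" by (rule tendsto_ennrealI)
      then show "(\<lambda>i. ennreal (norm (f x - s i x))) \<longlonglongrightarrow> 0" by simp
    qed
  qed (use fin bound in \<open>auto intro: ennreal_leI\<close>)
  have int_norm: "integrable M (\<lambda>x. norm (f x))"
    using fin by (auto simp: integrable_iff_bounded)
  have int_inner: "integrable M (\<lambda>x. inner u (f x))" for u
  proof (rule Bochner_Integration.integrable_bound)
    show "integrable M (\<lambda>x. norm u * norm (f x))" using int_norm by simp
    show "AE x in M. norm (inner u (f x)) \<le> norm (norm u * norm (f x))"
      by (auto simp: Cauchy_Schwarz_ineq2)
  qed measurable
  define l where "l = (\<lambda>u. \<integral>x. inner u (f x) \<partial>M)"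
  have "bounded_linear l"
  proof (rule bounded_linear_intro[where K = "\<integral>x. norm (f x) \<partial>M"])
    show "l (x + y) = l x + l y" for x y
      unfolding l_def by (simp add: inner_add_left int_inner)
    show "l (r *\<^sub>R x) = r *\<^sub>R l x" for r x
      unfolding l_def by simp
    show "norm (l x) \<le> norm x * (\<integral>x. norm (f x) \<partial>M)" for x
    proof -
      have "norm (l x) \<le> (\<integral>y. norm x * norm (f y) \<partial>M)"
        unfolding l_def
      proof (rule order_trans[OF integral_norm_bound], rule integral_mono)
        show "integrable M (\<lambda>y. norm (inner x (f y)))" using int_inner by simp
        show "integrable M (\<lambda>y. norm x * norm (f y))" using int_norm by simp
        show "norm (inner x (f y)) \<le> norm x * norm (f y)" for y
          using Cauchy_Schwarz_ineq2[of x "f y"] by simp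
      qed
      then show ?thesis by simp
    qed
  qed
  then obtain v where v: "\<And>u. l u = inner u v" using riesz_representation by blast
  have inner_simple: "has_bochner_integral M (\<lambda>x. inner u (s i x))
      (inner u (Bochner_Integration.simple_bochner_integral M (s i)))" for u i
  proof -
    have "Bochner_Integration.simple_bochner_integrable M (\<lambda>x. inner u (s i x))"
      using simple_bochner_integrable_compose2[where p = "\<lambda>x y. inner u x", OF _ s_int s_int] by simp
    then have "has_bochner_integral M (\<lambda>x. inner u (s i x))
        (Bochner_Integration.simple_bochner_integral M (\<lambda>x. inner u (s i x)))"
      by (rule has_bochner_integral_simple_bochner_integrable)
    then show ?thesis
      by (simp add: simple_bochner_integral_linear[OF _ s_int] bounded_linear.linear
          bounded_linear_inner_right)
  qed
  have dist_le: "ennreal (norm (Bochner_Integration.simple_bochner_integral M (s i) - v))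
      \<le> (\<integral>\<^sup>+x. ennreal (norm (f x - s i x)) \<partial>M)" for i
  proof -
    have int_diff: "integrable M (\<lambda>x. norm (f x - s i x))"
      by (rule Bochner_Integration.integrable_bound[OF int_norm]) (auto simp: bound)
    define w where "w = v - Bochner_Integration.simple_bochner_integral M (s i)"
    have "norm w * norm w = inner w w" by (simp add: norm_eq_sqrt_inner)
    also have "\<dots> = (\<integral>x. inner w (f x) \<partial>M) - (\<integral>x. inner w (s i x) \<partial>M)"
      using v[of w] has_bochner_integral_integral_eq[OF inner_simple, of w i]
      by (simp add: l_def w_def inner_diff_right)
    also have "\<dots> = (\<integral>x. inner w (f x - s i x) \<partial>M)"
      using int_inner[of w] inner_simple[of w i]
      by (subst Bochner_Integration.integral_diff[symmetric])
        (auto simp: inner_diff_right has_bochner_integral_iff)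
    also have "\<dots> \<le> (\<integral>x. norm w * norm (f x - s i x) \<partial>M)"
    proof (rule integral_mono)
      show "integrable M (\<lambda>x. inner w (f x - s i x))"
        using int_inner[of w] inner_simple[of w i] by (auto simp: inner_diff_right has_bochner_integral_iff)
    qed (auto simp: int_diff norm_cauchy_schwarz)
    finally have "norm w * norm w \<le> norm w * (\<integral>x. norm (f x - s i x) \<partial>M)" by simp
    then have "norm w \<le> (\<integral>x. norm (f x - s i x) \<partial>M)"
      by (cases "w = 0") auto
    then have "ennreal (norm w) \<le> (\<integral>\<^sup>+x. ennreal (norm (f x - s i x)) \<partial>M)"
      using int_diff by (subst nn_integral_eq_integral) (auto intro: ennreal_leI)
    then show ?thesis by (simp add: w_def norm_minus_commute)
  qed
  have conv0: "(\<lambda>i. \<integral>\<^sup>+x. ennreal (norm (f x - s i x)) \<partial>M) \<longlonglongrightarrow> 0"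
    using conv by simp
  define n where "n = (\<lambda>i. norm (Bochner_Integration.simple_bochner_integral M (s i) - v))"
  have "(\<lambda>i. ennreal (n i)) \<longlonglongrightarrow> 0"
  proof (rule tendsto_sandwich[OF _ _ tendsto_const conv0])
    show "\<forall>\<^sub>F i in sequentially. ennreal (n i) \<le> (\<integral>\<^sup>+x. ennreal (norm (f x - s i x)) \<partial>M)"
      unfolding n_def by (intro always_eventually allI dist_le)
  qed simp
  then have "n \<longlonglongrightarrow> 0"
    using tendsto_ennreal_iff[of n sequentially 0] by (simp add: n_def)
  then have "(\<lambda>i. Bochner_Integration.simple_bochner_integral M (s i)) \<longlonglongrightarrow> v"
    unfolding n_def using LIM_zero_cancel tendsto_norm_zero_iff by blast
  then have "has_bochner M f v"
    unfolding has_bochner_def using f_meas s_int conv0 by blast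
  then show ?thesis ..
qed

lemma has_bochner_unique:
  fixes f :: "'s \<Rightarrow> 'h::real_inner"
  assumes "has_bochner M f v" "has_bochner M f w"
  shows "v = w"
proof -
  have "inner (v - w) v = inner (v - w) w"
    using assms by (auto intro: has_bochner_integral_eq dest!: has_bochner_inner)
  then have "inner (v - w) (v - w) = 0" by (simp add: inner_diff_right)
  then show ?thesis by simp
qed

lemma mean_inner:
  fixes f :: "'a::euclidean_space \<Rightarrow> 'h::{real_inner,complete_space}"
  assumes "finite_measure M" "sets M = sets borel" "continuous_on UNIV f"
    and "(\<integral>\<^sup>+x. ennreal (norm (f x)) \<partial>M) < \<infinity>"
  shows "has_bochner_integral M (\<lambda>x. inner u (f x)) (inner u (mean f M))"
proof -
  obtain v where v: "has_bochner M f v" using has_bochner_exists[OF assms] by blast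
  have "(THE v. has_bochner M f v) = v"
    using v has_bochner_unique[OF _ v] by (rule the_equality)
  then have "mean f M = v"
    unfolding mean_def using v by (metis (no_types, lifting))
  then show ?thesis using has_bochner_inner[OF v] by simp
qed

section \<open>Means of Lipschitz maps and the Wasserstein distance\<close>

text \<open>A Lipschitz map grows at most linearly, hence at most quadratically.\<close>

lemma lipschitz_norm_finite_P2:
  fixes f :: "'a::euclidean_space \<Rightarrow> 'h::real_normed_vector"
  assumes rho: "\<rho> \<in> P2" and lip: "lipschitz_on L UNIV f"
  shows "(\<integral>\<^sup>+x. ennreal (norm (f x)) \<partial>\<rho>) < \<infinity>"
proof -
  interpret prob_space \<rho> using rho by (simp add: P2_def)
  have [measurable_cong]: "sets \<rho> = sets borel" using rho by (simp add: P2_def)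
  have L0: "0 \<le> L" using lip by (simp add: lipschitz_on_def)
  have le: "norm (f x) \<le> norm (f 0) + L + L * (norm x)\<^sup>2" for x :: 'a
  proof -
    have "norm (f x) \<le> norm (f 0) + norm (f x - f 0)" by (metis add.commute diff_add_cancel norm_triangle_ineq)
    moreover have "norm (f x - f 0) \<le> L * norm x"
      using lip unfolding lipschitz_on_def by (metis UNIV_I diff_zero dist_norm)
    moreover have "norm x \<le> 1 + (norm x)\<^sup>2"
    proof -
      have "0 \<le> (norm x - 1)\<^sup>2" by simp
      then have "2 * norm x \<le> 1 + (norm x)\<^sup>2" by (simp add: power2_diff)
      then show ?thesis using norm_ge_zero[of x] by linarith
    qed
    then have "L * norm x \<le> L * (1 + (norm x)\<^sup>2)" using L0 by (rule mult_left_mono)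
    ultimately show ?thesis by (simp add: distrib_left)
  qed
  have "(\<integral>\<^sup>+x. ennreal (norm (f x)) \<partial>\<rho>)
      \<le> (\<integral>\<^sup>+x. ennreal (norm (f 0) + L) + ennreal L * ennreal ((norm x)\<^sup>2) \<partial>\<rho>)"
  proof (rule nn_integral_mono)
    fix x :: 'a
    have "ennreal (norm (f 0) + L) + ennreal L * ennreal ((norm x)\<^sup>2)
        = ennreal (norm (f 0) + L + L * (norm x)\<^sup>2)"
      using L0 by (simp add: ennreal_mult[symmetric] ennreal_plus[symmetric] del: ennreal_plus)
    then show "ennreal (norm (f x)) \<le> ennreal (norm (f 0) + L) + ennreal L * ennreal ((norm x)\<^sup>2)"
      using le[of x] by (simp add: ennreal_leI del: ennreal_plus)
  qed
  also have "\<dots> = ennreal (norm (f 0) + L) + ennreal L * (\<integral>\<^sup>+x. ennreal ((norm x)\<^sup>2) \<partial>\<rho>)"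
    by (simp add: nn_integral_add nn_integral_cmult emeasure_space_1)
  also have "\<dots> < \<infinity>" using rho by (simp add: P2_def ennreal_mult_less_top)
  finally show ?thesis .
qed

text \<open>Tested against the difference \<open>u\<close> of the means, this is
  \<open>|u|\<^sup>2 = \<integral> (g(x) - g(y)) d\<pi> \<le> |u| L \<integral> |x - y| d\<pi>\<close> with \<open>g = \<langle>u, f\<rangle>\<close>, and the first moment of the distance is at
  most its second moment, by the positivity of the variance.\<close>

lemma mean_difference_coupling:
  fixes f :: "'a::euclidean_space \<Rightarrow> 'h::{real_inner,complete_space}"
  assumes lip: "lipschitz_on L UNIV f"
    and rho: "prob_space \<rho>" "sets \<rho> = sets borel" "(\<integral>\<^sup>+x. ennreal (norm (f x)) \<partial>\<rho>) < \<infinity>"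
    and gam: "prob_space \<gamma>" "sets \<gamma> = sets borel" "(\<integral>\<^sup>+x. ennreal (norm (f x)) \<partial>\<gamma>) < \<infinity>"
    and coup: "\<pi> \<in> couplings \<rho> \<gamma>"
    and fin: "(\<integral>\<^sup>+(x, y). ennreal ((dist x y)\<^sup>2) \<partial>\<pi>) \<noteq> \<infinity>"
  shows "ennreal ((norm (mean f \<rho> - mean f \<gamma>))\<^sup>2)
    \<le> ennreal (L\<^sup>2) * (\<integral>\<^sup>+(x, y). ennreal ((dist x y)\<^sup>2) \<partial>\<pi>)"
proof -
  interpret rho: prob_space \<rho> by fact
  interpret gam: prob_space \<gamma> by fact
  have L0: "0 \<le> L" using lip by (simp add: lipschitz_on_def)
  have f_cont: "continuous_on UNIV f" by (rule lipschitz_on_continuous_on[OF lip])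
  have sets_pi [measurable_cong]: "sets \<pi> = sets borel"
    and d1: "distr \<pi> borel fst = \<rho>" and d2: "distr \<pi> borel snd = \<gamma>"
    using coup by (auto simp: couplings_def)
  have bfst: "fst \<in> borel_measurable (borel :: ('a \<times> 'a) measure)"
    by (intro borel_measurable_continuous_onI continuous_intros)
  have bsnd: "snd \<in> borel_measurable (borel :: ('a \<times> 'a) measure)"
    by (intro borel_measurable_continuous_onI continuous_intros)
  have fst [measurable]: "fst \<in> borel_measurable \<pi>"
    unfolding measurable_cong_sets[OF sets_pi refl] by (rule bfst)
  have snd [measurable]: "snd \<in> borel_measurable \<pi>"
    unfolding measurable_cong_sets[OF sets_pi refl] by (rule bsnd)
  have "emeasure \<pi> (space \<pi>) = emeasure (distr \<pi> borel fst) UNIV"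
    by (subst emeasure_distr) auto
  also have "\<dots> = 1" using rho.emeasure_space_1 sets_eq_imp_space_eq[OF rho(2)] by (simp add: d1)
  finally interpret pi: prob_space \<pi> by (rule prob_spaceI)
  define D where "D = (\<lambda>z :: 'a \<times> 'a. dist (fst z) (snd z))"
  have [measurable]: "D \<in> borel_measurable \<pi>" unfolding D_def by measurable
  have cost: "(\<integral>\<^sup>+(x, y). ennreal ((dist x y)\<^sup>2) \<partial>\<pi>) = (\<integral>\<^sup>+z. ennreal ((D z)\<^sup>2) \<partial>\<pi>)"
    unfolding D_def by (intro nn_integral_cong) (simp add: case_prod_beta)
  have D2: "integrable \<pi> (\<lambda>z. (D z)\<^sup>2)"
    using fin unfolding cost by (auto simp: integrable_iff_bounded less_top)
  have D1: "integrable \<pi> D"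
  proof (rule Bochner_Integration.integrable_bound[where f = "\<lambda>z. 1 + (D z)\<^sup>2"])
    show "integrable \<pi> (\<lambda>z. 1 + (D z)\<^sup>2)" using D2 by simp
    show "AE z in \<pi>. norm (D z) \<le> norm (1 + (D z)\<^sup>2)"
    proof (rule AE_I2)
      fix z
      have "0 \<le> (\<bar>D z\<bar> - 1)\<^sup>2 + \<bar>D z\<bar>" by simp
      then have "\<bar>D z\<bar> \<le> 1 + (D z)\<^sup>2" by (simp add: power2_diff)
      then show "norm (D z) \<le> norm (1 + (D z)\<^sup>2)" by simp
    qed
  qed measurable
  define m where "m = (\<integral>z. D z \<partial>\<pi>)"
  have m0: "0 \<le> m" unfolding m_def D_def by simp
  have "0 \<le> (\<integral>z. (D z - m)\<^sup>2 \<partial>\<pi>)" by simp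
  also have "\<dots> = (\<integral>z. (D z)\<^sup>2 - 2 * m * D z + m\<^sup>2 \<partial>\<pi>)"
    by (intro Bochner_Integration.integral_cong) (simp_all add: power2_diff algebra_simps)
  also have "\<dots> = (\<integral>z. (D z)\<^sup>2 \<partial>\<pi>) - 2 * m * m + m\<^sup>2"
    using D1 D2 by (simp add: pi.prob_space m_def)
  finally have jensen: "m\<^sup>2 \<le> (\<integral>z. (D z)\<^sup>2 \<partial>\<pi>)" by (simp add: power2_eq_square)
  define u where "u = mean f \<rho> - mean f \<gamma>"
  define g where "g = (\<lambda>x. inner u (f x))"
  have gm [measurable]: "g \<in> borel_measurable borel"
    unfolding g_def by (intro borel_measurable_continuous_onI continuous_intros f_cont)
  have i1: "has_bochner_integral \<rho> g (inner u (mean f \<rho>))"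
    unfolding g_def by (rule mean_inner[OF rho.finite_measure_axioms rho(2) f_cont rho(3)])
  have i2: "has_bochner_integral \<gamma> g (inner u (mean f \<gamma>))"
    unfolding g_def by (rule mean_inner[OF gam.finite_measure_axioms gam(2) f_cont gam(3)])
  have j1: "integrable \<pi> (\<lambda>z. g (fst z))" "(\<integral>z. g (fst z) \<partial>\<pi>) = inner u (mean f \<rho>)"
    using i1 integrable_distr_eq[OF fst gm] integral_distr[OF fst gm]
    by (auto simp: has_bochner_integral_iff d1)
  have j2: "integrable \<pi> (\<lambda>z. g (snd z))" "(\<integral>z. g (snd z) \<partial>\<pi>) = inner u (mean f \<gamma>)"
    using i2 integrable_distr_eq[OF snd gm] integral_distr[OF snd gm]
    by (auto simp: has_bochner_integral_iff d2)
  have "norm u * norm u = inner u u" by (simp add: norm_eq_sqrt_inner)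
  also have "\<dots> = (\<integral>z. g (fst z) - g (snd z) \<partial>\<pi>)"
    using j1 j2 by (simp add: u_def inner_diff_right)
  also have "\<dots> \<le> (\<integral>z. norm u * L * D z \<partial>\<pi>)"
  proof (rule integral_mono)
    show "integrable \<pi> (\<lambda>z. g (fst z) - g (snd z))" using j1 j2 by simp
    show "integrable \<pi> (\<lambda>z. norm u * L * D z)" using D1 by simp
    fix z
    have "g (fst z) - g (snd z) \<le> norm u * norm (f (fst z) - f (snd z))"
      unfolding g_def inner_diff_right[symmetric] by (rule norm_cauchy_schwarz)
    also have "\<dots> \<le> norm u * (L * D z)"
      using lip by (intro mult_left_mono) (auto simp: lipschitz_on_def D_def dist_norm[of "f _"])
    finally show "g (fst z) - g (snd z) \<le> norm u * L * D z" by (simp add: mult.assoc)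
  qed
  also have "\<dots> = norm u * (L * m)" by (simp add: m_def mult.assoc)
  finally have "norm u \<le> L * m" using L0 m0 by (cases "u = 0") auto
  then have "(norm u)\<^sup>2 \<le> (L * m)\<^sup>2" by (intro power_mono) auto
  also have "\<dots> \<le> L\<^sup>2 * (\<integral>z. (D z)\<^sup>2 \<partial>\<pi>)"
    unfolding power_mult_distrib using jensen by (intro mult_left_mono) auto
  finally have "ennreal ((norm u)\<^sup>2) \<le> ennreal (L\<^sup>2 * (\<integral>z. (D z)\<^sup>2 \<partial>\<pi>))" by (rule ennreal_leI)
  also have "\<dots> = ennreal (L\<^sup>2) * (\<integral>\<^sup>+z. ennreal ((D z)\<^sup>2) \<partial>\<pi>)"
    using D2 by (simp add: ennreal_mult nn_integral_eq_integral)
  finally show ?thesis by (simp add: u_def cost)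
qed

lemma mean_difference_le_W2:
  fixes f :: "'a::euclidean_space \<Rightarrow> 'h::{real_inner,complete_space}"
  assumes lip: "lipschitz_on L UNIV f"
    and rho: "prob_space \<rho>" "sets \<rho> = sets borel" "(\<integral>\<^sup>+x. ennreal (norm (f x)) \<partial>\<rho>) < \<infinity>"
    and gam: "prob_space \<gamma>" "sets \<gamma> = sets borel" "(\<integral>\<^sup>+x. ennreal (norm (f x)) \<partial>\<gamma>) < \<infinity>"
  shows "ennreal (norm (mean f \<rho> - mean f \<gamma>)) \<le> ennreal L * W2 \<rho> \<gamma>"
proof (cases "L = 0")
  case True
  \<comment> \<open>The bound is then \<open>0\<close>, even where the distance is \<open>\<infinity>\<close>: a constant map has equal means.\<close>
  interpret rho: prob_space \<rho> by fact
  interpret gam: prob_space \<gamma> by fact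
  have f_cont: "continuous_on UNIV f" by (rule lipschitz_on_continuous_on[OF lip])
  define u where "u = mean f \<rho> - mean f \<gamma>"
  have const: "f x = f 0" for x using lip True by (auto simp: lipschitz_on_def)
  have "(\<integral>x. inner u (f x) \<partial>\<rho>) = inner u (f 0)"
    by (subst const) (simp add: rho.prob_space)
  moreover have "(\<integral>x. inner u (f x) \<partial>\<gamma>) = inner u (f 0)"
    by (subst const) (simp add: gam.prob_space)
  ultimately have "inner u (mean f \<rho>) = inner u (mean f \<gamma>)"
    using mean_inner[OF rho.finite_measure_axioms rho(2) f_cont rho(3), of u]
      mean_inner[OF gam.finite_measure_axioms gam(2) f_cont gam(3), of u]
    by (simp add: has_bochner_integral_iff)
  then have "inner u u = 0" by (simp add: u_def inner_diff_right)
  then show ?thesis by (simp add: u_def)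
next
  case False
  then have L: "L > 0" using lip by (simp add: lipschitz_on_def)
  define r where "r = norm (mean f \<rho> - mean f \<gamma>) / L"
  have r0: "0 \<le> r" using L by (simp add: r_def)
  have le: "ennreal (r\<^sup>2) \<le> transport_cost \<rho> \<gamma>"
    unfolding transport_cost_def
  proof (rule INF_greatest)
    fix \<pi> assume pi: "\<pi> \<in> couplings \<rho> \<gamma>"
    show "ennreal (r\<^sup>2) \<le> (\<integral>\<^sup>+(x, y). ennreal ((dist x y)\<^sup>2) \<partial>\<pi>)"
    proof (cases "(\<integral>\<^sup>+(x, y). ennreal ((dist x y)\<^sup>2) \<partial>\<pi>)")
      case (real c)
      have "ennreal ((norm (mean f \<rho> - mean f \<gamma>))\<^sup>2) \<le> ennreal (L\<^sup>2) * ennreal c"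
        using mean_difference_coupling[OF lip rho gam pi] real by simp
      then have "(norm (mean f \<rho> - mean f \<gamma>))\<^sup>2 \<le> L\<^sup>2 * c"
        using real by (simp add: ennreal_mult[symmetric])
      then have "r\<^sup>2 \<le> c" using L by (simp add: r_def power_divide divide_le_eq mult.commute)
      then show ?thesis using real by (simp add: ennreal_leI)
    qed simp
  qed
  show ?thesis
  proof (cases "transport_cost \<rho> \<gamma>")
    case (real c)
    then have "r\<^sup>2 \<le> c" using le by simp
    then have "r \<le> sqrt c" using r0 real_le_rsqrt by blast
    then have "norm (mean f \<rho> - mean f \<gamma>) \<le> L * sqrt c" using L by (simp add: r_def divide_le_eq mult.commute)
    then have "ennreal (norm (mean f \<rho> - mean f \<gamma>)) \<le> ennreal (L * sqrt c)" by (rule ennreal_leI)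
    also have "\<dots> = ennreal L * W2 \<rho> \<gamma>"
      using real L by (simp add: W2_def ennreal_mult)
    finally show ?thesis .
  next
    case top
    then show ?thesis using L by (simp add: W2_def ennreal_mult_top)
  qed
qed

section \<open>Continuously differentiable functions and weak gradients\<close>

text \<open>Gradients in place of bounded linear maps: sums, products and compositions then stay explicit, and
  the gradient can be compared with a weak gradient.\<close>

definition has_C1_grad :: "('a::real_inner \<Rightarrow> real) \<Rightarrow> ('a \<Rightarrow> 'a) \<Rightarrow> bool" where
  "has_C1_grad u D \<longleftrightarrow> (\<forall>x. GDERIV u x :> D x) \<and> continuous_on UNIV D"

lemma has_C1_gradD:
  assumes "has_C1_grad u D"
  shows "GDERIV u x :> D x" "continuous_on UNIV D" "continuous_on UNIV u" "grad u = D"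
proof -
  have *: "GDERIV u x :> D x" for x using assms by (auto simp: has_C1_grad_def)
  then show "GDERIV u x :> D x" .
  show "continuous_on UNIV D" using assms by (auto simp: has_C1_grad_def)
  show "continuous_on UNIV u"
    using * by (auto simp: continuous_on_eq_continuous_at gderiv_def intro: has_derivative_continuous)
  show "grad u = D" using grad_eqI[OF *] by auto
qed

lemma C1_fun_iff_grad:
  fixes u :: "'a::euclidean_space \<Rightarrow> real"
  shows "C1_fun u \<longleftrightarrow> has_C1_grad u (grad u)"
proof
  assume "C1_fun u"
  then obtain u' where u': "\<And>x. (u has_derivative blinfun_apply (u' x)) (at x)"
    and cont: "continuous_on UNIV u'" unfolding C1_fun_def by blast
  have G: "GDERIV u x :> grad u x" for x by (rule GDERIV_grad[OF u'])
  have "inner b (grad u x) = blinfun_apply (u' x) b" for b x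
    using has_derivative_unique[OF u' G[unfolded gderiv_def], of x] by simp
  then have "grad u = (\<lambda>x. \<Sum>b\<in>Basis. blinfun_apply (u' x) b *\<^sub>R b)"
    by (intro ext) (metis (no_types, lifting) euclidean_representation inner_commute sum.cong)
  moreover have "continuous_on UNIV (\<lambda>x. \<Sum>b\<in>Basis. blinfun_apply (u' x) b *\<^sub>R b)"
    by (intro continuous_intros cont)
  ultimately show "has_C1_grad u (grad u)" using G unfolding has_C1_grad_def by simp
next
  assume "has_C1_grad u (grad u)"
  then have "GDERIV u x :> grad u x" "continuous_on UNIV (grad u)" for x
    by (auto simp: has_C1_grad_def)
  then show "C1_fun u" unfolding C1_fun_def gderiv_def
    by (intro exI[of _ "\<lambda>x. blinfun_inner_left (grad u x)"])
      (auto intro!: bounded_linear.continuous_on[OF bounded_linear_blinfun_inner_left])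
qed

lemma has_C1_grad_imp_C1_fun:
  fixes u :: "'a::euclidean_space \<Rightarrow> real"
  shows "has_C1_grad u D \<Longrightarrow> C1_fun u"
  using has_C1_gradD(4) C1_fun_iff_grad by metis

lemma has_C1_grad_const: "has_C1_grad (\<lambda>x. c) (\<lambda>x. 0)"
  unfolding has_C1_grad_def by (simp add: GDERIV_const)

lemma has_C1_grad_add:
  assumes "has_C1_grad u U" "has_C1_grad v V"
  shows "has_C1_grad (\<lambda>x. u x + v x) (\<lambda>x. U x + V x)"
  using assms unfolding has_C1_grad_def by (auto intro!: GDERIV_add continuous_intros)

lemma has_C1_grad_mult:
  assumes "has_C1_grad u U" "has_C1_grad v V"
  shows "has_C1_grad (\<lambda>x. u x * v x) (\<lambda>x. u x *\<^sub>R V x + v x *\<^sub>R U x)"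
  using assms has_C1_gradD(3)[OF assms(1)] has_C1_gradD(3)[OF assms(2)]
  unfolding has_C1_grad_def by (auto intro!: GDERIV_mult continuous_intros)

lemma has_C1_grad_compose:
  assumes u: "has_C1_grad u U" and q: "\<And>s. (q has_real_derivative q' s) (at s)"
    and q': "continuous_on UNIV q'"
  shows "has_C1_grad (\<lambda>x. q (u x)) (\<lambda>x. q' (u x) *\<^sub>R U x)"
  unfolding has_C1_grad_def
proof (intro conjI allI)
  show "GDERIV (\<lambda>x. q (u x)) x :> q' (u x) *\<^sub>R U x" for x
    by (rule GDERIV_DERIV_compose[OF has_C1_gradD(1)[OF u] q])
  show "continuous_on UNIV (\<lambda>x. q' (u x) *\<^sub>R U x)"
    by (intro continuous_intros has_C1_gradD[OF u] continuous_on_compose2[OF q']) auto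
qed

lemma has_C1_grad_inner: "has_C1_grad (\<lambda>x. inner x b) (\<lambda>x. b)"
  unfolding has_C1_grad_def gderiv_def by (auto intro!: derivative_eq_intros)

lemma has_C1_grad_prod:
  assumes "finite I" "\<And>i. i \<in> I \<Longrightarrow> \<exists>D. has_C1_grad (u i) D"
  shows "\<exists>D. has_C1_grad (\<lambda>x. \<Prod>i\<in>I. u i x) D"
  using assms
proof (induction I rule: finite_induct)
  case empty
  then show ?case using has_C1_grad_const[of 1] by auto
next
  case (insert i I)
  then obtain D E where "has_C1_grad (u i) D" "has_C1_grad (\<lambda>x. \<Prod>i\<in>I. u i x) E" by blast
  from has_C1_grad_mult[OF this] show ?case using insert.hyps by auto
qed

lemma C2_fun_imp_C1_fun:
  assumes "C2_fun f"
  shows "C1_fun f"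
proof -
  obtain f' where f': "\<And>x. (f has_derivative blinfun_apply (f' x)) (at x)" and "C1_fun f'"
    using assms unfolding C2_fun_def by blast
  then have "continuous_on UNIV f'"
    unfolding C1_fun_def by (auto simp: continuous_on_eq_continuous_at intro: has_derivative_continuous)
  then show ?thesis unfolding C1_fun_def using f' by blast
qed

lemma C2_fun_continuous: "C2_fun f \<Longrightarrow> continuous_on UNIV f"
  unfolding C2_fun_def
  by (auto simp: continuous_on_eq_continuous_at intro: has_derivative_continuous)

lemma integrable_compact_support:
  fixes g :: "'a::euclidean_space \<Rightarrow> 'b::euclidean_space"
  assumes "continuous_on UNIV g" "compact K" "\<And>x. x \<notin> K \<Longrightarrow> g x = 0"
  shows "integrable lborel g"
proof -
  have "integrable lborel (\<lambda>x. indicator K x *\<^sub>R g x)"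
    using assms by (intro borel_integrable_compact) (auto intro: continuous_on_subset)
  moreover have "(\<lambda>x. indicator K x *\<^sub>R g x) = g" using assms(3) by (auto simp: indicator_def fun_eq_iff)
  ultimately show ?thesis by simp
qed

lemma locally_integrable_continuous:
  fixes g :: "'a::euclidean_space \<Rightarrow> 'b::euclidean_space"
  assumes "continuous_on UNIV g"
  shows "locally_integrable g"
  unfolding locally_integrable_def set_integrable_def
  using assms by (auto intro!: borel_integrable_compact intro: continuous_on_subset)

lemma grad_zero_outside:
  assumes w: "has_C1_grad w D" and K: "closed K" "\<And>x. x \<notin> K \<Longrightarrow> w x = 0" and x: "x \<notin> K"
  shows "D x = 0"
proof -
  have "((\<lambda>x. 0) has_derivative (\<lambda>h. inner h (D x))) (at x)"
  proof (rule has_derivative_transform_within_open[where s = "- K"])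
    show "(w has_derivative (\<lambda>h. inner h (D x))) (at x)"
      using has_C1_gradD(1)[OF w] by (simp add: gderiv_def)
  qed (use K x in auto)
  then have "GDERIV (\<lambda>x. 0) x :> D x" by (simp add: gderiv_def)
  then show ?thesis using GDERIV_unique GDERIV_const by blast
qed

lemma lipschitz_from_grad:
  assumes w: "has_C1_grad w D" and B: "\<And>x. norm (D x) \<le> B"
  shows "\<bar>w y - w x\<bar> \<le> B * norm (y - x)"
proof -
  have "norm (w y - w x) \<le> B * norm (y - x)"
  proof (rule differentiable_bound[OF convex_UNIV])
    show "(w has_derivative (\<lambda>h. inner h (D x))) (at x within UNIV)" for x
      using has_C1_gradD(1)[OF w] by (simp add: gderiv_def)
    show "onorm (\<lambda>h. inner h (D x)) \<le> B" for x
    proof (rule onorm_bound)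
      show "0 \<le> B" using B[of x] norm_ge_zero order_trans by blast
      fix h
      have "norm (inner h (D x)) \<le> norm h * norm (D x)" by (simp add: Cauchy_Schwarz_ineq2)
      also have "\<dots> \<le> norm h * B" using B by (intro mult_left_mono) auto
      finally show "norm (inner h (D x)) \<le> B * norm h" by (simp add: mult.commute)
    qed
  qed auto
  then show ?thesis by simp
qed

text \<open>Integration by parts without iterated integrals: by translation invariance the difference
  quotients of \<open>w\<close> have integral \<open>0\<close>, and they converge boundedly, on a common ball, to the directional
  derivatives.\<close>

lemma integral_grad_eq_0:
  fixes w :: "'a::euclidean_space \<Rightarrow> real"
  assumes w: "has_C1_grad w D" and K: "compact K" "\<And>x. x \<notin> K \<Longrightarrow> w x = 0"
  shows "(\<integral>x. D x \<partial>lborel) = 0"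
proof -
  have D0: "D x = 0" if "x \<notin> K" for x
    using grad_zero_outside[OF w compact_imp_closed[OF K(1)] K(2) that] .
  have D_int: "integrable lborel D"
    by (rule integrable_compact_support[OF has_C1_gradD(2)[OF w] K(1) D0])
  have w_int: "integrable lborel w"
    by (rule integrable_compact_support[OF has_C1_gradD(3)[OF w] K])
  have "bounded (D ` K)"
    using compact_continuous_image[OF continuous_on_subset[OF has_C1_gradD(2)[OF w]] K(1)]
    by (simp add: compact_imp_bounded)
  then obtain B where B: "B > 0" "\<And>x. x \<in> K \<Longrightarrow> norm (D x) \<le> B"
    unfolding bounded_pos by auto
  then have B': "norm (D x) \<le> B" for x using D0[of x] by (cases "x \<in> K") auto
  obtain r where r: "\<And>x. x \<in> K \<Longrightarrow> norm x \<le> r"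
    using compact_imp_bounded[OF K(1)] unfolding bounded_iff by blast
  have "(\<integral>x. D x \<partial>lborel) \<bullet> b = 0" if b: "b \<in> Basis" for b
  proof -
    define t where "t = (\<lambda>n. 1 / real (Suc n))"
    have t: "0 < t n" "t n \<le> 1" for n by (auto simp: t_def)
    have t0: "t \<longlonglongrightarrow> 0" unfolding t_def using LIMSEQ_inverse_real_of_nat by (simp add: inverse_eq_divide)
    define F where "F = (\<lambda>n x. (w (t n *\<^sub>R b + x) - w x) / t n)"
    have shift: "integrable lborel (\<lambda>x. w (c + x)) \<and> (\<integral>x. w (c + x) \<partial>lborel) = (\<integral>x. w x \<partial>lborel)" for c
    proof -
      have wm: "w \<in> borel_measurable borel" using w_int by auto
      have "integrable (distr lborel borel ((+) c)) w" using w_int by (simp add: lborel_distr_plus)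
      moreover have "(\<integral>x. w x \<partial>lborel) = (\<integral>x. w x \<partial>distr lborel borel ((+) c))"
        by (simp add: lborel_distr_plus)
      ultimately show ?thesis using wm by (simp add: integrable_distr_eq integral_distr)
    qed
    have F_int: "integrable lborel (F n)" "(\<integral>x. F n x \<partial>lborel) = 0" for n
      unfolding F_def using shift[of "t n *\<^sub>R b"] w_int by auto
    have F_lim: "(\<lambda>n. F n x) \<longlonglongrightarrow> D x \<bullet> b" for x
    proof -
      have "((\<lambda>s. w (s *\<^sub>R b + x)) has_derivative (\<lambda>s. inner (s *\<^sub>R b) (D x))) (at 0)"
      proof (rule has_derivative_compose[where f = "\<lambda>s. s *\<^sub>R b + x" and g = w
            and g' = "\<lambda>h. inner h (D x)"])
        show "((\<lambda>s. s *\<^sub>R b + x) has_derivative (\<lambda>s. s *\<^sub>R b)) (at 0)"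
          by (auto intro!: derivative_eq_intros)
        show "(w has_derivative (\<lambda>h. inner h (D x))) (at (0 *\<^sub>R b + x))"
          using has_C1_gradD(1)[OF w, of x] by (simp add: gderiv_def)
      qed
      then have "((\<lambda>s. w (s *\<^sub>R b + x)) has_real_derivative D x \<bullet> b) (at 0)"
        unfolding has_field_derivative_def
        by (rule has_derivative_eq_rhs) (simp add: fun_eq_iff inner_commute)
      then have "((\<lambda>s. (w (s *\<^sub>R b + x) - w x) / s) \<longlongrightarrow> D x \<bullet> b) (at 0)"
        by (simp add: has_field_derivative_iff)
      moreover have "filterlim t (at 0) sequentially"
        unfolding filterlim_at using t0 t(1) by (auto intro!: always_eventually less_imp_neq[symmetric])
      ultimately show ?thesis unfolding F_def by (rule filterlim_compose)
    qed
    have "(\<lambda>n. \<integral>x. F n x \<partial>lborel) \<longlonglongrightarrow> (\<integral>x. D x \<bullet> b \<partial>lborel)"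
    proof (rule integral_dominated_convergence[where w = "\<lambda>x. indicator (cball 0 (r + 1)) x *\<^sub>R B"])
      show "(\<lambda>x. D x \<bullet> b) \<in> borel_measurable lborel" using D_int by auto
      show "F n \<in> borel_measurable lborel" for n using F_int by auto
      show "integrable lborel (\<lambda>x. indicator (cball 0 (r + 1) :: 'a set) x *\<^sub>R B)"
        by (rule borel_integrable_compact) auto
      show "AE x in lborel. (\<lambda>n. F n x) \<longlonglongrightarrow> D x \<bullet> b" using F_lim by simp
      show "AE x in lborel. norm (F n x) \<le> indicator (cball 0 (r + 1)) x *\<^sub>R B" for n
      proof (rule AE_I2)
        fix x
        have le: "norm (F n x) \<le> B"
          using lipschitz_from_grad[OF w B', of "t n *\<^sub>R b + x" x] t(1)[of n] b
          by (simp add: F_def field_simps)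
        show "norm (F n x) \<le> indicator (cball 0 (r + 1)) x *\<^sub>R B"
        proof (cases "x \<in> cball 0 (r + 1)")
          case True
          then show ?thesis using le by simp
        next
          case False
          then have x: "norm x > r + 1" by simp
          then have 1: "x \<notin> K" using r by fastforce
          have "norm x \<le> norm (t n *\<^sub>R b + x) + norm (t n *\<^sub>R b)"
            by (metis add_diff_cancel_left' norm_triangle_ineq4 add.commute)
          then have "norm (t n *\<^sub>R b + x) > r" using x t[of n] b by simp
          then have "t n *\<^sub>R b + x \<notin> K" using r by fastforce
          then have "F n x = 0" using K(2)[OF 1] K(2)[of "t n *\<^sub>R b + x"] by (simp add: F_def)
          then show ?thesis using B(1) by simp
        qed
      qed
    qed
    then have "(\<lambda>n::nat. 0) \<longlonglongrightarrow> (\<integral>x. D x \<bullet> b \<partial>lborel)" by (simp only: F_int(2))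
    then have "(\<integral>x. D x \<bullet> b \<partial>lborel) = 0" by (metis LIMSEQ_unique tendsto_const)
    moreover have "(\<integral>x. D x \<bullet> b \<partial>lborel) = (\<integral>x. D x \<partial>lborel) \<bullet> b"
      by (rule integral_inner_left) (rule D_int)
    ultimately show ?thesis by simp
  qed
  then show ?thesis by (simp add: euclidean_eqI[of "integral\<^sup>L lborel D" 0])
qed

text \<open>The version \<open>h'\<close> is there because densities are only determined almost everywhere.\<close>

lemma has_weak_grad_C1:
  fixes h h' :: "'a::euclidean_space \<Rightarrow> real"
  assumes h: "has_C1_grad h H" and ae: "AE x in lborel. h' x = h x"
    and [measurable]: "h' \<in> borel_measurable borel"
  shows "has_weak_grad h' H"
  unfolding has_weak_grad_def
proof (intro conjI allI impI)
  note hm [measurable] = borel_measurable_continuous_onI[OF has_C1_gradD(3)[OF h]]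
  have "locally_integrable h" by (rule locally_integrable_continuous[OF has_C1_gradD(3)[OF h]])
  moreover have "set_integrable lborel K h' \<longleftrightarrow> set_integrable lborel K h" if "compact K" for K
    unfolding set_integrable_def
  proof (rule integrable_cong_AE)
    have [measurable]: "K \<in> sets borel" using that by (rule borel_compact)
    show "(\<lambda>x. indicator K x *\<^sub>R h' x) \<in> borel_measurable lborel"
      "(\<lambda>x. indicator K x *\<^sub>R h x) \<in> borel_measurable lborel" by measurable
  qed (use ae in auto)
  ultimately show "locally_integrable h'" unfolding locally_integrable_def by simp
  show "locally_integrable H" by (rule locally_integrable_continuous[OF has_C1_gradD(2)[OF h]])
  fix u :: "'a \<Rightarrow> real"
  assume u: "C1_fun u \<and> (\<exists>K. compact K \<and> (\<forall>x. x \<notin> K \<longrightarrow> u x = 0))"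
  then obtain K where K: "compact K" "\<And>x. x \<notin> K \<Longrightarrow> u x = 0" by blast
  have gu: "has_C1_grad u (grad u)" using u by (simp add: C1_fun_iff_grad)
  have gu0: "grad u x = 0" if "x \<notin> K" for x
    using grad_zero_outside[OF gu compact_imp_closed[OF K(1)] K(2) that] .
  note [measurable] = borel_measurable_continuous_onI[OF has_C1_gradD(2)[OF gu]]
  have 1: "integrable lborel (\<lambda>x. h x *\<^sub>R grad u x)"
    using gu0 by (intro integrable_compact_support[OF _ K(1)] continuous_intros
        has_C1_gradD[OF h] has_C1_gradD[OF gu]) auto
  have 2: "integrable lborel (\<lambda>x. u x *\<^sub>R H x)"
    using K(2) by (intro integrable_compact_support[OF _ K(1)] continuous_intros
        has_C1_gradD[OF h] has_C1_gradD[OF gu]) auto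
  have "(\<integral>x. h x *\<^sub>R grad u x + u x *\<^sub>R H x \<partial>lborel) = 0"
    using K(2) by (intro integral_grad_eq_0[OF has_C1_grad_mult[OF h gu] K(1)]) auto
  then have "(\<integral>x. h x *\<^sub>R grad u x \<partial>lborel) = - (\<integral>x. u x *\<^sub>R H x \<partial>lborel)"
    using 1 2 by (simp add: eq_neg_iff_add_eq_0)
  moreover have "(\<integral>x. h' x *\<^sub>R grad u x \<partial>lborel) = (\<integral>x. h x *\<^sub>R grad u x \<partial>lborel)"
    using ae by (intro integral_cong_AE) auto
  ultimately show "(\<integral>x. h' x *\<^sub>R grad u x \<partial>lborel) = - (\<integral>x. u x *\<^sub>R H x \<partial>lborel)" by simp
qed

subsection \<open>Uniqueness of weak gradients\<close>

text \<open>A continuously differentiable function that vanishes exactly on the nonpositive reals.  Along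
  \<open>n s\<close> it tends to the indicator of \<open>s > 0\<close>, so no piecewise construction of cut-offs is needed.\<close>

definition soft_step :: "real \<Rightarrow> real" where
  "soft_step s = (max 0 s)\<^sup>2 / (1 + (max 0 s)\<^sup>2)"

lemma soft_step_has_derivative:
  "(soft_step has_real_derivative 2 * max 0 s / (1 + (max 0 s)\<^sup>2)\<^sup>2) (at s)"
proof -
  have pos: "1 + x\<^sup>2 \<noteq> 0" for x :: real using zero_le_power2[of x] by linarith
  have sq: "((\<lambda>s. (max 0 s)\<^sup>2) has_real_derivative 2 * max 0 s) (at s)" for s :: real
  proof (cases "s = 0")
    case True
    have "((\<lambda>h. ((max 0 h)\<^sup>2 - 0) / h) \<longlongrightarrow> 0) (at (0 :: real))"
    proof (rule Lim_null_comparison[where g = "\<lambda>h. \<bar>h\<bar>"])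
      show "\<forall>\<^sub>F h in at (0 :: real). norm (((max 0 h)\<^sup>2 - 0) / h) \<le> \<bar>h\<bar>"
        by (intro always_eventually) (auto simp: max_def power2_eq_square)
      show "((\<lambda>h::real. \<bar>h\<bar>) \<longlongrightarrow> 0) (at 0)" by (rule tendsto_rabs_zero[OF tendsto_ident_at])
    qed
    then show ?thesis using True by (simp add: has_field_derivative_iff)
  next
    case False
    then consider "s > 0" | "s < 0" by linarith
    then show ?thesis
    proof cases
      case 1
      have "((\<lambda>s. s\<^sup>2) has_real_derivative 2 * max 0 s) (at s)"
        using 1 DERIV_power[OF DERIV_ident, of 2 s] by simp
      then show ?thesis
        by (rule has_field_derivative_transform_within_open[of _ _ _ "{0<..}"]) (use 1 in auto)
    next
      case 2
      have "((\<lambda>s. 0) has_real_derivative 2 * max 0 s) (at s)"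
        using 2 by simp
      then show ?thesis
        by (rule has_field_derivative_transform_within_open[of _ _ _ "{..<0}"]) (use 2 in auto)
    qed
  qed
  have "((\<lambda>s. (max 0 s)\<^sup>2 / (1 + (max 0 s)\<^sup>2)) has_real_derivative
      (2 * max 0 s * (1 + (max 0 s)\<^sup>2) - (max 0 s)\<^sup>2 * (0 + 2 * max 0 s))
        / ((1 + (max 0 s)\<^sup>2) * (1 + (max 0 s)\<^sup>2))) (at s)"
    by (intro DERIV_divide DERIV_add DERIV_const sq pos)
  then show ?thesis
    unfolding soft_step_def by (simp add: algebra_simps power2_eq_square)
qed

lemma soft_step_bounds: "0 \<le> soft_step s" "soft_step s \<le> 1"
  unfolding soft_step_def by (simp_all add: divide_le_eq_1 add_pos_nonneg)

lemma soft_step_nonpos: "s \<le> 0 \<Longrightarrow> soft_step s = 0"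
  by (simp add: soft_step_def)

lemma soft_step_limit:
  assumes "s > 0"
  shows "(\<lambda>n. soft_step (real n * s)) \<longlonglongrightarrow> 1"
proof -
  have "(\<lambda>n. 1 - 1 / (1 + (real n * s)\<^sup>2)) \<longlonglongrightarrow> 1 - 0"
  proof (intro tendsto_intros tendsto_divide_0[OF tendsto_const] filterlim_at_top_imp_at_infinity)
    have "filterlim (\<lambda>n. real n * s) at_top sequentially"
      using filterlim_at_top_mult_tendsto_pos[OF tendsto_const assms filterlim_real_sequentially] .
    then have "filterlim (\<lambda>n. (real n * s)\<^sup>2) at_top sequentially"
      by (rule filterlim_pow_at_top[rotated]) simp
    then show "filterlim (\<lambda>n. 1 + (real n * s)\<^sup>2) at_top sequentially"
      by (rule filterlim_tendsto_add_at_top[OF tendsto_const])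
  qed
  moreover have "1 - 1 / (1 + (real n * s)\<^sup>2) = soft_step (real n * s)" for n
  proof -
    have "1 + (real n * s)\<^sup>2 > 0" by (simp add: add_pos_nonneg)
    then show ?thesis using assms by (simp add: soft_step_def field_simps)
  qed
  ultimately show ?thesis by simp
qed

text \<open>Test functions supported in a box that converge pointwise to its indicator.\<close>

definition bump :: "'a::euclidean_space \<Rightarrow> 'a \<Rightarrow> nat \<Rightarrow> 'a \<Rightarrow> real" where
  "bump a b n x = (\<Prod>i\<in>Basis. soft_step (real n * (x \<bullet> i - a \<bullet> i)) * soft_step (real n * (b \<bullet> i - x \<bullet> i)))"

lemma bump_C1: "\<exists>D. has_C1_grad (bump a b n) D"
proof -
  have cont: "continuous_on UNIV (\<lambda>s. 2 * max 0 s / (1 + (max 0 s)\<^sup>2)\<^sup>2 :: real)"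
  proof (intro continuous_intros ballI)
    fix s :: real
    show "(1 + (max 0 s)\<^sup>2)\<^sup>2 \<noteq> 0" using zero_le_power2[of "max 0 s"] by (metis add_pos_nonneg less_numeral_extra(3) power_not_zero zero_less_one)
  qed
  have lin: "\<exists>D. has_C1_grad (\<lambda>x::'a. soft_step (p * (x \<bullet> i) + q)) D" for p q i
  proof -
    have "has_C1_grad (\<lambda>x. p * (x \<bullet> i) + q) (\<lambda>x. (p *\<^sub>R i + (x \<bullet> i) *\<^sub>R 0) + 0)"
      by (intro has_C1_grad_add has_C1_grad_mult has_C1_grad_const has_C1_grad_inner)
    from has_C1_grad_compose[OF this soft_step_has_derivative cont] show ?thesis by blast
  qed
  show ?thesis
    unfolding bump_def
  proof (rule has_C1_grad_prod)
    fix i :: 'a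
    obtain D where D: "has_C1_grad (\<lambda>x. soft_step (real n * (x \<bullet> i) + (- real n * (a \<bullet> i)))) D"
      using lin[of "real n" i] by blast
    obtain E where E: "has_C1_grad (\<lambda>x. soft_step (- real n * (x \<bullet> i) + real n * (b \<bullet> i))) E"
      using lin[of "- real n" i] by blast
    have "(\<lambda>x. soft_step (real n * (x \<bullet> i) + (- real n * (a \<bullet> i)))
          * soft_step (- real n * (x \<bullet> i) + real n * (b \<bullet> i)))
        = (\<lambda>x. soft_step (real n * (x \<bullet> i - a \<bullet> i)) * soft_step (real n * (b \<bullet> i - x \<bullet> i)))"
      by (simp add: right_diff_distrib)
    then show "\<exists>D. has_C1_grad (\<lambda>x. soft_step (real n * (x \<bullet> i - a \<bullet> i)) * soft_step (real n * (b \<bullet> i - x \<bullet> i))) D"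
      using has_C1_grad_mult[OF D E] by metis
  qed simp
qed

lemma bump_bounds: "0 \<le> bump a b n x" "bump a b n x \<le> 1"
  unfolding bump_def
  by (intro prod_nonneg prod_le_1 ballI conjI mult_nonneg_nonneg mult_le_one soft_step_bounds)+

lemma bump_outside:
  assumes "x \<notin> box a b"
  shows "bump a b n x = 0"
proof -
  obtain i where i: "i \<in> Basis" "x \<bullet> i - a \<bullet> i \<le> 0 \<or> b \<bullet> i - x \<bullet> i \<le> 0"
    using assms by (auto simp: mem_box not_less)
  then have "soft_step (real n * (x \<bullet> i - a \<bullet> i)) * soft_step (real n * (b \<bullet> i - x \<bullet> i)) = 0"
    by (auto intro!: soft_step_nonpos mult_nonneg_nonpos)
  then show ?thesis unfolding bump_def using i(1) by (metis (no_types, lifting) finite_Basis prod_zero)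
qed

lemma bump_limit: "(\<lambda>n. bump a b n x) \<longlonglongrightarrow> indicator (box a b) x"
proof (cases "x \<in> box a b")
  case True
  have "(\<lambda>n. bump a b n x) \<longlonglongrightarrow> (\<Prod>i\<in>(Basis :: 'a set). 1 * 1)"
    unfolding bump_def using True
    by (intro tendsto_prod tendsto_mult soft_step_limit) (auto simp: mem_box)
  then show ?thesis using True by simp
qed (simp add: bump_outside)

text \<open>Boxes form an intersection-stable generator of the Borel sets, so within a fixed box the integral
  vanishes over all Borel sets.\<close>

lemma integral_boxes_zero_imp_AE_zero:
  fixes k :: "'a::euclidean_space \<Rightarrow> 'b::euclidean_space"
  assumes k: "locally_integrable k"
    and zero: "\<And>a b. (\<integral>x. indicator (box a b) x *\<^sub>R k x \<partial>lborel) = 0"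
  shows "AE x in lborel. k x = 0"
proof -
  have "AE x in lborel. x \<in> box a b \<longrightarrow> k x = 0" for a b
  proof -
    define f where "f = (\<lambda>x. indicator (box a b) x *\<^sub>R k x)"
    have "set_integrable lborel (cbox a b) k"
      using k unfolding locally_integrable_def by (simp add: compact_cbox)
    then have "set_integrable lborel (box a b) k"
      by (rule set_integrable_subset) (auto simp: box_subset_cbox)
    then have f: "integrable lborel f" unfolding f_def set_integrable_def .
    have all: "set_lebesgue_integral lborel A f = 0" if A: "A \<in> sets borel" for A
    proof -
      have "A \<in> sigma_sets UNIV (range (\<lambda>(a, b). box a b))" using A by (simp add: borel_eq_box)
      then show ?thesis
      proof (induction rule: sigma_sets_induct_disjoint[consumes 0, OF _ _ \<open>A \<in> sigma_sets UNIV _\<close>,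
            case_names Int_stable subset basic empty compl union])
        case Int_stable
        show ?case by (auto simp: Int_stable_def box_Int_box)
      next
        case subset
        show ?case by simp
      next
        case (basic A)
        then obtain c d where "A = box c d" by auto
        moreover obtain p q where "box c d \<inter> box a b = box p q" by (rule that[OF box_Int_box])
        moreover have "indicator (box c d) x *\<^sub>R f x = indicator (box c d \<inter> box a b) x *\<^sub>R k x" for x
          by (simp add: f_def indicator_def)
        ultimately show ?case using zero[of p q] by (simp add: set_lebesgue_integral_def)
      next
        case empty
        show ?case by (simp add: set_lebesgue_integral_def)
      next
        case (compl A)
        then have [measurable]: "A \<in> sets borel" by (simp add: borel_eq_box)
        have sA: "set_integrable lborel A f" "set_integrable lborel (UNIV - A) f"
          unfolding set_integrable_def by (auto intro!: integrable_mult_indicator f)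
        have "set_lebesgue_integral lborel (A \<union> (UNIV - A)) f = 0"
          using zero[of a b] by (simp add: set_lebesgue_integral_def f_def)
        moreover have "set_lebesgue_integral lborel (A \<union> (UNIV - A)) f
            = set_lebesgue_integral lborel A f + set_lebesgue_integral lborel (UNIV - A) f"
          by (rule set_integral_Un[OF _ sA]) auto
        ultimately show ?case using compl by simp
      next
        case (union A)
        then have Am: "A i \<in> sets lborel" for i by (auto simp: borel_eq_box)
        have "set_lebesgue_integral lborel (\<Union>i. A i) f = (\<Sum>i. set_lebesgue_integral lborel (A i) f)"
        proof (rule lebesgue_integral_countable_add[OF Am])
          show "A i \<inter> A j = {}" if "i \<noteq> j" for i j
            using union that by (auto simp: disjoint_family_on_def)
          show "set_integrable lborel (\<Union>i. A i) f"
            unfolding set_integrable_def using Am by (intro integrable_mult_indicator f) auto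
        qed
        moreover have "set_lebesgue_integral lborel (A i) f = 0" for i
          using union by (meson range_subsetD)
        ultimately show ?case by simp
      qed
    qed
    have "AE x in lborel. f x = 0"
      by (rule sigma_finite_measure.density_unique_banach[OF sigma_finite_lborel f]) (auto simp: all set_lebesgue_integral_def[of _ _ "\<lambda>x. 0"])
    then show ?thesis by eventually_elim (auto simp: f_def)
  qed
  then have "AE x in lborel. \<forall>n::nat. x \<in> box (- (real n *\<^sub>R One)) (real n *\<^sub>R One) \<longrightarrow> k x = 0"
    unfolding AE_all_countable by blast
  then show ?thesis
  proof eventually_elim
    case (elim x)
    have "x \<in> (\<Union>n::nat. box (- (real n *\<^sub>R One)) (real n *\<^sub>R One))"
      unfolding UN_box_eq_UNIV by simp
    then show ?case using elim by blast
  qed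
qed

text \<open>Both weak gradients have the same integral against every bump, hence over every box.\<close>

lemma has_weak_grad_unique:
  fixes h :: "'a::euclidean_space \<Rightarrow> real"
  assumes g: "has_weak_grad h g" and g': "has_weak_grad h g'"
  shows "AE x in lborel. g x = g' x"
proof -
  have lg: "locally_integrable g" and lg': "locally_integrable g'"
    using g g' by (auto simp: has_weak_grad_def)
  have "AE x in lborel. g x - g' x = 0"
  proof (rule integral_boxes_zero_imp_AE_zero)
    show "locally_integrable (\<lambda>x. g x - g' x)"
      using lg lg' unfolding locally_integrable_def by (auto intro: set_integral_diff)
    fix a b :: 'a
    define f where "f = (\<lambda>x. indicator (cbox a b) x *\<^sub>R (g x - g' x))"
    have gi: "integrable lborel (\<lambda>x. indicator (cbox a b) x *\<^sub>R g x)"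
      "integrable lborel (\<lambda>x. indicator (cbox a b) x *\<^sub>R g' x)"
      using lg lg' unfolding locally_integrable_def set_integrable_def by (auto simp: compact_cbox)
    then have f: "integrable lborel f" unfolding f_def by (simp add: scaleR_diff_right)
    have bm [measurable]: "bump a b n \<in> borel_measurable borel" for n
      using bump_C1 has_C1_gradD(3) borel_measurable_continuous_onI by metis
    have bump_cbox: "bump a b n x *\<^sub>R y = bump a b n x *\<^sub>R indicator (cbox a b) x *\<^sub>R y" for n x and y :: 'a
      using bump_outside[of x a b n] box_subset_cbox[of a b] by (auto simp: indicator_def)
    have bi: "integrable lborel (\<lambda>x. bump a b n x *\<^sub>R indicator (cbox a b) x *\<^sub>R y x)"
      if "integrable lborel (\<lambda>x. indicator (cbox a b) x *\<^sub>R y x)" for n and y :: "'a \<Rightarrow> 'a"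
    proof (rule Bochner_Integration.integrable_bound[OF that])
      show "(\<lambda>x. bump a b n x *\<^sub>R indicator (cbox a b) x *\<^sub>R y x) \<in> borel_measurable lborel"
        using borel_measurable_scaleR[OF _ borel_measurable_integrable[OF that], of "bump a b n"] by simp
      show "AE x in lborel. norm (bump a b n x *\<^sub>R indicator (cbox a b) x *\<^sub>R y x) \<le> norm (indicator (cbox a b) x *\<^sub>R y x)"
        using bump_bounds[of a b n] by (auto intro!: mult_left_le_one_le simp: mult.assoc)
    qed
    have "(\<integral>x. bump a b n x *\<^sub>R f x \<partial>lborel) = 0" for n
    proof -
      have u: "C1_fun (bump a b n) \<and> (\<exists>K. compact K \<and> (\<forall>x. x \<notin> K \<longrightarrow> bump a b n x = 0))"
        using bump_C1 has_C1_grad_imp_C1_fun bump_outside[of _ a b n] box_subset_cbox[of a b]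
        by (metis compact_cbox subsetD)
      have "(\<integral>x. bump a b n x *\<^sub>R g x \<partial>lborel) = (\<integral>x. bump a b n x *\<^sub>R g' x \<partial>lborel)"
      proof -
        have "(\<integral>x. h x *\<^sub>R grad (bump a b n) x \<partial>lborel) = - (\<integral>x. bump a b n x *\<^sub>R g x \<partial>lborel)"
          "(\<integral>x. h x *\<^sub>R grad (bump a b n) x \<partial>lborel) = - (\<integral>x. bump a b n x *\<^sub>R g' x \<partial>lborel)"
          using g g' u unfolding has_weak_grad_def by blast+
        then show ?thesis by simp
      qed
      then have "(\<integral>x. bump a b n x *\<^sub>R indicator (cbox a b) x *\<^sub>R g x \<partial>lborel)
          = (\<integral>x. bump a b n x *\<^sub>R indicator (cbox a b) x *\<^sub>R g' x \<partial>lborel)"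
        by (simp only: bump_cbox[symmetric])
      then show ?thesis
        unfolding f_def using bi[OF gi(1)] bi[OF gi(2)]
        by (simp add: scaleR_diff_right)
    qed
    moreover have "(\<lambda>n. \<integral>x. bump a b n x *\<^sub>R f x \<partial>lborel) \<longlonglongrightarrow> (\<integral>x. indicator (box a b) x *\<^sub>R f x \<partial>lborel)"
    proof (rule integral_dominated_convergence[where w = "\<lambda>x. norm (f x)"])
      show "(\<lambda>x. indicator (box a b) x *\<^sub>R f x) \<in> borel_measurable lborel"
        "(\<lambda>x. bump a b n x *\<^sub>R f x) \<in> borel_measurable lborel" for n
        using f by (auto intro!: borel_measurable_scaleR)
      show "integrable lborel (\<lambda>x. norm (f x))" using f by simp
      show "AE x in lborel. (\<lambda>n. bump a b n x *\<^sub>R f x) \<longlonglongrightarrow> indicator (box a b) x *\<^sub>R f x"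
        by (auto intro!: tendsto_intros bump_limit)
      show "AE x in lborel. norm (bump a b n x *\<^sub>R f x) \<le> norm (f x)" for n
        using bump_bounds[of a b n] by (auto intro!: mult_left_le_one_le)
    qed
    ultimately have "(\<integral>x. indicator (box a b) x *\<^sub>R f x \<partial>lborel) = 0"
      by (simp add: LIMSEQ_const_iff)
    moreover have "indicator (box a b) x *\<^sub>R f x = indicator (box a b) x *\<^sub>R (g x - g' x)" for x
      using box_subset_cbox[of a b] by (auto simp: f_def indicator_def)
    ultimately show "(\<integral>x. indicator (box a b) x *\<^sub>R (g x - g' x) \<partial>lborel) = 0" by simp
  qed
  then show ?thesis by simp
qed

text \<open>Hilbert's choice in \<^const>\<open>weak_grad\<close> therefore does not affect integrals.\<close>

lemma weak_grad_C1:
  fixes h h' :: "'a::euclidean_space \<Rightarrow> real"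
  assumes "has_C1_grad h H" "AE x in lborel. h' x = h x" "h' \<in> borel_measurable borel"
  shows "AE x in lborel. weak_grad h' x = H x"
proof -
  have H: "has_weak_grad h' H" by (rule has_weak_grad_C1[OF assms])
  then have "has_weak_grad h' (weak_grad h')" unfolding weak_grad_def by (rule someI[where P = "has_weak_grad h'"])
  then show ?thesis using H by (rule has_weak_grad_unique)
qed

section \<open>Extended integrals and relative entropy\<close>

lemma ereal_integral_integrable:
  assumes "integrable M g"
  shows "ereal_integral M g = ereal (\<integral>x. g x \<partial>M)"
proof -
  have p: "(\<integral>\<^sup>+x. ennreal (g x) \<partial>M) \<noteq> \<infinity>" and n: "(\<integral>\<^sup>+x. ennreal (- g x) \<partial>M) \<noteq> \<infinity>"
    using assms by (auto simp: real_integrable_def)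
  have conv: "enn2ereal a = ereal (enn2real a)" if "a \<noteq> \<infinity>" for a
    using that by (cases a) (auto simp: enn2ereal_ennreal)
  show ?thesis
    unfolding ereal_integral_def conv[OF p] conv[OF n]
    using real_lebesgue_integral_def[OF assms] by simp
qed

text \<open>Since \<open>\<infinity> - \<infinity> = \<infinity>\<close>, an extended integral below \<open>\<infinity>\<close> leaves only the negative part to be
  controlled.\<close>

lemma ereal_integral_finite_positive_part:
  assumes "ereal_integral M g \<noteq> \<infinity>"
  shows "(\<integral>\<^sup>+x. ennreal (g x) \<partial>M) \<noteq> \<infinity>"
  using assms unfolding ereal_integral_def by auto

lemma ereal_integral_neq_infinity:
  assumes "(\<integral>\<^sup>+x. ennreal (g x) \<partial>M) < \<infinity>"
  shows "ereal_integral M g \<noteq> \<infinity>"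
proof -
  obtain p where p: "enn2ereal (\<integral>\<^sup>+x. ennreal (g x) \<partial>M) = ereal p"
    using assms by (cases "\<integral>\<^sup>+x. ennreal (g x) \<partial>M") (auto simp: enn2ereal_ennreal)
  have "0 \<le> enn2ereal (\<integral>\<^sup>+x. ennreal (- g x) \<partial>M)" by simp
  then show ?thesis
    unfolding ereal_integral_def p by (cases "enn2ereal (\<integral>\<^sup>+x. ennreal (- g x) \<partial>M)") auto
qed

text \<open>The function \<open>k\<close> may take negative values; only its positive part enters the integral.\<close>

lemma nn_integral_linear_bound:
  assumes [measurable]: "k \<in> borel_measurable M" "n \<in> borel_measurable M" and "finite_measure M"
    and le: "\<And>x. g x \<le> a * k x + b + d * n x" and pos: "0 \<le> a" "0 \<le> b" "0 \<le> d" "\<And>x. 0 \<le> n x"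
    and k: "(\<integral>\<^sup>+x. ennreal (k x) \<partial>M) < \<infinity>" and n: "(\<integral>\<^sup>+x. ennreal (n x) \<partial>M) < \<infinity>"
  shows "(\<integral>\<^sup>+x. ennreal (g x) \<partial>M) < \<infinity>"
proof -
  interpret finite_measure M by fact
  have "(\<integral>\<^sup>+x. ennreal (g x) \<partial>M)
      \<le> (\<integral>\<^sup>+x. ennreal a * ennreal (k x) + (ennreal b + ennreal d * ennreal (n x)) \<partial>M)"
  proof (rule nn_integral_mono)
    fix x
    have "g x \<le> a * max 0 (k x) + (b + d * n x)"
      using le[of x] pos(1) by (smt (verit) max.cobounded2 mult_left_mono)
    then have "ennreal (g x) \<le> ennreal (a * max 0 (k x) + (b + d * n x))" by (rule ennreal_leI)
    also have "\<dots> = ennreal a * ennreal (max 0 (k x)) + (ennreal b + ennreal d * ennreal (n x))"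
      using pos by (simp add: ennreal_mult)
    also have "ennreal (max 0 (k x)) = ennreal (k x)" by (simp add: max_def ennreal_neg)
    finally show "ennreal (g x) \<le> ennreal a * ennreal (k x) + (ennreal b + ennreal d * ennreal (n x))" .
  qed
  also have "\<dots> = ennreal a * (\<integral>\<^sup>+x. ennreal (k x) \<partial>M)
      + (ennreal b * emeasure M (space M) + ennreal d * (\<integral>\<^sup>+x. ennreal (n x) \<partial>M))"
    by (simp add: nn_integral_add nn_integral_cmult)
  also have "\<dots> < \<infinity>"
    using k n by (simp add: ennreal_mult_eq_top_iff emeasure_finite less_top[symmetric])
  finally show ?thesis .
qed

lemma integrableI_parts:
  fixes g :: "'a \<Rightarrow> real"
  assumes "g \<in> borel_measurable M" "(\<integral>\<^sup>+x. ennreal (g x) \<partial>M) \<noteq> \<infinity>" "(\<integral>\<^sup>+x. ennreal (- g x) \<partial>M) \<noteq> \<infinity>"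
  shows "integrable M g"
  using assms by (simp add: real_integrable_def)

lemma neg_mult_ln_le_one:
  fixes x :: real
  assumes "0 \<le> x"
  shows "x * (- ln x) \<le> 1"
proof (cases "x = 0")
  case False
  then have x: "x > 0" using assms by simp
  have "- ln x = ln (1 / x)" using x by (simp add: ln_div)
  also have "\<dots> \<le> 1 / x - 1" using x by (intro ln_le_minus_one) simp
  finally have "x * (- ln x) \<le> x * (1 / x - 1)" using x by (intro mult_left_mono) auto
  moreover have "x * (1 / x - 1) = 1 - x" using x by (simp add: right_diff_distrib)
  ultimately show ?thesis using x by linarith
qed simp

lemma rel_density_measurable [measurable]:
  "rel_density \<mu> \<nu> \<in> borel_measurable \<mu>"
  unfolding rel_density_def[abs_def] by measurable

lemma rel_density_nonneg: "0 \<le> rel_density \<mu> \<nu> x"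
  by (simp add: rel_density_def)

lemma density_rel_density:
  assumes mu: "sigma_finite_measure \<mu>" and nu: "sigma_finite_measure \<nu>"
    and ac: "absolutely_continuous \<mu> \<nu>" and sets: "sets \<nu> = sets \<mu>"
  shows "density \<mu> (\<lambda>x. ennreal (rel_density \<mu> \<nu> x)) = \<nu>"
proof -
  have "AE x in \<mu>. RN_deriv \<mu> \<nu> x \<noteq> \<infinity>"
    by (rule sigma_finite_measure.RN_deriv_finite[OF mu nu ac sets])
  then have "AE x in \<mu>. ennreal (rel_density \<mu> \<nu> x) = RN_deriv \<mu> \<nu> x"
    by eventually_elim (simp add: rel_density_def less_top)
  then have "density \<mu> (\<lambda>x. ennreal (rel_density \<mu> \<nu> x)) = density \<mu> (RN_deriv \<mu> \<nu>)"
    by (intro density_cong) auto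
  then show ?thesis
    using sigma_finite_measure.density_RN_deriv[OF mu ac sets] by simp
qed

lemma rel_density_density:
  assumes mu: "sigma_finite_measure \<mu>"
    and [measurable]: "h \<in> borel_measurable \<mu>" and h: "\<And>x. 0 \<le> h x"
  shows "AE x in \<mu>. rel_density \<mu> (density \<mu> (\<lambda>x. ennreal (h x))) x = h x"
proof -
  have "AE x in \<mu>. ennreal (h x) = RN_deriv \<mu> (density \<mu> (\<lambda>x. ennreal (h x))) x"
    by (rule sigma_finite_measure.RN_deriv_unique[OF mu]) auto
  then show ?thesis
    by eventually_elim (metis enn2real_ennreal h rel_density_def)
qed

text \<open>The negative part of \<open>h ln h\<close> is bounded by \<open>1\<close>, so a relative entropy below \<open>\<infinity>\<close> is a genuine
  integral.\<close>

lemma relative_entropy_integrable: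
  assumes mu: "prob_space \<mu>" and nu: "prob_space \<nu>" and sets: "sets \<nu> = sets \<mu>"
    and fin: "relative_entropy \<nu> \<mu> \<noteq> \<infinity>"
  shows "absolutely_continuous \<mu> \<nu>"
    and "integrable \<nu> (\<lambda>x. ln (rel_density \<mu> \<nu> x))"
    and "relative_entropy \<nu> \<mu> = ereal (\<integral>x. ln (rel_density \<mu> \<nu> x) \<partial>\<nu>)"
proof -
  interpret mu: prob_space \<mu> by fact
  interpret nu: prob_space \<nu> by fact
  show ac: "absolutely_continuous \<mu> \<nu>"
    using fin unfolding relative_entropy_def by (metis PInfty_neq_ereal(1))
  have ent: "ereal_integral \<nu> (\<lambda>x. ln (rel_density \<mu> \<nu> x)) = relative_entropy \<nu> \<mu>"
    using ac by (simp add: relative_entropy_def)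
  note [measurable_cong] = sets
  have dens: "density \<mu> (\<lambda>x. ennreal (rel_density \<mu> \<nu> x)) = \<nu>"
    using mu.sigma_finite_measure_axioms nu.sigma_finite_measure_axioms ac sets
    by (rule density_rel_density)
  have "(\<integral>\<^sup>+x. ennreal (- ln (rel_density \<mu> \<nu> x)) \<partial>\<nu>)
      = (\<integral>\<^sup>+x. ennreal (rel_density \<mu> \<nu> x) * ennreal (- ln (rel_density \<mu> \<nu> x)) \<partial>\<mu>)"
    by (subst dens[symmetric], subst nn_integral_density) auto
  also have "\<dots> \<le> (\<integral>\<^sup>+x. 1 \<partial>\<mu>)"
  proof (rule nn_integral_mono)
    fix x
    have "ennreal (rel_density \<mu> \<nu> x) * ennreal (- ln (rel_density \<mu> \<nu> x))
        = ennreal (rel_density \<mu> \<nu> x * (- ln (rel_density \<mu> \<nu> x)))"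
      by (rule ennreal_mult'[OF rel_density_nonneg, symmetric])
    also have "\<dots> \<le> ennreal 1"
      using neg_mult_ln_le_one[OF rel_density_nonneg, of \<mu> \<nu> x] by (rule ennreal_leI)
    finally show "ennreal (rel_density \<mu> \<nu> x) * ennreal (- ln (rel_density \<mu> \<nu> x)) \<le> 1" by simp
  qed
  also have "\<dots> < \<infinity>" by (simp add: mu.emeasure_space_1)
  finally have neg: "(\<integral>\<^sup>+x. ennreal (- ln (rel_density \<mu> \<nu> x)) \<partial>\<nu>) \<noteq> \<infinity>" by simp
  have "(\<lambda>x. ln (rel_density \<mu> \<nu> x)) \<in> borel_measurable \<nu>" by measurable
  then show int: "integrable \<nu> (\<lambda>x. ln (rel_density \<mu> \<nu> x))"
    using ereal_integral_finite_positive_part[of \<nu> "\<lambda>x. ln (rel_density \<mu> \<nu> x)"] neg fin ent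
    by (intro integrableI_parts) auto
  show "relative_entropy \<nu> \<mu> = ereal (\<integral>x. ln (rel_density \<mu> \<nu> x) \<partial>\<nu>)"
    using ereal_integral_integrable[OF int] ent by simp
qed

lemma integral_exp_pos:
  fixes g :: "'s \<Rightarrow> real"
  assumes "prob_space M" and int: "integrable M (\<lambda>x. exp (g x))"
  shows "0 < (\<integral>x. exp (g x) \<partial>M)"
proof -
  interpret prob_space M by fact
  have "(\<integral>x. exp (g x) \<partial>M) \<noteq> 0"
  proof
    assume "(\<integral>x. exp (g x) \<partial>M) = 0"
    then have "AE x in M. exp (g x) = 0"
      using integral_nonneg_eq_0_iff_AE[OF int] by simp
    then show False by simp
  qed
  moreover have "0 \<le> (\<integral>x. exp (g x) \<partial>M)" by simp
  ultimately show ?thesis by linarith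
qed

text \<open>Pointwise \<open>h (g - ln c - ln h) \<le> exp g / c - h\<close>, from \<open>ln y \<le> y - 1\<close> at \<open>y = exp g / (c h)\<close>; with
  \<open>c\<close> the integral of \<open>exp g\<close> the right-hand side integrates to \<open>0\<close>.\<close>

lemma donsker_varadhan:
  assumes mu: "prob_space \<mu>" and nu: "prob_space \<nu>" and sets: "sets \<nu> = sets \<mu>"
    and fin: "relative_entropy \<nu> \<mu> \<noteq> \<infinity>"
    and g: "integrable \<nu> g" and eg: "integrable \<mu> (\<lambda>x. exp (g x))" and gm [measurable]: "g \<in> borel_measurable \<mu>"
  shows "(\<integral>x. g x \<partial>\<nu>) \<le> (\<integral>x. ln (rel_density \<mu> \<nu> x) \<partial>\<nu>) + ln (\<integral>x. exp (g x) \<partial>\<mu>)"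
proof -
  interpret mu: prob_space \<mu> by fact
  interpret nu: prob_space \<nu> by fact
  note ent = relative_entropy_integrable[OF mu nu sets fin]
  have dens: "\<nu> = density \<mu> (\<lambda>x. ennreal (rel_density \<mu> \<nu> x))"
    using density_rel_density[OF mu.sigma_finite_measure_axioms nu.sigma_finite_measure_axioms ent(1) sets] by simp
  define h where "h = rel_density \<mu> \<nu>"
  have h0: "0 \<le> h x" for x by (simp add: h_def rel_density_nonneg)
  have [measurable]: "h \<in> borel_measurable \<mu>" unfolding h_def by measurable
  have dens': "\<nu> = density \<mu> (\<lambda>x. ennreal (h x))" using dens by (simp add: h_def)
  define c where "c = (\<integral>x. exp (g x) \<partial>\<mu>)"
  have c: "c > 0"
    unfolding c_def by (rule integral_exp_pos[OF mu eg])
  define k where "k = (\<lambda>x. g x - ln c - ln (h x))"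
  have k: "integrable \<nu> k"
    unfolding k_def h_def by (intro Bochner_Integration.integrable_diff g ent(2)) simp
  have [measurable]: "k \<in> borel_measurable \<mu>" unfolding k_def by measurable
  have hk: "integrable \<mu> (\<lambda>x. h x * k x)"
    using k h0 by (subst (asm) dens') (simp add: integrable_density)
  have "integrable \<nu> (\<lambda>x. 1 :: real)" by simp
  then have h: "integrable \<mu> h"
    using h0 by (subst (asm) dens') (simp add: integrable_density)
  have "(\<integral>x. k x \<partial>\<nu>) = (\<integral>x. h x * k x \<partial>\<mu>)"
    using h0 by (subst dens') (simp add: integral_density)
  also have "\<dots> \<le> (\<integral>x. exp (g x) / c - h x \<partial>\<mu>)"
  proof (rule integral_mono[OF hk])
    show "integrable \<mu> (\<lambda>x. exp (g x) / c - h x)" using eg h by simp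
    fix x
    show "h x * k x \<le> exp (g x) / c - h x"
    proof (cases "h x = 0")
      case True
      then show ?thesis using c by simp
    next
      case False
      then have hx: "h x > 0" using h0[of x] by simp
      have "k x = ln (exp (g x) / (c * h x))"
        using hx c by (simp add: k_def ln_div ln_mult)
      also have "\<dots> \<le> exp (g x) / (c * h x) - 1" using hx c by (intro ln_le_minus_one) simp
      finally have "h x * k x \<le> h x * (exp (g x) / (c * h x) - 1)"
        using hx by (intro mult_left_mono) auto
      then show ?thesis using hx by (simp add: right_diff_distrib)
    qed
  qed
  also have "\<dots> = 0"
  proof -
    have "(\<integral>x. h x \<partial>\<mu>) = (\<integral>x. 1 \<partial>\<nu>)"
      using h0 by (subst dens', subst integral_density) auto
    also have "\<dots> = 1" by (simp add: nu.prob_space)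
    finally show ?thesis using h eg c by (simp add: c_def)
  qed
  finally have "(\<integral>x. k x \<partial>\<nu>) \<le> 0" .
  moreover have "(\<integral>x. k x \<partial>\<nu>) = (\<integral>x. g x \<partial>\<nu>) - ln c - (\<integral>x. ln (h x) \<partial>\<nu>)"
    using g ent(2) unfolding k_def h_def by (simp add: nu.prob_space)
  ultimately show ?thesis by (simp add: c_def h_def)
qed

subsection \<open>Entropy with respect to Lebesgue measure\<close>

text \<open>The integrable weight against which the entropy of a law with a second moment is compared.\<close>

lemma nn_integral_gaussian_finite:
  "(\<integral>\<^sup>+x. ennreal (exp (- (norm (x :: 'a::euclidean_space))\<^sup>2 / 2)) \<partial>lborel) < \<infinity>"
proof -
  have fin: "(\<integral>\<^sup>+t. ennreal (exp (- (t::real)\<^sup>2 / 2)) \<partial>lborel) < \<infinity>"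
  proof -
    have "integrable lborel (\<lambda>t. sqrt (2 * pi) * std_normal_density t)" by simp
    then have "integrable lborel (\<lambda>t::real. exp (- t\<^sup>2 / 2))" by (simp add: std_normal_density_def)
    then show ?thesis by (subst nn_integral_eq_integral) auto
  qed
  have "exp (- (norm x)\<^sup>2 / 2) = (\<Prod>b\<in>Basis. exp (- (x \<bullet> b)\<^sup>2 / 2))" for x :: 'a
  proof -
    have "(norm x)\<^sup>2 = (\<Sum>b\<in>Basis. (x \<bullet> b)\<^sup>2)"
      unfolding power2_norm_eq_inner by (subst euclidean_inner) (simp add: power2_eq_square)
    then show ?thesis by (simp add: exp_sum[symmetric] sum_negf sum_divide_distrib)
  qed
  then have "(\<integral>\<^sup>+x. ennreal (exp (- (norm (x :: 'a))\<^sup>2 / 2)) \<partial>lborel)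
      = (\<integral>\<^sup>+x. (\<Prod>b\<in>(Basis :: 'a set). ennreal (exp (- (x \<bullet> b)\<^sup>2 / 2))) \<partial>lborel)"
    by (simp add: prod_ennreal)
  also have "\<dots> = (\<Prod>b\<in>(Basis :: 'a set). (\<integral>\<^sup>+t. ennreal (exp (- t\<^sup>2 / 2)) \<partial>lborel))"
    by (rule nn_integral_lborel_prod) auto
  also have "\<dots> < \<infinity>" using fin by (simp add: power_less_top_ennreal)
  finally show ?thesis .
qed

lemma entropy_eq_relative_entropy:
  assumes "prob_space \<rho>" and sets: "sets \<rho> = sets borel"
  shows "entropy \<rho> = relative_entropy \<rho> lborel"
proof (cases "absolutely_continuous lborel \<rho>")
  case True
  interpret prob_space \<rho> by fact
  define r where "r = rel_density lborel \<rho>"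
  have rm [measurable]: "r \<in> borel_measurable borel"
    unfolding r_def using rel_density_measurable[of lborel \<rho>] by simp
  have r0: "0 \<le> r x" for x by (simp add: r_def rel_density_nonneg)
  have dens: "\<rho> = density lborel (\<lambda>x. ennreal (r x))"
    unfolding r_def
    using density_rel_density[OF sigma_finite_lborel sigma_finite_measure_axioms True] sets by simp
  have "(\<integral>\<^sup>+x. ennreal (c * ln (r x)) \<partial>\<rho>) = (\<integral>\<^sup>+x. ennreal (c * (r x * ln (r x))) \<partial>lborel)" for c
    using r0 by (subst dens, subst nn_integral_density) (auto simp: ennreal_mult'[symmetric] mult_ac)
  from this[of 1] this[of "-1"] show ?thesis
    using True by (simp add: Defs.entropy_def relative_entropy_def ereal_integral_def r_def)
qed (simp add: Defs.entropy_def relative_entropy_def)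

text \<open>Young's inequality \<open>- r ln r \<le> r a + exp (- a)\<close> with \<open>a = |x|\<^sup>2 / 2\<close> splits the integrand into the second
  moment and a Gaussian.\<close>

lemma neg_ln_density_finite_P2:
  assumes rho: "\<rho> \<in> P2" and ac: "absolutely_continuous lborel \<rho>"
  shows "(\<integral>\<^sup>+x. ennreal (- ln (rel_density lborel \<rho> x)) \<partial>\<rho>) < \<infinity>"
proof -
  interpret prob_space \<rho> using rho by (simp add: P2_def)
  have sets: "sets \<rho> = sets borel" using rho by (simp add: P2_def)
  define r where "r = rel_density lborel \<rho>"
  have rm [measurable]: "r \<in> borel_measurable borel"
    unfolding r_def using rel_density_measurable[of lborel \<rho>] by simp
  have r0: "0 \<le> r x" for x by (simp add: r_def rel_density_nonneg)
  have dens: "\<rho> = density lborel (\<lambda>x. ennreal (r x))"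
    unfolding r_def
    using density_rel_density[OF sigma_finite_lborel sigma_finite_measure_axioms ac] sets by simp
  define a where "a = (\<lambda>x::'a. (norm x)\<^sup>2 / 2)"
  have young: "r x * (- ln (r x)) \<le> r x * (norm x)\<^sup>2 + exp (- (norm x)\<^sup>2 / 2)" for x
  proof (cases "r x = 0")
    case False
    then have rx: "0 < r x" using r0[of x] by simp
    have "r x * exp (a x) * (- ln (r x * exp (a x))) \<le> 1"
      using rx by (intro neg_mult_ln_le_one) simp
    then have "r x * (- ln (r x * exp (a x))) * exp (a x) \<le> exp (- a x) * exp (a x)"
      by (simp add: exp_minus mult_ac)
    then have "r x * (- ln (r x * exp (a x))) \<le> exp (- a x)"
      by (simp only: mult_le_cancel_right_pos exp_gt_zero)
    then have "r x * (- ln (r x)) \<le> r x * a x + exp (- a x)"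
      using rx by (simp add: ln_mult algebra_simps)
    moreover have "r x * a x \<le> r x * (norm x)\<^sup>2" using rx by (intro mult_left_mono) (auto simp: a_def)
    ultimately show ?thesis by (simp add: a_def)
  qed simp
  have "(\<integral>\<^sup>+x. ennreal (- ln (r x)) \<partial>\<rho>) = (\<integral>\<^sup>+x. ennreal (r x * (- ln (r x))) \<partial>lborel)"
    using r0 by (subst dens, subst nn_integral_density) (auto simp: ennreal_mult'[symmetric])
  also have "\<dots> \<le> (\<integral>\<^sup>+x. ennreal (r x) * ennreal ((norm x)\<^sup>2) + ennreal (exp (- (norm x)\<^sup>2 / 2)) \<partial>lborel)"
  proof (rule nn_integral_mono)
    fix x
    have "ennreal (r x) * ennreal ((norm x)\<^sup>2) + ennreal (exp (- (norm x)\<^sup>2 / 2))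
        = ennreal (r x * (norm x)\<^sup>2 + exp (- (norm x)\<^sup>2 / 2))"
      using r0[of x] by (simp add: ennreal_mult)
    then show "ennreal (r x * (- ln (r x)))
        \<le> ennreal (r x) * ennreal ((norm x)\<^sup>2) + ennreal (exp (- (norm x)\<^sup>2 / 2))"
      using young[of x] by (simp only: ennreal_leI)
  qed
  also have "\<dots> = (\<integral>\<^sup>+x. ennreal ((norm x)\<^sup>2) \<partial>\<rho>) + (\<integral>\<^sup>+x. ennreal (exp (- (norm (x::'a))\<^sup>2 / 2)) \<partial>lborel)"
    by (subst dens, subst nn_integral_density, simp, simp) (simp add: nn_integral_add)
  also have "\<dots> < \<infinity>" using rho nn_integral_gaussian_finite by (simp add: P2_def)
  finally show ?thesis by (simp add: r_def)
qed

section \<open>Concentration from the log-Sobolev inequality\<close>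

text \<open>The measure has the Lebesgue null sets as its null sets, so that weak gradients, which are
  determined up to Lebesgue null sets, can be compared under it.  As in the definition of the inequality
  for the mean-field model, only laws with a second moment are tested.\<close>

locale log_sobolev = prob_space \<mu> for \<mu> :: "'a::euclidean_space measure" +
  fixes \<eta> :: real
  assumes sets_eq: "sets \<mu> = sets borel"
    and same_null_sets: "\<And>P. (AE x in \<mu>. P x) \<longleftrightarrow> (AE x in lborel. P x)"
    and entropy_le_fisher: "\<And>\<nu>. \<nu> \<in> P2 \<Longrightarrow>
      relative_entropy \<nu> \<mu> \<le> ereal \<eta> * enn2ereal (fisher_information \<nu> \<mu>)"
    and eta_nonneg: "0 \<le> \<eta>"
begin

lemma measurable_mu [measurable_cong]: "sets \<mu> = sets borel" by (rule sets_eq)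

text \<open>The logarithmic gradient of a density proportional to \<open>exp G\<close> is the gradient of \<open>G\<close>.\<close>

lemma fisher_information_exp_density:
  assumes G: "has_C1_grad G G'" and bound: "\<And>x. norm (G' x) \<le> B"
    and nu: "\<nu> = density \<mu> (\<lambda>x. ennreal (exp (G x) / c))" and c: "c > 0" and prob: "prob_space \<nu>"
  shows "fisher_information \<nu> \<mu> \<le> ennreal (B\<^sup>2)"
proof -
  interpret nu: prob_space \<nu> by fact
  define h where "h = (\<lambda>x. exp (G x) / c)"
  define H where "H = (\<lambda>x. (exp (G x) / c) *\<^sub>R G' x)"
  have h: "has_C1_grad h H"
    unfolding h_def H_def
    by (rule has_C1_grad_compose[OF G]) (auto intro!: derivative_eq_intros continuous_intros simp: c less_imp_neq[OF c, symmetric])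
  have [measurable]: "h \<in> borel_measurable \<mu>"
    using borel_measurable_continuous_onI[OF has_C1_gradD(3)[OF h]] by simp
  have h_pos: "0 < h x" for x using c by (simp add: h_def)
  have nu_h: "\<nu> = density \<mu> (\<lambda>x. ennreal (h x))" using nu by (simp add: h_def)
  have "AE x in \<mu>. rel_density \<mu> \<nu> x = h x"
    unfolding nu_h by (rule rel_density_density) (auto simp: sigma_finite_measure_axioms less_imp_le[OF h_pos])
  then have ae: "AE x in lborel. rel_density \<mu> \<nu> x = h x" by (simp add: same_null_sets)
  have meas: "rel_density \<mu> \<nu> \<in> borel_measurable borel"
    using rel_density_measurable[of \<mu> \<nu>] by simp
  have ac: "absolutely_continuous \<mu> \<nu>" unfolding nu_h by (rule absolutely_continuousI_density) simp
  have "AE x in lborel. weak_grad (rel_density \<mu> \<nu>) x = H x" by (rule weak_grad_C1[OF h ae meas])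
  with ae have "AE x in lborel. weak_grad (rel_density \<mu> \<nu>) x /\<^sub>R rel_density \<mu> \<nu> x = G' x"
  proof eventually_elim
    case (elim x)
    then show ?case using c by (simp add: H_def h_def)
  qed
  then have "AE x in \<mu>. weak_grad (rel_density \<mu> \<nu>) x /\<^sub>R rel_density \<mu> \<nu> x = G' x"
    by (simp add: same_null_sets)
  then have ae_nu: "AE x in \<nu>. weak_grad (rel_density \<mu> \<nu>) x /\<^sub>R rel_density \<mu> \<nu> x = G' x"
    unfolding nu_h by (subst AE_density) auto
  have "fisher_information \<nu> \<mu>
      = (\<integral>\<^sup>+x. ennreal ((norm (weak_grad (rel_density \<mu> \<nu>) x /\<^sub>R rel_density \<mu> \<nu> x))\<^sup>2) \<partial>\<nu>)"
    unfolding fisher_information_def using ac has_weak_grad_C1[OF h ae meas] by auto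
  also have "\<dots> \<le> (\<integral>\<^sup>+x. ennreal (B\<^sup>2) \<partial>\<nu>)"
    using ae_nu by (intro nn_integral_mono_AE, eventually_elim) (auto intro!: ennreal_leI power_mono bound)
  also have "\<dots> = ennreal (B\<^sup>2)" by (simp add: nu.emeasure_space_1)
  finally show ?thesis .
qed

text \<open>The log-Sobolev inequality for the law with density \<open>exp G / c\<close>, multiplied by \<open>c\<close>.\<close>

lemma entropy_exp_le_P2:
  assumes G: "has_C1_grad G G'" and bound: "\<And>x. norm (G' x) \<le> B"
    and int: "integrable \<mu> (\<lambda>x. exp (G x))" and intG: "integrable \<mu> (\<lambda>x. G x * exp (G x))"
    and moment: "(\<integral>\<^sup>+x. ennreal ((norm x)\<^sup>2 * exp (G x)) \<partial>\<mu>) < \<infinity>"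
  shows "(\<integral>x. G x * exp (G x) \<partial>\<mu>)
    \<le> (\<integral>x. exp (G x) \<partial>\<mu>) * (ln (\<integral>x. exp (G x) \<partial>\<mu>) + \<eta> * B\<^sup>2)"
proof -
  define c where "c = (\<integral>x. exp (G x) \<partial>\<mu>)"
  have c: "c > 0" unfolding c_def by (rule integral_exp_pos[OF prob_space_axioms int])
  define \<nu> where "\<nu> = density \<mu> (\<lambda>x. ennreal (exp (G x) / c))"
  have [measurable]: "G \<in> borel_measurable \<mu>"
    using borel_measurable_continuous_onI[OF has_C1_gradD(3)[OF G]] by simp
  have sets_nu: "sets \<nu> = sets \<mu>" by (simp add: \<nu>_def)
  have "emeasure \<nu> (space \<nu>) = (\<integral>\<^sup>+x. ennreal (exp (G x) / c) \<partial>\<mu>)"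
    unfolding \<nu>_def by (subst emeasure_density) (auto intro!: nn_integral_cong)
  also have "\<dots> = ennreal (\<integral>x. exp (G x) / c \<partial>\<mu>)"
    using int c by (intro nn_integral_eq_integral) auto
  also have "\<dots> = 1" using c by (simp add: c_def[symmetric])
  finally have prob: "prob_space \<nu>" by (rule prob_spaceI)
  interpret nu: prob_space \<nu> by fact
  have "(\<integral>\<^sup>+x. ennreal ((norm x)\<^sup>2) \<partial>\<nu>) = (\<integral>\<^sup>+x. ennreal (exp (G x) / c) * ennreal ((norm x)\<^sup>2) \<partial>\<mu>)"
    unfolding \<nu>_def by (rule nn_integral_density) auto
  also have "\<dots> = (\<integral>\<^sup>+x. ennreal (1 / c) * ennreal ((norm x)\<^sup>2 * exp (G x)) \<partial>\<mu>)"
    using c by (intro nn_integral_cong) (simp add: ennreal_mult[symmetric] mult.commute)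
  also have "\<dots> = ennreal (1 / c) * (\<integral>\<^sup>+x. ennreal ((norm x)\<^sup>2 * exp (G x)) \<partial>\<mu>)"
    by (rule nn_integral_cmult) auto
  also have "\<dots> < \<infinity>" using moment by (simp add: ennreal_mult_less_top)
  finally have P2: "\<nu> \<in> P2" using prob sets_nu sets_eq by (simp add: P2_def)
  have fisher: "fisher_information \<nu> \<mu> \<le> ennreal (B\<^sup>2)"
    by (rule fisher_information_exp_density[OF G bound \<nu>_def c prob])
  have "relative_entropy \<nu> \<mu> \<le> ereal \<eta> * enn2ereal (fisher_information \<nu> \<mu>)" by (rule entropy_le_fisher[OF P2])
  also have "\<dots> \<le> ereal \<eta> * enn2ereal (ennreal (B\<^sup>2))"
    using fisher eta_nonneg by (intro ereal_mult_left_mono) (auto simp: less_eq_ennreal.rep_eq)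
  also have "\<dots> = ereal (\<eta> * B\<^sup>2)" by (simp add: enn2ereal_ennreal)
  finally have le: "relative_entropy \<nu> \<mu> \<le> ereal (\<eta> * B\<^sup>2)" .
  then have "relative_entropy \<nu> \<mu> \<noteq> \<infinity>" by auto
  note ent = relative_entropy_integrable[OF prob_space_axioms prob sets_nu this]
  have ae: "AE x in \<mu>. rel_density \<mu> \<nu> x = exp (G x) / c"
    unfolding \<nu>_def using c by (intro rel_density_density sigma_finite_measure_axioms) auto
  have "(\<integral>x. ln (rel_density \<mu> \<nu> x) \<partial>\<nu>) = (\<integral>x. G x - ln c \<partial>\<nu>)"
  proof (rule integral_cong_AE)
    have "AE x in \<mu>. ln (rel_density \<mu> \<nu> x) = G x - ln c"
      using ae by eventually_elim (use c in \<open>simp add: ln_div\<close>)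
    then show "AE x in \<nu>. ln (rel_density \<mu> \<nu> x) = G x - ln c"
      unfolding \<nu>_def by (subst AE_density) auto
    show "(\<lambda>x. ln (rel_density \<mu> \<nu> x)) \<in> borel_measurable \<nu>"
      "(\<lambda>x. G x - ln c) \<in> borel_measurable \<nu>"
      using rel_density_measurable[of \<mu> \<nu>] by (simp_all add: measurable_cong_sets[OF sets_nu refl])
  qed
  also have "\<dots> = (\<integral>x. (exp (G x) / c) * (G x - ln c) \<partial>\<mu>)"
    unfolding \<nu>_def using c by (subst integral_density) auto
  also have "\<dots> = (\<integral>x. (1 / c) * (G x * exp (G x)) - (ln c / c) * exp (G x) \<partial>\<mu>)"
    by (rule Bochner_Integration.integral_cong) (auto simp: right_diff_distrib diff_divide_distrib mult.commute)
  also have "\<dots> = (1 / c) * (\<integral>x. G x * exp (G x) \<partial>\<mu>) - (ln c / c) * c"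
    unfolding c_def using int intG by simp
  finally have "(1 / c) * (\<integral>x. G x * exp (G x) \<partial>\<mu>) - (ln c / c) * c \<le> \<eta> * B\<^sup>2"
    using le ent(3) by simp
  then have "(\<integral>x. G x * exp (G x) \<partial>\<mu>) \<le> c * (ln c + \<eta> * B\<^sup>2)"
    using c by (simp add: field_simps)
  then show ?thesis by (simp add: c_def)
qed

end

text \<open>Dominated convergence of the difference quotients along arbitrary null sequences.\<close>

lemma DERIV_integral_exp:
  fixes g :: "'s \<Rightarrow> real"
  assumes "finite_measure M" and [measurable]: "g \<in> borel_measurable M" and C: "\<And>x. \<bar>g x\<bar> \<le> C"
  shows "((\<lambda>l. \<integral>x. exp (l * g x) \<partial>M) has_real_derivative (\<integral>x. g x * exp (l * g x) \<partial>M)) (at l)"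
proof -
  interpret finite_measure M by fact
  have int: "integrable M (\<lambda>x. exp (m * g x))" for m
  proof (rule integrable_const_bound[where B = "exp (\<bar>m\<bar> * C)"])
    have "m * g x \<le> \<bar>m\<bar> * C" for x
      using order_trans[OF abs_ge_self[of "m * g x"]] mult_left_mono[OF C[of x], of "\<bar>m\<bar>"]
      by (simp add: abs_mult)
    then show "AE x in M. norm (exp (m * g x)) \<le> exp (\<bar>m\<bar> * C)" by simp
  qed measurable
  have "((\<lambda>s. ((\<integral>x. exp ((l + s) * g x) \<partial>M) - (\<integral>x. exp (l * g x) \<partial>M)) / s)
      \<longlongrightarrow> (\<integral>x. g x * exp (l * g x) \<partial>M)) (at 0)"
    unfolding tendsto_at_iff_sequentially
  proof (intro allI impI)
    fix X :: "nat \<Rightarrow> real" assume X: "\<forall>i. X i \<in> UNIV - {0}" "X \<longlonglongrightarrow> 0"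
    have "Bseq X" using X(2) convergent_imp_Bseq convergentI by blast
    then obtain K where K: "\<And>n. \<bar>X n\<bar> \<le> K" unfolding Bseq_def by auto
    have X0: "X n \<noteq> 0" for n using X(1) by simp
    have "(\<lambda>n. \<integral>x. (exp ((l + X n) * g x) - exp (l * g x)) / X n \<partial>M)
        \<longlonglongrightarrow> (\<integral>x. g x * exp (l * g x) \<partial>M)"
    proof (rule integral_dominated_convergence[where w = "\<lambda>x. C * exp ((\<bar>l\<bar> + K) * C)"])
      show "AE x in M. (\<lambda>n. (exp ((l + X n) * g x) - exp (l * g x)) / X n) \<longlonglongrightarrow> g x * exp (l * g x)"
      proof (rule AE_I2)
        fix x
        have "((\<lambda>s. exp (s * g x)) has_real_derivative g x * exp (l * g x)) (at l)"
          by (auto intro!: derivative_eq_intros)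
        then have "((\<lambda>s. (exp ((l + s) * g x) - exp (l * g x)) / s) \<longlongrightarrow> g x * exp (l * g x)) (at 0)"
          by (simp add: DERIV_def)
        moreover have "filterlim X (at 0) sequentially"
          using X X0 by (simp add: filterlim_at)
        ultimately show "(\<lambda>n. (exp ((l + X n) * g x) - exp (l * g x)) / X n) \<longlonglongrightarrow> g x * exp (l * g x)"
          by (rule filterlim_compose)
      qed
      show "AE x in M. norm ((exp ((l + X n) * g x) - exp (l * g x)) / X n) \<le> C * exp ((\<bar>l\<bar> + K) * C)" for n
      proof (rule AE_I2)
        fix x
        \<comment> \<open>Convexity of the exponential bounds a difference by the larger slope.\<close>
        have exp_diff: "\<bar>exp a - exp b\<bar> \<le> \<bar>a - b\<bar> * exp m" if "a \<le> m" "b \<le> m" for a b m :: real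
        proof -
          have one: "exp a - exp b \<le> \<bar>a - b\<bar> * exp m" if "a \<le> m" for a b :: real
          proof -
            have "exp a * (1 + (b - a)) \<le> exp a * exp (b - a)"
              by (intro mult_left_mono exp_ge_add_one_self) simp
            also have "\<dots> = exp b" by (simp add: exp_diff)
            finally have "exp a - exp b \<le> (a - b) * exp a" by (simp add: algebra_simps)
            also have "\<dots> \<le> \<bar>a - b\<bar> * exp m" using that by (intro mult_mono) auto
            finally show ?thesis .
          qed
          from one[OF that(1), of b] one[OF that(2), of a] show ?thesis
            by (simp add: abs_minus_commute abs_le_iff)
        qed
        have C0: "0 \<le> C" using C[of x] by linarith
        have K0: "0 \<le> K" using K[of 0] by linarith
        have top: "m * g x \<le> (\<bar>l\<bar> + K) * C" if "\<bar>m\<bar> \<le> \<bar>l\<bar> + K" for m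
        proof -
          have "m * g x \<le> \<bar>m\<bar> * \<bar>g x\<bar>" by (metis abs_ge_self abs_mult)
          also have "\<dots> \<le> (\<bar>l\<bar> + K) * C" using that C C0 by (intro mult_mono) auto
          finally show ?thesis .
        qed
        have "\<bar>l + X n\<bar> \<le> \<bar>l\<bar> + K" using K[of n] by linarith
        then have "\<bar>exp ((l + X n) * g x) - exp (l * g x)\<bar>
            \<le> \<bar>(l + X n) * g x - l * g x\<bar> * exp ((\<bar>l\<bar> + K) * C)"
          using K0 by (intro exp_diff top) auto
        also have "\<dots> = \<bar>X n\<bar> * (\<bar>g x\<bar> * exp ((\<bar>l\<bar> + K) * C))" by (simp add: algebra_simps abs_mult)
        also have "\<dots> \<le> \<bar>X n\<bar> * (C * exp ((\<bar>l\<bar> + K) * C))"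
          using C by (intro mult_left_mono mult_right_mono) auto
        finally show "norm ((exp ((l + X n) * g x) - exp (l * g x)) / X n) \<le> C * exp ((\<bar>l\<bar> + K) * C)"
          using X0[of n] by (simp add: divide_le_eq mult.commute)
      qed
    qed simp_all
    moreover have "(\<integral>x. (exp ((l + X n) * g x) - exp (l * g x)) / X n \<partial>M)
        = ((\<integral>x. exp ((l + X n) * g x) \<partial>M) - (\<integral>x. exp (l * g x) \<partial>M)) / X n" for n
      using int by simp
    ultimately show "((\<lambda>s. ((\<integral>x. exp ((l + s) * g x) \<partial>M) - (\<integral>x. exp (l * g x) \<partial>M)) / s) \<circ> X)
        \<longlonglongrightarrow> (\<integral>x. g x * exp (l * g x) \<partial>M)"
      unfolding comp_def by (simp only:)
  qed
  then show ?thesis by (simp add: DERIV_def)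
qed

context log_sobolev
begin

text \<open>The function \<open>G = g - ln (1 + d\<^sup>2 |x|\<^sup>2)\<close> has a density with a second moment, and its gradient differs
  from that of \<open>g\<close> by at most \<open>d\<close>, because \<open>2 d |x| \<le> 1 + d\<^sup>2 |x|\<^sup>2\<close>.  Let \<open>d\<close> tend to \<open>0\<close>.\<close>

lemma entropy_exp_le:
  assumes g: "has_C1_grad g g'" and bound: "\<And>x. norm (g' x) \<le> B" and C: "\<And>x. \<bar>g x\<bar> \<le> C"
  shows "(\<integral>x. g x * exp (g x) \<partial>\<mu>)
    \<le> (\<integral>x. exp (g x) \<partial>\<mu>) * (ln (\<integral>x. exp (g x) \<partial>\<mu>) + \<eta> * B\<^sup>2)"
proof -
  have [measurable]: "g \<in> borel_measurable \<mu>"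
    using borel_measurable_continuous_onI[OF has_C1_gradD(3)[OF g]] by simp
  have C0: "0 \<le> C" using C[of 0] by linarith
  define d where "d = (\<lambda>n. 1 / real (Suc n))"
  have d: "0 < d n" for n by (simp add: d_def)
  have d_lim: "d \<longlonglongrightarrow> 0" unfolding d_def using LIMSEQ_inverse_real_of_nat by (simp add: inverse_eq_divide)
  define q where "q = (\<lambda>n x. 1 + (d n)\<^sup>2 * (norm (x :: 'a))\<^sup>2)"
  have q1: "1 \<le> q n x" for n x by (simp add: q_def)
  then have q_pos: "0 < q n x" for n x by (smt (verit))
  define G where "G = (\<lambda>n x. g x - ln (q n x))"
  define G' where "G' = (\<lambda>n x. g' x - (inverse (q n x) * (2 * (d n)\<^sup>2)) *\<^sub>R x)"
  have [measurable]: "G n \<in> borel_measurable \<mu>" for n unfolding G_def q_def by measurable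
  have G: "has_C1_grad (G n) (G' n)" for n
    unfolding has_C1_grad_def
  proof (intro conjI allI)
    fix x
    have "GDERIV (q n) x :> (2 * (d n)\<^sup>2) *\<^sub>R x"
      unfolding q_def gderiv_def power2_norm_eq_inner
      by (auto intro!: derivative_eq_intros simp: inner_commute)
    then have "GDERIV (\<lambda>x. ln (q n x)) x :> inverse (q n x) *\<^sub>R ((2 * (d n)\<^sup>2) *\<^sub>R x)"
      by (rule GDERIV_DERIV_compose) (rule DERIV_ln[OF q_pos])
    from GDERIV_diff[OF has_C1_gradD(1)[OF g] this]
    show "GDERIV (G n) x :> G' n x" by (simp add: G_def G'_def)
  next
    have "continuous_on UNIV (q n)" unfolding q_def by (intro continuous_intros)
    then show "continuous_on UNIV (G' n)"
      unfolding G'_def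
      by (intro continuous_intros has_C1_gradD(2)[OF g] ballI less_imp_neq[OF q_pos, symmetric])
  qed
  have G'_bound: "norm (G' n x) \<le> B + d n" for n x
  proof -
    have "0 \<le> d n * (1 - d n * norm x)\<^sup>2" using d[of n] by simp
    then have "2 * (d n)\<^sup>2 * norm x \<le> d n * q n x"
      unfolding q_def by (simp add: power2_eq_square algebra_simps)
    then have "norm ((inverse (q n x) * (2 * (d n)\<^sup>2)) *\<^sub>R x) \<le> d n"
      using q_pos[of n x] by (simp add: field_simps abs_mult)
    then show ?thesis
      unfolding G'_def using bound[of x] norm_triangle_ineq4 order_trans by (smt (verit))
  qed
  have exp_G: "exp (G n x) = exp (g x) / q n x" for n x
    using q_pos[of n x] by (simp add: G_def exp_diff)
  have G_le: "G n x \<le> C" for n x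
    using C[of x] q1[of n x] by (simp add: G_def abs_le_iff) (smt (verit) ln_ge_zero)
  have exp_bound: "\<bar>exp t\<bar> \<le> exp C" "\<bar>t * exp t\<bar> \<le> 1 + C * exp C" if "t \<le> C" for t
  proof -
    show "\<bar>exp t\<bar> \<le> exp C" using that by simp
    show "\<bar>t * exp t\<bar> \<le> 1 + C * exp C"
    proof (cases "t \<le> 0")
      case True
      have "exp t * (- ln (exp t)) \<le> 1" by (rule neg_mult_ln_le_one) simp
      moreover have "0 \<le> C * exp C" using C0 by simp
      ultimately show ?thesis using True by (simp add: abs_mult mult.commute)
    next
      case False
      then have "t * exp t \<le> C * exp C" using that C0 by (intro mult_mono) auto
      then show ?thesis using False by simp
    qed
  qed
  have g_le: "g x \<le> C" for x using C[of x] by linarith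
  have int: "integrable \<mu> (\<lambda>x. exp (G n x))" "integrable \<mu> (\<lambda>x. G n x * exp (G n x))" for n
    by (rule integrable_const_bound[where B = "exp C"], use exp_bound(1)[OF G_le] in auto)
      (rule integrable_const_bound[where B = "1 + C * exp C"], use exp_bound(2)[OF G_le] in auto)
  have moment: "(\<integral>\<^sup>+x. ennreal ((norm x)\<^sup>2 * exp (G n x)) \<partial>\<mu>) < \<infinity>" for n
  proof -
    have "(\<integral>\<^sup>+x. ennreal ((norm x)\<^sup>2 * exp (G n x)) \<partial>\<mu>) \<le> (\<integral>\<^sup>+x. ennreal (exp C / (d n)\<^sup>2) \<partial>\<mu>)"
    proof (intro nn_integral_mono ennreal_leI)
      fix x
      have "(d n)\<^sup>2 * (norm x)\<^sup>2 \<le> q n x" by (simp add: q_def)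
      then have "(norm x)\<^sup>2 / q n x \<le> 1 / (d n)\<^sup>2"
        using d[of n] q_pos[of n x] by (simp add: field_simps)
      then have "(norm x)\<^sup>2 / q n x * exp (g x) \<le> 1 / (d n)\<^sup>2 * exp C"
        using g_le[of x] by (intro mult_mono) auto
      then show "(norm x)\<^sup>2 * exp (G n x) \<le> exp C / (d n)\<^sup>2"
        by (simp add: exp_G)
    qed
    also have "\<dots> < \<infinity>" by (simp add: emeasure_space_1)
    finally show ?thesis .
  qed
  have G_lim: "(\<lambda>n. G n x) \<longlonglongrightarrow> g x" for x
  proof -
    have "(\<lambda>n. g x - ln (q n x)) \<longlonglongrightarrow> g x - ln (1 + 0\<^sup>2 * (norm x)\<^sup>2)"
      unfolding q_def by (intro tendsto_intros d_lim) simp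
    then show ?thesis by (simp add: G_def)
  qed
  define c where "c = (\<integral>x. exp (g x) \<partial>\<mu>)"
  have int_g: "integrable \<mu> (\<lambda>x. exp (g x))"
    by (rule integrable_const_bound[where B = "exp C"]) (use exp_bound(1)[OF g_le] in auto)
  have c: "0 < c" unfolding c_def by (rule integral_exp_pos[OF prob_space_axioms int_g])
  have lim1: "(\<lambda>n. \<integral>x. exp (G n x) \<partial>\<mu>) \<longlonglongrightarrow> c"
    unfolding c_def
  proof (rule integral_dominated_convergence[where w = "\<lambda>x. exp C"])
    show "AE x in \<mu>. (\<lambda>n. exp (G n x)) \<longlonglongrightarrow> exp (g x)"
      by (intro AE_I2 tendsto_intros G_lim)
  qed (use exp_bound(1)[OF G_le] in auto)
  have lim2: "(\<lambda>n. \<integral>x. G n x * exp (G n x) \<partial>\<mu>) \<longlonglongrightarrow> (\<integral>x. g x * exp (g x) \<partial>\<mu>)"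
  proof (rule integral_dominated_convergence[where w = "\<lambda>x. 1 + C * exp C"])
    show "AE x in \<mu>. (\<lambda>n. G n x * exp (G n x)) \<longlonglongrightarrow> g x * exp (g x)"
      by (intro AE_I2 tendsto_intros G_lim)
  qed (use exp_bound(2)[OF G_le] in auto)
  have "(\<integral>x. G n x * exp (G n x) \<partial>\<mu>)
      \<le> (\<integral>x. exp (G n x) \<partial>\<mu>) * (ln (\<integral>x. exp (G n x) \<partial>\<mu>) + \<eta> * (B + d n)\<^sup>2)" for n
    by (rule entropy_exp_le_P2[OF G G'_bound int moment])
  moreover have "(\<lambda>n. (\<integral>x. exp (G n x) \<partial>\<mu>) * (ln (\<integral>x. exp (G n x) \<partial>\<mu>) + \<eta> * (B + d n)\<^sup>2))
      \<longlonglongrightarrow> c * (ln c + \<eta> * (B + 0)\<^sup>2)"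
    using c by (intro tendsto_intros lim1 d_lim) simp
  ultimately have "(\<integral>x. g x * exp (g x) \<partial>\<mu>) \<le> c * (ln c + \<eta> * (B + 0)\<^sup>2)"
    by (intro LIMSEQ_le[OF lim2]) auto
  then show ?thesis by (simp add: c_def)
qed

text \<open>With \<open>F l = \<integral> exp (l g) d\<mu>\<close>, the entropy bound for \<open>l g\<close> reads \<open>l F' l / F l \<le> ln (F l) + \<eta> B\<^sup>2 l\<^sup>2\<close>,
  which says that \<open>ln (F l) / l - \<eta> B\<^sup>2 l\<close> decreases.  Its limit at \<open>0\<close> is the mean of \<open>g\<close>.\<close>

lemma herbst:
  assumes g: "has_C1_grad g g'" and bound: "\<And>x. norm (g' x) \<le> B" and C: "\<And>x. \<bar>g x\<bar> \<le> C"
    and l: "0 < l"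
  shows "ln (\<integral>x. exp (l * g x) \<partial>\<mu>) \<le> l * (\<integral>x. g x \<partial>\<mu>) + \<eta> * B\<^sup>2 * l\<^sup>2"
proof -
  have gm [measurable]: "g \<in> borel_measurable \<mu>"
    using borel_measurable_continuous_onI[OF has_C1_gradD(3)[OF g]] by simp
  have int: "integrable \<mu> (\<lambda>x. exp (m * g x))" for m
  proof (rule integrable_const_bound[where B = "exp (\<bar>m\<bar> * C)"])
    have "m * g x \<le> \<bar>m\<bar> * C" for x
      using order_trans[OF abs_ge_self[of "m * g x"]] mult_left_mono[OF C[of x], of "\<bar>m\<bar>"]
      by (simp add: abs_mult)
    then show "AE x in \<mu>. norm (exp (m * g x)) \<le> exp (\<bar>m\<bar> * C)" by simp
  qed measurable
  define F where "F = (\<lambda>m. \<integral>x. exp (m * g x) \<partial>\<mu>)"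
  define F' where "F' = (\<lambda>m. \<integral>x. g x * exp (m * g x) \<partial>\<mu>)"
  have F: "(F has_real_derivative F' m) (at m)" for m
    unfolding F_def F'_def by (rule DERIV_integral_exp[OF _ gm C]) unfold_locales
  have F_pos: "0 < F m" for m unfolding F_def by (rule integral_exp_pos[OF prob_space_axioms int])
  have lnF: "((\<lambda>m. ln (F m)) has_real_derivative F' m / F m) (at m)" for m
    using DERIV_chain2[OF DERIV_ln[OF F_pos] F] by (simp add: divide_inverse mult.commute)
  have F'_le: "m * F' m \<le> F m * (ln (F m) + \<eta> * B\<^sup>2 * m\<^sup>2)" if "0 < m" for m
  proof -
    have 1: "has_C1_grad (\<lambda>x. m * g x) (\<lambda>x. m *\<^sub>R g' x)"
      using has_C1_grad_mult[OF has_C1_grad_const[of m] g] by simp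
    have 2: "norm (m *\<^sub>R g' x) \<le> m * B" for x using that bound by simp
    have 3: "\<bar>m * g x\<bar> \<le> m * C" for x using that C by (simp add: abs_mult)
    have "(\<integral>x. m * g x * exp (m * g x) \<partial>\<mu>) \<le> F m * (ln (F m) + \<eta> * (m * B)\<^sup>2)"
      unfolding F_def by (rule entropy_exp_le[OF 1 2 3])
    then show ?thesis by (simp add: F'_def mult.assoc power_mult_distrib mult.commute[of "m\<^sup>2"])
  qed
  define k where "k = (\<lambda>m. ln (F m) / m - \<eta> * B\<^sup>2 * m)"
  have decr: "k l \<le> k s" if s: "0 < s" "s \<le> l" for s
  proof (rule DERIV_nonpos_imp_nonincreasing[OF s(2)])
    fix m assume "s \<le> m" "m \<le> l"
    then have m: "0 < m" using s by simp
    have "(k has_real_derivative (F' m / F m * m - ln (F m) * 1) / (m * m) - \<eta> * B\<^sup>2 * 1) (at m)"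
      unfolding k_def using m
      by (intro DERIV_diff DERIV_divide lnF DERIV_ident DERIV_cmult) simp
    moreover have "(F' m / F m * m - ln (F m) * 1) / (m * m) - \<eta> * B\<^sup>2 * 1 \<le> 0"
    proof -
      have "F' m / F m * m \<le> ln (F m) + \<eta> * B\<^sup>2 * m\<^sup>2"
        using F'_le[OF m] F_pos[of m] by (simp add: divide_le_eq mult.commute)
      then have "F' m / F m * m - ln (F m) * 1 \<le> \<eta> * B\<^sup>2 * (m * m)"
        by (simp add: power2_eq_square)
      then have "(F' m / F m * m - ln (F m) * 1) / (m * m) \<le> \<eta> * B\<^sup>2"
        using m by (subst pos_divide_le_eq) auto
      then show ?thesis by simp
    qed
    ultimately show "\<exists>y. (k has_real_derivative y) (at m) \<and> y \<le> 0" by blast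
  qed
  have F0: "F 0 = 1" by (simp add: F_def prob_space)
  have F'0: "F' 0 = (\<integral>x. g x \<partial>\<mu>)" by (simp add: F'_def)
  have "((\<lambda>s. ln (F s) / s) \<longlongrightarrow> F' 0) (at 0)"
    using lnF[of 0] F0 by (simp add: DERIV_def)
  then have "((\<lambda>s. ln (F s) / s) \<longlongrightarrow> F' 0) (at_right 0)"
    by (auto intro: tendsto_mono[OF at_le])
  then have "(k \<longlongrightarrow> F' 0 - \<eta> * B\<^sup>2 * 0) (at_right 0)"
    unfolding k_def by (intro tendsto_intros)
  moreover have "\<forall>\<^sub>F s in at_right 0. k l \<le> k s"
    unfolding eventually_at_right_field using decr l by (intro exI[of _ l]) auto
  ultimately have "k l \<le> F' 0 - \<eta> * B\<^sup>2 * 0"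
    by (intro tendsto_lowerbound) (auto simp: trivial_limit_at_right_real)
  then have "ln (F l) / l \<le> F' 0 + \<eta> * B\<^sup>2 * l" by (simp add: k_def)
  then have "ln (F l) \<le> (F' 0 + \<eta> * B\<^sup>2 * l) * l" using l by (simp add: divide_le_eq)
  then have "ln (F l) \<le> l * (\<integral>x. g x \<partial>\<mu>) + \<eta> * B\<^sup>2 * l\<^sup>2"
    by (simp add: F'0 power2_eq_square algebra_simps)
  then show ?thesis unfolding F_def .
qed

end

context log_sobolev
begin

lemma transport_entropy_bounded:
  assumes g: "has_C1_grad g g'" and bound: "\<And>x. norm (g' x) \<le> B" and C: "\<And>x. \<bar>g x\<bar> \<le> C"
    and nu: "prob_space \<nu>" "sets \<nu> = sets borel" and fin: "relative_entropy \<nu> \<mu> \<noteq> \<infinity>" and l: "0 < l"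
  shows "l * ((\<integral>x. g x \<partial>\<nu>) - (\<integral>x. g x \<partial>\<mu>))
    \<le> (\<integral>x. ln (rel_density \<mu> \<nu> x) \<partial>\<nu>) + \<eta> * B\<^sup>2 * l\<^sup>2"
proof -
  interpret nu: prob_space \<nu> by fact
  have gm: "g \<in> borel_measurable borel"
    by (rule borel_measurable_continuous_onI[OF has_C1_gradD(3)[OF g]])
  have sets: "sets \<nu> = sets \<mu>" using nu(2) sets_eq by simp
  note [measurable_cong] = nu(2)
  have [measurable]: "g \<in> borel_measurable \<mu>" "g \<in> borel_measurable \<nu>" using gm by simp_all
  have 1: "integrable \<nu> (\<lambda>x. l * g x)"
    by (intro integrable_mult_right nu.integrable_const_bound[where B = C]) (use C in auto)
  have lC: "l * g x \<le> l * C" for x using C[of x] l by (intro mult_left_mono) auto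
  have 2: "integrable \<mu> (\<lambda>x. exp (l * g x))"
    by (rule integrable_const_bound[where B = "exp (l * C)"]) (use lC in auto)
  have "(\<integral>x. l * g x \<partial>\<nu>) \<le> (\<integral>x. ln (rel_density \<mu> \<nu> x) \<partial>\<nu>) + ln (\<integral>x. exp (l * g x) \<partial>\<mu>)"
    by (rule donsker_varadhan[OF prob_space_axioms nu(1) sets fin 1 2]) simp
  with herbst[OF g bound C l] show ?thesis by (simp add: right_diff_distrib)
qed

text \<open>Bounded functions are reached by the truncation \<open>k arctan (g / k)\<close>, which is smooth, converges to \<open>g\<close>,
  is dominated by \<open>|g|\<close> and has no larger gradient.  The bound is linear in \<open>g\<close> and survives the limit for
  each fixed \<open>l\<close>; it is optimised in \<open>l\<close> only afterwards.\<close>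

lemma transport_entropy:
  assumes g: "has_C1_grad g g'" and bound: "\<And>x. norm (g' x) \<le> B"
    and nu: "prob_space \<nu>" "sets \<nu> = sets borel" and fin: "relative_entropy \<nu> \<mu> \<noteq> \<infinity>"
    and int_nu: "integrable \<nu> g" and int_mu: "integrable \<mu> g" and l: "0 < l"
  shows "l * ((\<integral>x. g x \<partial>\<nu>) - (\<integral>x. g x \<partial>\<mu>))
    \<le> (\<integral>x. ln (rel_density \<mu> \<nu> x) \<partial>\<nu>) + \<eta> * B\<^sup>2 * l\<^sup>2"
proof -
  have gm: "g \<in> borel_measurable borel"
    by (rule borel_measurable_continuous_onI[OF has_C1_gradD(3)[OF g]])
  define k where "k = (\<lambda>n. real (Suc n))"
  have k: "0 < k n" for n by (simp add: k_def)
  define T where "T = (\<lambda>n s. k n * arctan (s / k n))"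
  define T' where "T' = (\<lambda>n s. inverse (1 + (s / k n)\<^sup>2))"
  have T_deriv: "(T n has_real_derivative T' n s) (at s)" for n s
    unfolding T_def T'_def using k[of n]
    by (auto intro!: derivative_eq_intros)
  have T'_bound: "\<bar>T' n s\<bar> \<le> 1" for n s
  proof -
    have "1 \<le> 1 + (s / k n)\<^sup>2" by simp
    then show ?thesis unfolding T'_def by (simp add: inverse_le_1_iff)
  qed
  have T'_cont: "continuous_on UNIV (T' n)" for n
    unfolding T'_def
  proof (intro continuous_intros ballI)
    show "1 + (s / k n)\<^sup>2 \<noteq> 0" for s using zero_le_power2[of "s / k n"] by linarith
  qed (use k[of n] in auto)
  have T_C1: "has_C1_grad (T n) (T' n)" for n
    unfolding has_C1_grad_def using T_deriv T'_cont by simp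
  have T_le: "\<bar>T n s\<bar> \<le> \<bar>s\<bar>" for n s
    using lipschitz_from_grad[OF T_C1, of n 1 s 0] T'_bound by (simp add: T_def)
  have T_bounded: "\<bar>T n s\<bar> \<le> k n * pi" for n s
  proof -
    have "\<bar>arctan (s / k n)\<bar> \<le> pi"
      using arctan_bounded[of "s / k n"] pi_gt_zero unfolding abs_le_iff by linarith
    then show ?thesis using k[of n] by (simp add: T_def abs_mult)
  qed
  have T_lim: "(\<lambda>n. T n s) \<longlonglongrightarrow> s" for s
  proof (cases "s = 0")
    case False
    have "((\<lambda>h. arctan h / h) \<longlongrightarrow> 1) (at 0)"
      using DERIV_arctan[of 0] by (simp add: DERIV_def)
    moreover have "filterlim (\<lambda>n. s / k n) (at 0) sequentially"
    proof -
      have "(\<lambda>n. s * (1 / k n)) \<longlonglongrightarrow> s * 0"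
        unfolding k_def using LIMSEQ_inverse_real_of_nat by (intro tendsto_intros) (simp add: inverse_eq_divide)
      then show ?thesis using False k by (simp add: filterlim_at less_imp_neq[symmetric])
    qed
    ultimately have "(\<lambda>n. arctan (s / k n) / (s / k n)) \<longlonglongrightarrow> 1" by (rule filterlim_compose)
    then have "(\<lambda>n. s * (arctan (s / k n) / (s / k n))) \<longlonglongrightarrow> s * 1" by (intro tendsto_intros)
    then show ?thesis using False by (simp add: T_def mult.commute)
  qed (simp add: T_def)
  have Tg: "has_C1_grad (\<lambda>x. T n (g x)) (\<lambda>x. T' n (g x) *\<^sub>R g' x)" for n
    by (rule has_C1_grad_compose[OF g T_deriv T'_cont])
  have Tg_bound: "norm (T' n (g x) *\<^sub>R g' x) \<le> B" for n x
  proof -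
    have "norm (T' n (g x) *\<^sub>R g' x) \<le> 1 * norm (g' x)"
      unfolding norm_scaleR by (intro mult_right_mono T'_bound norm_ge_zero)
    then show ?thesis using bound[of x] by simp
  qed
  have Tg_meas: "(\<lambda>x. T n (g x)) \<in> borel_measurable borel" for n
    by (rule borel_measurable_continuous_onI[OF has_C1_gradD(3)[OF Tg]])
  have lim: "(\<lambda>n. \<integral>x. T n (g x) \<partial>M) \<longlonglongrightarrow> (\<integral>x. g x \<partial>M)"
    if "integrable M g" "sets M = sets borel" for M
  proof (rule integral_dominated_convergence[where w = "\<lambda>x. \<bar>g x\<bar>"])
    show "(\<lambda>x. T n (g x)) \<in> borel_measurable M" for n
      using Tg_meas[of n] unfolding measurable_cong_sets[OF that(2) refl] .
    show "AE x in M. norm (T n (g x)) \<le> \<bar>g x\<bar>" for n using T_le by simp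
    show "AE x in M. (\<lambda>n. T n (g x)) \<longlonglongrightarrow> g x" using T_lim by simp
  qed (use that in auto)
  have "l * ((\<integral>x. T n (g x) \<partial>\<nu>) - (\<integral>x. T n (g x) \<partial>\<mu>))
      \<le> (\<integral>x. ln (rel_density \<mu> \<nu> x) \<partial>\<nu>) + \<eta> * B\<^sup>2 * l\<^sup>2" for n
    by (rule transport_entropy_bounded[OF Tg Tg_bound T_bounded nu fin l])
  moreover have "(\<lambda>n. l * ((\<integral>x. T n (g x) \<partial>\<nu>) - (\<integral>x. T n (g x) \<partial>\<mu>)))
      \<longlonglongrightarrow> l * ((\<integral>x. g x \<partial>\<nu>) - (\<integral>x. g x \<partial>\<mu>))"
    by (intro tendsto_intros lim int_nu int_mu nu(2) sets_eq)
  ultimately show ?thesis by (intro LIMSEQ_le_const2) auto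
qed

text \<open>The scalar bound for \<open>g = \<langle>u, f\<rangle>\<close> in the direction \<open>u\<close> of the difference of the means, whose Lipschitz
  constant is \<open>|u| L\<close>.\<close>

lemma mean_transport_entropy:
  fixes f :: "'a \<Rightarrow> 'h::{real_inner,complete_space}"
  assumes f: "C1_fun f" and lip: "lipschitz_on L UNIV f"
    and nu: "prob_space \<nu>" "sets \<nu> = sets borel" and fin: "relative_entropy \<nu> \<mu> \<noteq> \<infinity>"
    and f_nu: "(\<integral>\<^sup>+x. ennreal (norm (f x)) \<partial>\<nu>) < \<infinity>" and f_mu: "(\<integral>\<^sup>+x. ennreal (norm (f x)) \<partial>\<mu>) < \<infinity>"
  shows "(norm (mean f \<nu> - mean f \<mu>))\<^sup>2 \<le> 4 * \<eta> * L\<^sup>2 * (\<integral>x. ln (rel_density \<mu> \<nu> x) \<partial>\<nu>)"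
proof -
  interpret nu: prob_space \<nu> by fact
  define H where "H = (\<integral>x. ln (rel_density \<mu> \<nu> x) \<partial>\<nu>)"
  have L0: "0 \<le> L" using lip by (simp add: lipschitz_on_def)
  have f_cont: "continuous_on UNIV f" by (rule lipschitz_on_continuous_on[OF lip])
  define u where "u = mean f \<nu> - mean f \<mu>"
  note m_nu = mean_inner[OF nu.finite_measure_axioms nu(2) f_cont f_nu, of u]
  note m_mu = mean_inner[OF finite_measure_axioms sets_eq f_cont f_mu, of u]
  define g where "g = (\<lambda>x. inner u (f x))"
  obtain f' where f': "\<And>x. (f has_derivative blinfun_apply (f' x)) (at x)" and f'_cont: "continuous_on UNIV f'"
    using f unfolding C1_fun_def by blast
  have "C1_fun g"
    unfolding C1_fun_def
  proof (intro exI conjI allI)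
    show "(g has_derivative blinfun_apply (blinfun_inner_right u o\<^sub>L f' x)) (at x)" for x
      unfolding g_def using has_derivative_inner_right[OF f'[of x], of u]
      by (simp add: blinfun_compose.rep_eq comp_def)
    show "continuous_on UNIV (\<lambda>x. blinfun_inner_right u o\<^sub>L f' x)"
      by (intro continuous_intros f'_cont)
  qed
  then have g: "has_C1_grad g (grad g)" by (simp add: C1_fun_iff_grad)
  have g_lip: "\<bar>g x - g y\<bar> \<le> norm u * L * dist x y" for x y
  proof -
    have "\<bar>g x - g y\<bar> \<le> norm u * norm (f x - f y)"
      unfolding g_def inner_diff_right[symmetric] by (rule Cauchy_Schwarz_ineq2)
    also have "\<dots> \<le> norm u * (L * dist x y)"
      using lip by (intro mult_left_mono) (auto simp: lipschitz_on_def dist_norm)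
    finally show ?thesis by (simp add: mult.assoc)
  qed
  have g_bound: "norm (grad g x) \<le> norm u * L" for x
  proof -
    define v where "v = grad g x"
    have "((\<lambda>t. g (x + t *\<^sub>R v)) has_derivative (\<lambda>t. inner (t *\<^sub>R v) v)) (at 0)"
    proof (rule has_derivative_compose[where f = "\<lambda>t. x + t *\<^sub>R v" and g = g and g' = "\<lambda>h. inner h v"])
      show "((\<lambda>t. x + t *\<^sub>R v) has_derivative (\<lambda>t. t *\<^sub>R v)) (at 0)"
        by (auto intro!: derivative_eq_intros)
      show "(g has_derivative (\<lambda>h. inner h v)) (at (x + 0 *\<^sub>R v))"
        using has_C1_gradD(1)[OF g, of x] by (simp add: gderiv_def v_def)
    qed
    then have "((\<lambda>t. g (x + t *\<^sub>R v)) has_real_derivative inner v v) (at 0)"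
      unfolding has_field_derivative_def by (rule has_derivative_eq_rhs) (simp add: fun_eq_iff)
    then have lim: "((\<lambda>t. (g (x + t *\<^sub>R v) - g x) / t) \<longlongrightarrow> inner v v) (at 0)"
      by (simp add: DERIV_def)
    have "inner v v \<le> norm u * L * norm v"
    proof (rule tendsto_upperbound[OF lim])
      show "\<forall>\<^sub>F t in at 0. (g (x + t *\<^sub>R v) - g x) / t \<le> norm u * L * norm v"
        unfolding eventually_at_filter
      proof (intro always_eventually allI impI)
        fix t :: real assume t: "t \<noteq> 0"
        have "(g (x + t *\<^sub>R v) - g x) / t \<le> \<bar>g (x + t *\<^sub>R v) - g x\<bar> / \<bar>t\<bar>"
          by (metis abs_divide abs_ge_self)
        also have "\<dots> \<le> norm u * L * norm v"
          using g_lip[of "x + t *\<^sub>R v" x] t by (simp add: dist_norm divide_le_eq algebra_simps)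
        finally show "(g (x + t *\<^sub>R v) - g x) / t \<le> norm u * L * norm v" .
      qed
    qed simp
    then have "norm v * norm v \<le> norm u * L * norm v" by (simp add: norm_eq_sqrt_inner)
    then have "norm v \<le> norm u * L" using L0 by (cases "v = 0") auto
    then show ?thesis by (simp add: v_def)
  qed
  have ineq: "l * (norm u)\<^sup>2 \<le> H + \<eta> * (norm u * L)\<^sup>2 * l\<^sup>2" if "0 < l" for l
  proof -
    have "integrable \<nu> g" "integrable \<mu> g" using m_nu m_mu by (auto simp: g_def has_bochner_integral_iff)
    from transport_entropy[OF g g_bound nu fin this that]
    have "l * ((\<integral>x. g x \<partial>\<nu>) - (\<integral>x. g x \<partial>\<mu>)) \<le> H + \<eta> * (norm u * L)\<^sup>2 * l\<^sup>2" by (simp add: H_def)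
    moreover have "(\<integral>x. g x \<partial>\<nu>) - (\<integral>x. g x \<partial>\<mu>) = (norm u)\<^sup>2"
      using m_nu m_mu by (simp add: g_def has_bochner_integral_iff inner_diff_right[symmetric]
          u_def[symmetric] power2_norm_eq_inner)
    ultimately show ?thesis by simp
  qed
  have "(norm u)\<^sup>2 \<le> 4 * \<eta> * L\<^sup>2 * H"
  proof (cases "\<eta> * L\<^sup>2 = 0")
    case True
    have "u = 0"
    proof (rule ccontr)
      assume u: "u \<noteq> 0"
      \<comment> \<open>The quadratic term vanishes, so the bound is violated for large exponents.\<close>
      define l where "l = (\<bar>H\<bar> + 1) / (norm u)\<^sup>2"
      have "0 < l" using u by (simp add: l_def)
      have "\<eta> * (norm u * L)\<^sup>2 * l\<^sup>2 = 0" using True by auto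
      then have "l * (norm u)\<^sup>2 \<le> H" using ineq[OF \<open>0 < l\<close>] by linarith
      then show False using u by (simp add: l_def)
    qed
    then show ?thesis using True by auto
  next
    case False
    then have pos: "0 < \<eta> * L\<^sup>2" using eta_nonneg by (simp add: less_le)
    \<comment> \<open>The optimal exponent in the transport-entropy bound.\<close>
    define l where "l = 1 / (2 * (\<eta> * L\<^sup>2))"
    have "0 < l" using pos by (simp add: l_def)
    have "\<eta> * (norm u * L)\<^sup>2 * l\<^sup>2 = (\<eta> * L\<^sup>2 * l) * (norm u)\<^sup>2 * l"
      by (simp add: power_mult_distrib power2_eq_square)
    moreover have "\<eta> * L\<^sup>2 * l = 1 / 2" using pos by (auto simp: l_def)
    ultimately have "l * (norm u)\<^sup>2 \<le> H + 1 / 2 * (norm u)\<^sup>2 * l" using ineq[OF \<open>0 < l\<close>] by simp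
    then have "l * (norm u)\<^sup>2 \<le> 2 * H" by (simp add: mult.commute)
    then have "(norm u)\<^sup>2 \<le> 2 * H / l" using \<open>0 < l\<close> by (simp add: pos_le_divide_eq mult.commute)
    then show ?thesis by (simp add: l_def algebra_simps)
  qed
  then show ?thesis by (simp add: u_def H_def)
qed

end

section \<open>The free energy near a local equilibrium\<close>

text \<open>The integrability required of a linear functional derivative, used for the constant path from \<open>\<rho>\<close> to
  itself.\<close>

lemma derivative_integrable:
  assumes d: "linear_functional_derivative S En dE" and rho: "\<rho> \<in> P2" and fin: "En \<rho> < \<infinity>"
  shows "(\<integral>\<^sup>+x. ennreal \<bar>dE \<rho> x\<bar> \<partial>\<rho>) < \<infinity>"
proof -
  have "En \<rho> + En \<rho> < \<infinity>" using fin by auto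
  then have sup: "(\<integral>\<^sup>+x. (SUP t\<in>{0..1}. ennreal \<bar>dE (mixture t \<rho> \<rho>) x\<bar>) \<partial>\<rho>) < \<infinity>"
    using d rho unfolding linear_functional_derivative_def by blast
  have "mixture 0 \<rho> \<rho> = \<rho>" by (simp add: mixture_def measure_of_of_measure)
  then have "(\<integral>\<^sup>+x. ennreal \<bar>dE \<rho> x\<bar> \<partial>\<rho>)
      \<le> (\<integral>\<^sup>+x. (SUP t\<in>{0..1}. ennreal \<bar>dE (mixture t \<rho> \<rho>) x\<bar>) \<partial>\<rho>)"
    by (intro nn_integral_mono SUP_upper2[of 0]) auto
  then show ?thesis using sup by (rule le_less_trans)
qed

locale mean_field =
  fixes V\<^sub>0 :: "'a::euclidean_space \<Rightarrow> real"
    and R :: "'h::{real_inner,complete_space} \<Rightarrow> real"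
    and \<phi> :: "'a \<Rightarrow> 'h"
    and \<sigma> :: real
  assumes V0_cont: "continuous_on UNIV V\<^sub>0"
    and R_C1: "C1_fun R"
    and phi_cont: "continuous_on UNIV \<phi>"
    and sigma_pos: "0 < \<sigma>\<^sup>2"
    and weight_integrable: "\<And>\<psi>. integrable lborel (gibbs_weight V\<^sub>0 R \<phi> \<sigma> \<psi>)"
    and gibbs_finite_energy: "\<And>\<psi>. free_energy V\<^sub>0 R \<phi> \<sigma> (gibbs V\<^sub>0 R \<phi> \<sigma> \<psi>) < \<infinity>"
begin

abbreviation "U \<equiv> potential V\<^sub>0 R \<phi>"
abbreviation "w \<equiv> gibbs_weight V\<^sub>0 R \<phi> \<sigma>"
abbreviation "\<gamma> \<equiv> gibbs V\<^sub>0 R \<phi> \<sigma>"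

definition Z :: "'h \<Rightarrow> real" where
  "Z \<psi> = (\<integral>x. w \<psi> x \<partial>lborel)"

definition gibbs_density :: "'h \<Rightarrow> 'a \<Rightarrow> real" where
  "gibbs_density \<psi> x = w \<psi> x / Z \<psi>"

lemma V0_meas [measurable]: "V\<^sub>0 \<in> borel_measurable borel"
  by (rule borel_measurable_continuous_onI[OF V0_cont])

lemma phi_meas [measurable]: "(\<lambda>x. norm (\<phi> x)) \<in> borel_measurable borel"
  "(\<lambda>x. inner u (\<phi> x)) \<in> borel_measurable borel"
  by (intro borel_measurable_continuous_onI continuous_intros phi_cont)+

lemma U_meas [measurable]: "U \<psi> \<in> borel_measurable borel"
  unfolding potential_def[abs_def] by measurable

lemma w_meas [measurable]: "w \<psi> \<in> borel_measurable borel"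
  unfolding gibbs_weight_def[abs_def] by measurable

lemma w_pos: "0 < w \<psi> x"
  by (simp add: gibbs_weight_def)

lemma Z_pos: "0 < Z \<psi>"
proof -
  have "Z \<psi> \<noteq> 0"
  proof
    assume "Z \<psi> = 0"
    then have "AE x in lborel. w \<psi> x = 0"
      using integral_nonneg_eq_0_iff_AE[OF weight_integrable[of \<psi>]] w_pos[of \<psi>]
      by (simp add: Z_def less_imp_le)
    then have "AE x in (lborel :: 'a measure). False"
      using w_pos[of \<psi>] by (simp add: less_imp_neq[symmetric])
    then show False by (simp add: AE_iff_measurable[OF _ refl] emeasure_lborel_UNIV)
  qed
  moreover have "0 \<le> Z \<psi>" unfolding Z_def using w_pos[of \<psi>] by (simp add: less_imp_le)
  ultimately show ?thesis by linarith
qed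

lemma gibbs_density_pos: "0 < gibbs_density \<psi> x"
  by (simp add: gibbs_density_def w_pos Z_pos)

lemma gibbs_density_meas [measurable]: "gibbs_density \<psi> \<in> borel_measurable borel"
  unfolding gibbs_density_def[abs_def] by measurable

lemma ln_gibbs_density: "ln (gibbs_density \<psi> x) = - U \<psi> x / \<sigma>\<^sup>2 - ln (Z \<psi>)"
  unfolding gibbs_density_def using Z_pos[of \<psi>] by (simp add: ln_div gibbs_weight_def)

lemma gibbs_eq_density: "\<gamma> \<psi> = density lborel (\<lambda>x. ennreal (gibbs_density \<psi> x))"
  by (simp add: gibbs_def gibbs_density_def Z_def)

lemma sets_gibbs: "sets (\<gamma> \<psi>) = sets borel"
  by (simp add: gibbs_eq_density)

lemma prob_space_gibbs: "prob_space (\<gamma> \<psi>)"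
proof (rule prob_spaceI)
  have "emeasure (\<gamma> \<psi>) (space (\<gamma> \<psi>)) = (\<integral>\<^sup>+x. ennreal (w \<psi> x / Z \<psi>) \<partial>lborel)"
    unfolding gibbs_eq_density gibbs_density_def[symmetric] by (subst emeasure_density) auto
  also have "\<dots> = ennreal (\<integral>x. w \<psi> x / Z \<psi> \<partial>lborel)"
    using weight_integrable[of \<psi>] w_pos[of \<psi>] Z_pos[of \<psi>]
    by (intro nn_integral_eq_integral) (auto simp: less_imp_le)
  also have "\<dots> = 1" using Z_pos[of \<psi>] by (simp add: Z_def[symmetric])
  finally show "emeasure (\<gamma> \<psi>) (space (\<gamma> \<psi>)) = 1" .
qed

lemma AE_gibbs: "(AE x in \<gamma> \<psi>. P x) \<longleftrightarrow> (AE x in lborel. P x)"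
  unfolding gibbs_eq_density using gibbs_density_pos[of \<psi>] by (subst AE_density) auto

lemma rel_density_gibbs: "AE x in lborel. rel_density lborel (\<gamma> \<psi>) x = gibbs_density \<psi> x"
  unfolding gibbs_eq_density
  by (rule rel_density_density[OF sigma_finite_lborel]) (auto simp: less_imp_le[OF gibbs_density_pos])

lemma gibbs_absolutely_continuous: "absolutely_continuous lborel (\<gamma> \<psi>)"
  unfolding gibbs_eq_density by (rule absolutely_continuousI_density) simp

lemma inner_phi_bound: "\<bar>inner u (\<phi> x)\<bar> \<le> norm u * norm (\<phi> x)"
  by (rule Cauchy_Schwarz_ineq2)

text \<open>Finite free energy means that neither the energy nor the entropy is \<open>\<infinity>\<close>, which bounds the positive part
  of \<open>V\<^sub>0\<close> and, the log-density being \<open>- U / \<sigma>\<^sup>2\<close> up to a constant, its negative part.\<close>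

lemma gibbs_integrable:
  shows gibbs_norm_phi: "(\<integral>\<^sup>+x. ennreal (norm (\<phi> x)) \<partial>\<gamma> \<psi>) < \<infinity>"
    and gibbs_V0: "integrable (\<gamma> \<psi>) V\<^sub>0"
proof -
  note [measurable_cong] = sets_gibbs
  interpret prob_space "\<gamma> \<psi>" by (rule prob_space_gibbs)
  have fin: "energy V\<^sub>0 R \<phi> (\<gamma> \<psi>) + ereal (\<sigma>\<^sup>2) * Defs.entropy (\<gamma> \<psi>) \<noteq> \<infinity>"
    using gibbs_finite_energy[of \<psi>] by (simp add: free_energy_def)
  then have en: "energy V\<^sub>0 R \<phi> (\<gamma> \<psi>) \<noteq> \<infinity>" by auto
  have ent: "Defs.entropy (\<gamma> \<psi>) \<noteq> \<infinity>" using fin sigma_pos by auto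
  have n: "(\<integral>\<^sup>+x. ennreal (norm (\<phi> x)) \<partial>\<gamma> \<psi>) \<noteq> \<infinity>" and v: "ereal_integral (\<gamma> \<psi>) V\<^sub>0 \<noteq> \<infinity>"
    using en unfolding energy_def by (auto split: if_splits)
  show n': "(\<integral>\<^sup>+x. ennreal (norm (\<phi> x)) \<partial>\<gamma> \<psi>) < \<infinity>" using n by (simp add: less_top)
  have vpos: "(\<integral>\<^sup>+x. ennreal (V\<^sub>0 x) \<partial>\<gamma> \<psi>) \<noteq> \<infinity>" by (rule ereal_integral_finite_positive_part[OF v])
  have "ereal_integral (\<gamma> \<psi>) (\<lambda>x. ln (rel_density lborel (\<gamma> \<psi>) x)) \<noteq> \<infinity>"
    using ent gibbs_absolutely_continuous[of \<psi>]
    by (simp add: entropy_eq_relative_entropy[OF prob_space_axioms sets_gibbs] relative_entropy_def)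
  then have "(\<integral>\<^sup>+x. ennreal (ln (rel_density lborel (\<gamma> \<psi>) x)) \<partial>\<gamma> \<psi>) \<noteq> \<infinity>"
    by (rule ereal_integral_finite_positive_part)
  moreover have "(\<integral>\<^sup>+x. ennreal (ln (rel_density lborel (\<gamma> \<psi>) x)) \<partial>\<gamma> \<psi>)
      = (\<integral>\<^sup>+x. ennreal (- U \<psi> x / \<sigma>\<^sup>2 - ln (Z \<psi>)) \<partial>\<gamma> \<psi>)"
  proof (rule nn_integral_cong_AE)
    show "AE x in \<gamma> \<psi>. ennreal (ln (rel_density lborel (\<gamma> \<psi>) x)) = ennreal (- U \<psi> x / \<sigma>\<^sup>2 - ln (Z \<psi>))"
      unfolding AE_gibbs using rel_density_gibbs[of \<psi>]
      by eventually_elim (simp add: ln_gibbs_density)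
  qed
  ultimately have k: "(\<integral>\<^sup>+x. ennreal (- U \<psi> x / \<sigma>\<^sup>2 - ln (Z \<psi>)) \<partial>\<gamma> \<psi>) < \<infinity>" by (simp add: less_top)
  have "(\<integral>\<^sup>+x. ennreal (- V\<^sub>0 x) \<partial>\<gamma> \<psi>) < \<infinity>"
  proof (rule nn_integral_linear_bound[OF _ _ finite_measure_axioms _ _ _ _ _ k n'])
    fix x
    have "- V\<^sub>0 x = \<sigma>\<^sup>2 * (- U \<psi> x / \<sigma>\<^sup>2 - ln (Z \<psi>)) + \<sigma>\<^sup>2 * ln (Z \<psi>) + inner (grad R \<psi>) (\<phi> x)"
      using sigma_pos by (simp add: potential_def field_simps)
    then show "- V\<^sub>0 x \<le> \<sigma>\<^sup>2 * (- U \<psi> x / \<sigma>\<^sup>2 - ln (Z \<psi>)) + \<bar>\<sigma>\<^sup>2 * ln (Z \<psi>)\<bar> + norm (grad R \<psi>) * norm (\<phi> x)"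
      using inner_phi_bound[of "grad R \<psi>" x] by linarith
  qed auto
  then show "integrable (\<gamma> \<psi>) V\<^sub>0" using vpos by (intro integrableI_parts) auto
qed

lemma phi_integral:
  assumes "prob_space \<rho>" "sets \<rho> = sets borel" "(\<integral>\<^sup>+x. ennreal (norm (\<phi> x)) \<partial>\<rho>) < \<infinity>"
  shows "integrable \<rho> (\<lambda>x. inner u (\<phi> x))" "(\<integral>x. inner u (\<phi> x) \<partial>\<rho>) = inner u (mean \<phi> \<rho>)"
proof -
  interpret prob_space \<rho> by fact
  show "integrable \<rho> (\<lambda>x. inner u (\<phi> x))" "(\<integral>x. inner u (\<phi> x) \<partial>\<rho>) = inner u (mean \<phi> \<rho>)"
    using mean_inner[OF finite_measure_axioms assms(2) phi_cont assms(3), of u]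
    by (auto simp: has_bochner_integral_iff)
qed

lemma free_energy_finite:
  assumes rho: "prob_space \<rho>" "sets \<rho> = sets borel" "(\<integral>\<^sup>+x. ennreal (norm (\<phi> x)) \<partial>\<rho>) < \<infinity>"
    and V: "integrable \<rho> V\<^sub>0" and ac: "absolutely_continuous lborel \<rho>"
    and ln: "integrable \<rho> (\<lambda>x. ln (rel_density lborel \<rho> x))"
  shows "free_energy V\<^sub>0 R \<phi> \<sigma> \<rho> = ereal ((\<integral>x. V\<^sub>0 x \<partial>\<rho>) + R (mean \<phi> \<rho>)
    + \<sigma>\<^sup>2 * (\<integral>x. ln (rel_density lborel \<rho> x) \<partial>\<rho>))"
proof -
  have "Defs.entropy \<rho> = ereal (\<integral>x. ln (rel_density lborel \<rho> x) \<partial>\<rho>)"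
    using ac ereal_integral_integrable[OF ln]
    by (simp add: entropy_eq_relative_entropy[OF rho(1,2)] relative_entropy_def)
  moreover have "energy V\<^sub>0 R \<phi> \<rho> = ereal ((\<integral>x. V\<^sub>0 x \<partial>\<rho>) + R (mean \<phi> \<rho>))"
    using rho(3) ereal_integral_integrable[OF V] by (simp add: energy_def)
  ultimately show ?thesis by (simp add: free_energy_def)
qed

lemma free_energy_gibbs:
  "free_energy V\<^sub>0 R \<phi> \<sigma> (\<gamma> \<psi>)
    = ereal (R (mean \<phi> (\<gamma> \<psi>)) - inner (grad R \<psi>) (mean \<phi> (\<gamma> \<psi>)) - \<sigma>\<^sup>2 * ln (Z \<psi>))"
proof -
  note [measurable_cong] = sets_gibbs
  interpret prob_space "\<gamma> \<psi>" by (rule prob_space_gibbs)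
  note phi = phi_integral[OF prob_space_gibbs sets_gibbs gibbs_norm_phi, of \<psi> "grad R \<psi>"]
  define k where "k = (\<lambda>x. - U \<psi> x / \<sigma>\<^sup>2 - ln (Z \<psi>))"
  have k_eq: "k = (\<lambda>x. - (V\<^sub>0 x + inner (grad R \<psi>) (\<phi> x)) / \<sigma>\<^sup>2 - ln (Z \<psi>))"
    by (simp add: k_def potential_def)
  have k: "integrable (\<gamma> \<psi>) k" unfolding k_eq using gibbs_V0[of \<psi>] phi(1) by simp
  have k_int: "\<sigma>\<^sup>2 * (\<integral>x. k x \<partial>\<gamma> \<psi>)
      = - (\<integral>x. V\<^sub>0 x \<partial>\<gamma> \<psi>) - inner (grad R \<psi>) (mean \<phi> (\<gamma> \<psi>)) - \<sigma>\<^sup>2 * ln (Z \<psi>)"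
    unfolding k_eq using gibbs_V0[of \<psi>] phi sigma_pos by (simp add: prob_space field_simps)
  have ae: "AE x in \<gamma> \<psi>. ln (rel_density lborel (\<gamma> \<psi>) x) = k x"
    unfolding AE_gibbs using rel_density_gibbs[of \<psi>]
    by eventually_elim (simp add: ln_gibbs_density k_def)
  have m1: "(\<lambda>x. ln (rel_density lborel (\<gamma> \<psi>) x)) \<in> borel_measurable (\<gamma> \<psi>)"
    using rel_density_measurable[of lborel "\<gamma> \<psi>"] by simp
  have m2: "k \<in> borel_measurable (\<gamma> \<psi>)" using k by auto
  have ln: "integrable (\<gamma> \<psi>) (\<lambda>x. ln (rel_density lborel (\<gamma> \<psi>) x))"
    using integrable_cong_AE[OF m1 m2 ae] k by simp
  have "(\<integral>x. ln (rel_density lborel (\<gamma> \<psi>) x) \<partial>\<gamma> \<psi>) = (\<integral>x. k x \<partial>\<gamma> \<psi>)"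
    by (rule integral_cong_AE[OF m1 m2 ae])
  then show ?thesis
    using free_energy_finite[OF prob_space_gibbs sets_gibbs gibbs_norm_phi gibbs_V0
        gibbs_absolutely_continuous ln] k_int by simp
qed

text \<open>Jensen's inequality for \<open>Z \<psi> / Z \<xi> = \<integral> exp (- \<langle>\<nabla>R \<psi> - \<nabla>R \<xi>, \<phi>\<rangle> / \<sigma>\<^sup>2) d\<rho>\<close>, where \<open>\<rho>\<close> is the Gibbs measure at
  \<open>\<xi>\<close>.\<close>

lemma log_partition_le:
  "- \<sigma>\<^sup>2 * ln (Z \<psi>) \<le> - \<sigma>\<^sup>2 * ln (Z \<xi>) + inner (grad R \<psi> - grad R \<xi>) (mean \<phi> (\<gamma> \<xi>))"
proof -
  note [measurable_cong] = sets_gibbs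
  interpret prob_space "\<gamma> \<xi>" by (rule prob_space_gibbs)
  define D where "D = grad R \<psi> - grad R \<xi>"
  note phi = phi_integral[OF prob_space_gibbs sets_gibbs gibbs_norm_phi, of \<xi> D]
  define m where "m = - inner D (mean \<phi> (\<gamma> \<xi>)) / \<sigma>\<^sup>2"
  define Y where "Y = (\<lambda>x. - inner D (\<phi> x) / \<sigma>\<^sup>2)"
  have Y: "integrable (\<gamma> \<xi>) Y" "(\<integral>x. Y x \<partial>\<gamma> \<xi>) = m" using phi by (auto simp: Y_def m_def)
  have w_eq: "gibbs_density \<xi> x * exp (Y x) = w \<psi> x / Z \<xi>" for x
    by (simp add: gibbs_density_def gibbs_weight_def Y_def D_def potential_def exp_add[symmetric]
        inner_diff_left diff_divide_distrib add_divide_distrib)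
  have eY: "integrable (\<gamma> \<xi>) (\<lambda>x. exp (Y x))" "(\<integral>x. exp (Y x) \<partial>\<gamma> \<xi>) = Z \<psi> / Z \<xi>"
  proof -
    have [measurable]: "Y \<in> borel_measurable borel" unfolding Y_def by measurable
    show "integrable (\<gamma> \<xi>) (\<lambda>x. exp (Y x))"
      unfolding gibbs_eq_density using weight_integrable[of \<psi>] gibbs_density_pos[of \<xi>]
      by (subst integrable_density) (auto simp: w_eq less_imp_le)
    show "(\<integral>x. exp (Y x) \<partial>\<gamma> \<xi>) = Z \<psi> / Z \<xi>"
      unfolding gibbs_eq_density using gibbs_density_pos[of \<xi>]
      by (subst integral_density) (auto simp: w_eq less_imp_le Z_def)
  qed
  have "(\<integral>x. exp m * (1 + (Y x - m)) \<partial>\<gamma> \<xi>) \<le> (\<integral>x. exp (Y x) \<partial>\<gamma> \<xi>)"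
  proof (rule integral_mono[OF _ eY(1)])
    show "integrable (\<gamma> \<xi>) (\<lambda>x. exp m * (1 + (Y x - m)))" using Y by simp
    fix x
    have "exp m * (1 + (Y x - m)) \<le> exp m * exp (Y x - m)"
      by (intro mult_left_mono exp_ge_add_one_self) simp
    then show "exp m * (1 + (Y x - m)) \<le> exp (Y x)" by (simp add: exp_add[symmetric])
  qed
  then have "exp m \<le> Z \<psi> / Z \<xi>" using Y by (simp add: eY(2) prob_space)
  then have "ln (exp m) \<le> ln (Z \<psi> / Z \<xi>)" using Z_pos[of \<psi>] Z_pos[of \<xi>] by (subst ln_le_cancel_iff) auto
  then have "m \<le> ln (Z \<psi>) - ln (Z \<xi>)" using Z_pos[of \<psi>] Z_pos[of \<xi>] by (simp add: ln_div)
  then have "\<sigma>\<^sup>2 * m \<le> \<sigma>\<^sup>2 * (ln (Z \<psi>) - ln (Z \<xi>))" using sigma_pos by (intro mult_left_mono) auto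
  moreover have "\<sigma>\<^sup>2 * m = - inner D (mean \<phi> (\<gamma> \<xi>))" using sigma_pos by (simp add: m_def)
  ultimately show ?thesis by (simp add: D_def right_diff_distrib)
qed

end

context mean_field
begin

text \<open>With \<open>h\<close>, \<open>p\<close>, \<open>r\<close> the densities \<open>d\<rho>/d\<Gamma>(\<rho>)\<close>, \<open>d\<Gamma>(\<rho>)/dx\<close>, \<open>d\<rho>/dx\<close>, the claim is the integral of
  \<open>ln r = ln h + ln p\<close>.  The point is to show that every term is integrable: \<open>ln h\<close> because the relative
  entropy is finite, \<open>(ln r)\<^sup>-\<close> because of the second moment, hence \<open>(ln p)\<^sup>-\<close> and the positive part of the
  energy.  The last premise then supplies the negative part.\<close>

lemma free_energy_eq_relative_entropy:
  assumes rho: "\<rho> \<in> P2" and n: "(\<integral>\<^sup>+x. ennreal (norm (\<phi> x)) \<partial>\<rho>) < \<infinity>"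
    and psi: "\<psi> = mean \<phi> \<rho>" and re: "relative_entropy \<rho> (\<gamma> \<psi>) \<noteq> \<infinity>"
    and deriv: "energy V\<^sub>0 R \<phi> \<rho> < \<infinity> \<longrightarrow> (\<integral>\<^sup>+x. ennreal \<bar>U \<psi> x\<bar> \<partial>\<rho>) < \<infinity>"
  shows "free_energy V\<^sub>0 R \<phi> \<sigma> \<rho> = ereal (R \<psi> - inner (grad R \<psi>) \<psi> - \<sigma>\<^sup>2 * ln (Z \<psi>)
    + \<sigma>\<^sup>2 * (\<integral>x. ln (rel_density (\<gamma> \<psi>) \<rho> x) \<partial>\<rho>))"
proof -
  have prob: "prob_space \<rho>" and sets: "sets \<rho> = sets borel" using rho by (auto simp: P2_def)
  interpret prob_space \<rho> by fact
  interpret g: prob_space "\<gamma> \<psi>" by (rule prob_space_gibbs)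
  note [measurable_cong] = sets sets_gibbs
  have sets': "sets \<rho> = sets (\<gamma> \<psi>)" using sets sets_gibbs by simp
  note ent = relative_entropy_integrable[OF prob_space_gibbs prob sets' re]
  define h where "h = rel_density (\<gamma> \<psi>) \<rho>"
  define p where "p = gibbs_density \<psi>"
  define r where "r = rel_density lborel \<rho>"
  have hm [measurable]: "h \<in> borel_measurable borel"
    unfolding h_def using rel_density_measurable[of "\<gamma> \<psi>" \<rho>] by simp
  have rm [measurable]: "r \<in> borel_measurable borel"
    unfolding r_def using rel_density_measurable[of lborel \<rho>] by simp
  have pm [measurable]: "p \<in> borel_measurable borel" unfolding p_def by measurable
  have h0: "0 \<le> h x" for x by (simp add: h_def rel_density_nonneg)
  have p0: "0 < p x" for x by (simp add: p_def gibbs_density_pos)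
  have dens_h: "\<rho> = density (\<gamma> \<psi>) (\<lambda>x. ennreal (h x))"
    unfolding h_def using density_rel_density[OF g.sigma_finite_measure_axioms
        sigma_finite_measure_axioms ent(1) sets'] by simp
  have dens: "\<rho> = density lborel (\<lambda>x. ennreal (p x * h x))"
  proof -
    have "\<gamma> \<psi> = density lborel (\<lambda>x. ennreal (p x))" by (simp add: gibbs_eq_density p_def)
    then have "\<rho> = density (density lborel (\<lambda>x. ennreal (p x))) (\<lambda>x. ennreal (h x))"
      using dens_h by simp
    also have "\<dots> = density lborel (\<lambda>x. ennreal (p x) * ennreal (h x))"
      by (rule density_density_eq) auto
    also have "(\<lambda>x. ennreal (p x) * ennreal (h x)) = (\<lambda>x. ennreal (p x * h x))"
      using h0 p0 by (simp add: ennreal_mult less_imp_le)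
    finally show ?thesis .
  qed
  have ac: "absolutely_continuous lborel \<rho>"
    by (subst dens) (rule absolutely_continuousI_density, simp)
  have "AE x in lborel. r x = p x * h x"
    unfolding r_def by (subst dens, rule rel_density_density[OF sigma_finite_lborel])
      (auto simp: h0 less_imp_le[OF p0])
  then have ae_r: "AE x in \<rho>. r x = p x * h x"
    by (subst dens, subst AE_density) auto
  have ae_h: "AE x in \<rho>. 0 < h x" by (subst dens_h, subst AE_density) auto
  have ae: "AE x in \<rho>. ln (r x) = ln (h x) + ln (p x)"
    using ae_r ae_h by eventually_elim (simp add: ln_mult less_imp_neq[OF p0, symmetric])
  have ln_p: "ln (p x) = - U \<psi> x / \<sigma>\<^sup>2 - ln (Z \<psi>)" for x by (simp add: p_def ln_gibbs_density)
  have h_int: "integrable \<rho> (\<lambda>x. ln (h x))" using ent(2) by (simp add: h_def)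
  \<comment> \<open>The reference energy has an integrable positive part, since \<open>- ln p = ln h - ln r\<close>.\<close>
  have neg_p: "(\<integral>\<^sup>+x. ennreal (- ln (p x)) \<partial>\<rho>) < \<infinity>"
  proof -
    have "(\<integral>\<^sup>+x. ennreal \<bar>ln (h x)\<bar> \<partial>\<rho>) < \<infinity>"
      using h_int by (simp add: integrable_iff_bounded)
    moreover have "(\<integral>\<^sup>+x. ennreal (- ln (r x)) \<partial>\<rho>) < \<infinity>"
      using neg_ln_density_finite_P2[OF rho ac] by (simp add: r_def)
    moreover have "ln (h x) - ln (r x) \<le> 1 * (- ln (r x)) + 0 + 1 * \<bar>ln (h x)\<bar>" for x by simp
    ultimately have "(\<integral>\<^sup>+x. ennreal (ln (h x) - ln (r x)) \<partial>\<rho>) < \<infinity>"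
      using nn_integral_linear_bound[of "\<lambda>x. - ln (r x)" \<rho> "\<lambda>x. \<bar>ln (h x)\<bar>"
          "\<lambda>x. ln (h x) - ln (r x)" 1 0 1] finite_measure_axioms by simp
    moreover have "(\<integral>\<^sup>+x. ennreal (- ln (p x)) \<partial>\<rho>) = (\<integral>\<^sup>+x. ennreal (ln (h x) - ln (r x)) \<partial>\<rho>)"
      using ae by (intro nn_integral_cong_AE, eventually_elim) simp
    ultimately show ?thesis by simp
  qed
  have "(\<integral>\<^sup>+x. ennreal (V\<^sub>0 x) \<partial>\<rho>) < \<infinity>"
  proof (rule nn_integral_linear_bound[OF _ _ finite_measure_axioms _ _ _ _ _ neg_p n])
    fix x
    have "V\<^sub>0 x = \<sigma>\<^sup>2 * (- ln (p x)) + - \<sigma>\<^sup>2 * ln (Z \<psi>) - inner (grad R \<psi>) (\<phi> x)"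
      using sigma_pos by (simp add: ln_p potential_def field_simps)
    then show "V\<^sub>0 x \<le> \<sigma>\<^sup>2 * (- ln (p x)) + \<bar>- \<sigma>\<^sup>2 * ln (Z \<psi>)\<bar> + norm (grad R \<psi>) * norm (\<phi> x)"
      using inner_phi_bound[of "grad R \<psi>" x] by linarith
  qed auto
  then have "ereal_integral \<rho> V\<^sub>0 \<noteq> \<infinity>" by (rule ereal_integral_neq_infinity)
  then have "energy V\<^sub>0 R \<phi> \<rho> < \<infinity>" using n by (simp add: energy_def)
  then have "(\<integral>\<^sup>+x. ennreal \<bar>U \<psi> x\<bar> \<partial>\<rho>) < \<infinity>" using deriv by blast
  then have U_int: "integrable \<rho> (U \<psi>)" by (simp add: integrable_iff_bounded)
  note phi = phi_integral[OF prob sets n, of "grad R \<psi>"]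
  have V_fun: "(\<lambda>x. U \<psi> x - inner (grad R \<psi>) (\<phi> x)) = V\<^sub>0" by (simp add: potential_def)
  have V_int: "integrable \<rho> V\<^sub>0"
    using Bochner_Integration.integrable_diff[OF U_int phi(1)] unfolding V_fun .
  have V_val: "(\<integral>x. V\<^sub>0 x \<partial>\<rho>) = (\<integral>x. U \<psi> x \<partial>\<rho>) - inner (grad R \<psi>) \<psi>"
    using Bochner_Integration.integral_diff[OF U_int phi(1)] phi(2)[folded psi] unfolding V_fun by simp
  have p_int: "integrable \<rho> (\<lambda>x. ln (p x))" unfolding ln_p using U_int by simp
  have p_val: "\<sigma>\<^sup>2 * (\<integral>x. ln (p x) \<partial>\<rho>) = - (\<integral>x. U \<psi> x \<partial>\<rho>) - \<sigma>\<^sup>2 * ln (Z \<psi>)"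
    unfolding ln_p using U_int sigma_pos by (simp add: prob_space right_diff_distrib)
  have m: "(\<lambda>x. ln (r x)) \<in> borel_measurable \<rho>" "(\<lambda>x. ln (h x) + ln (p x)) \<in> borel_measurable \<rho>"
    by measurable
  have r_int: "integrable \<rho> (\<lambda>x. ln (r x))"
    using integrable_cong_AE[OF m ae] h_int p_int by simp
  have r_val: "(\<integral>x. ln (r x) \<partial>\<rho>) = (\<integral>x. ln (h x) \<partial>\<rho>) + (\<integral>x. ln (p x) \<partial>\<rho>)"
    using integral_cong_AE[OF m ae] h_int p_int by simp
  show ?thesis
    using free_energy_finite[OF prob sets n V_int ac r_int[unfolded r_def]] r_val V_val p_val
    by (simp add: r_def h_def psi distrib_left)
qed

text \<open>The convex function \<open>R + \<theta> |\<cdot>|\<^sup>2\<close> lies above its tangent at \<open>\<psi>\<close>; in this inequality at \<open>\<psi>\<^sub>s\<close> the quadratic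
  terms add up to \<open>\<theta> |\<psi> - \<psi>\<^sub>s|\<^sup>2\<close>.\<close>

lemma free_energy_gap:
  assumes rho: "\<rho> \<in> P2" and n: "(\<integral>\<^sup>+x. ennreal (norm (\<phi> x)) \<partial>\<rho>) < \<infinity>"
    and psi: "\<psi> = mean \<phi> \<rho>" and re: "relative_entropy \<rho> (\<gamma> \<psi>) \<noteq> \<infinity>"
    and deriv: "energy V\<^sub>0 R \<phi> \<rho> < \<infinity> \<longrightarrow> (\<integral>\<^sup>+x. ennreal \<bar>U \<psi> x\<bar> \<partial>\<rho>) < \<infinity>"
    and fixed: "mean \<phi> (\<gamma> \<psi>\<^sub>s) = \<psi>\<^sub>s"
    and convex: "convex_on UNIV (\<lambda>\<psi>. R \<psi> + \<theta> * (norm \<psi>)\<^sup>2)"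
  shows "free_energy V\<^sub>0 R \<phi> \<sigma> \<rho> - free_energy V\<^sub>0 R \<phi> \<sigma> (\<gamma> \<psi>\<^sub>s)
    \<le> ereal (\<sigma>\<^sup>2 * (\<integral>x. ln (rel_density (\<gamma> \<psi>) \<rho> x) \<partial>\<rho>) + \<theta> * (norm (\<psi> - \<psi>\<^sub>s))\<^sup>2)"
proof -
  have R: "GDERIV R \<psi> :> grad R \<psi>"
    using R_C1 GDERIV_grad unfolding C1_fun_def by blast
  have sq: "GDERIV (\<lambda>\<psi>. \<theta> * (norm \<psi>)\<^sup>2) \<psi> :> (2 * \<theta>) *\<^sub>R \<psi>"
    unfolding gderiv_def power2_norm_eq_inner
    by (auto intro!: derivative_eq_intros simp: inner_commute)
  have "R \<psi> + \<theta> * (norm \<psi>)\<^sup>2 + inner (\<psi>\<^sub>s - \<psi>) (grad R \<psi> + (2 * \<theta>) *\<^sub>R \<psi>) \<le> R \<psi>\<^sub>s + \<theta> * (norm \<psi>\<^sub>s)\<^sup>2"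
    by (rule convex_above_tangent[OF convex GDERIV_add[OF R sq]])
  moreover have "\<theta> * (norm (\<psi> - \<psi>\<^sub>s))\<^sup>2
      = \<theta> * (norm \<psi>\<^sub>s)\<^sup>2 - \<theta> * (norm \<psi>)\<^sup>2 - inner (\<psi>\<^sub>s - \<psi>) ((2 * \<theta>) *\<^sub>R \<psi>)"
    unfolding power2_norm_eq_inner
    by (simp add: inner_diff_left inner_diff_right inner_commute[of \<psi> \<psi>\<^sub>s] algebra_simps)
  ultimately have "R \<psi> - R \<psi>\<^sub>s - inner (grad R \<psi>) (\<psi> - \<psi>\<^sub>s) \<le> \<theta> * (norm (\<psi> - \<psi>\<^sub>s))\<^sup>2"
    by (simp add: inner_add_right inner_diff_left inner_diff_right inner_commute[of _ "grad R \<psi>"])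
  with log_partition_le[of \<psi> \<psi>\<^sub>s] show ?thesis
    unfolding free_energy_eq_relative_entropy[OF rho n psi re deriv] free_energy_gibbs fixed
    by (simp add: inner_diff_left inner_diff_right)
qed

lemma gibbs_log_sobolev:
  assumes "0 \<le> \<eta>" "\<And>\<nu>. \<nu> \<in> P2 \<Longrightarrow>
      relative_entropy \<nu> (\<gamma> \<psi>) \<le> ereal \<eta> * enn2ereal (fisher_information \<nu> (\<gamma> \<psi>))"
  shows "log_sobolev (\<gamma> \<psi>) \<eta>"
proof -
  interpret prob_space "\<gamma> \<psi>" by (rule prob_space_gibbs)
  show ?thesis
  proof
    show "sets (\<gamma> \<psi>) = sets borel" by (rule sets_gibbs)
    show "(AE x in \<gamma> \<psi>. P x) \<longleftrightarrow> (AE x in lborel. P x)" for P by (rule AE_gibbs)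
  qed (rule assms(2), assumption, rule assms(1))
qed

end

section \<open>The functional inequality\<close>

theorem proposition9:
  fixes V\<^sub>0 :: "'a::euclidean_space \<Rightarrow> real"
    and R :: "'h::{real_inner,complete_space} \<Rightarrow> real"
    and \<phi> :: "'a \<Rightarrow> 'h"
    and \<sigma> \<alpha> :: real
    and \<psi>\<^sub>s :: 'h
    and A' :: "'h set"
  assumes V0_C2: "C2_fun V\<^sub>0"
    and R_C1: "C1_fun R"
    and phi_C2: "C2_fun \<phi>"
    and sigma_pos: "\<sigma>\<^sup>2 > 0"
    and gibbs_well_defined: "\<forall>\<psi>. integrable lborel (gibbs_weight V\<^sub>0 R \<phi> \<sigma> \<psi>)"
    and gibbs_finite_energy: "\<forall>\<psi>. free_energy V\<^sub>0 R \<phi> \<sigma> (gibbs V\<^sub>0 R \<phi> \<sigma> \<psi>) < \<infinity>"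
    and bounded_below: "\<exists>c::real. \<forall>\<mu>\<in>P2. ereal c \<le> free_energy V\<^sub>0 R \<phi> \<sigma> \<mu>"
    and derivative: "linear_functional_derivative (P2_mean \<phi>) (energy V\<^sub>0 R \<phi>)
      (energy_derivative V\<^sub>0 R \<phi>)"
    and exp_integrable: "\<forall>\<rho>\<in>P2_mean \<phi>.
      integrable lborel (\<lambda>x. exp (- energy_derivative V\<^sub>0 R \<phi> \<rho> x / \<sigma>\<^sup>2))"
    and psi_stationary: "\<psi>\<^sub>s \<in> stationary_params V\<^sub>0 R \<phi> \<sigma>"
    and alpha: "0 \<le> \<alpha>" "\<alpha> < 1"
    and contraction: "\<forall>\<psi>\<in>A'. norm (mean_map V\<^sub>0 R \<phi> \<sigma> \<psi> - \<psi>\<^sub>s) \<le> \<alpha> * norm (\<psi> - \<psi>\<^sub>s)"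
  shows
    "(\<forall>\<psi>\<in>A'. norm (\<psi> - \<psi>\<^sub>s) \<le> 1 / (1 - \<alpha>) * norm (mean_map V\<^sub>0 R \<phi> \<sigma> \<psi> - \<psi>)) \<and>
     (\<forall>L. lipschitz_on L UNIV \<phi> \<longrightarrow>
        (\<forall>\<rho>\<in>P2. mean \<phi> \<rho> \<in> A' \<longrightarrow>
           ennreal (norm (mean \<phi> \<rho> - \<psi>\<^sub>s))
             \<le> ennreal (L / (1 - \<alpha>)) * W2 \<rho> (local_equilibrium V\<^sub>0 R \<phi> \<sigma> \<rho>)) \<and>
        (\<forall>\<eta> \<theta>. \<eta> > 0 \<and> \<theta> > 0 \<and>
           (\<forall>\<nu>\<in>P2. \<forall>\<rho>\<in>P2. relative_entropy \<nu> (local_equilibrium V\<^sub>0 R \<phi> \<sigma> \<rho>)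
              \<le> ereal \<eta> * enn2ereal (fisher_information \<nu> (local_equilibrium V\<^sub>0 R \<phi> \<sigma> \<rho>))) \<and>
           convex_on UNIV (\<lambda>\<psi>. R \<psi> + \<theta> * (norm \<psi>)\<^sup>2) \<longrightarrow>
           (\<forall>\<rho>\<in>P2. mean \<phi> \<rho> \<in> A' \<longrightarrow>
              free_energy V\<^sub>0 R \<phi> \<sigma> \<rho> - free_energy V\<^sub>0 R \<phi> \<sigma> (gibbs V\<^sub>0 R \<phi> \<sigma> \<psi>\<^sub>s)
                \<le> ereal (\<eta> * (\<sigma>\<^sup>2 + 4 * \<eta> * \<theta> * L\<^sup>2 / (1 - \<alpha>)\<^sup>2))
                  * enn2ereal (fisher_information \<rho> (local_equilibrium V\<^sub>0 R \<phi> \<sigma> \<rho>))) \<and>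
           (free_energy V\<^sub>0 R \<phi> \<sigma> (gibbs V\<^sub>0 R \<phi> \<sigma> \<psi>\<^sub>s)
                \<in> free_energy V\<^sub>0 R \<phi> \<sigma> ` P2_with_mean_in \<phi> A' \<and>
            (\<forall>\<mu>\<in>P2_with_mean_in \<phi> A'.
                free_energy V\<^sub>0 R \<phi> \<sigma> (gibbs V\<^sub>0 R \<phi> \<sigma> \<psi>\<^sub>s) \<le> free_energy V\<^sub>0 R \<phi> \<sigma> \<mu>) \<longrightarrow>
            (\<exists>\<eta>'>0. \<forall>\<rho>\<in>P2_with_mean_in \<phi> A'.
               free_energy V\<^sub>0 R \<phi> \<sigma> \<rho> - (INF \<mu>\<in>P2_with_mean_in \<phi> A'. free_energy V\<^sub>0 R \<phi> \<sigma> \<mu>)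
                 \<le> ereal (\<eta>' * \<sigma>^4)
                   * enn2ereal (fisher_information \<rho> (local_equilibrium V\<^sub>0 R \<phi> \<sigma> \<rho>))))))"
proof -
  interpret mean_field V\<^sub>0 R \<phi> \<sigma>
  proof
    show "continuous_on UNIV V\<^sub>0" "continuous_on UNIV \<phi>"
      using V0_C2 phi_C2 by (auto dest: C2_fun_continuous)
    show "C1_fun R" by (rule R_C1)
    show "0 < \<sigma>\<^sup>2" by (rule sigma_pos)
    show "integrable lborel (gibbs_weight V\<^sub>0 R \<phi> \<sigma> \<psi>)" for \<psi> using gibbs_well_defined by blast
    show "free_energy V\<^sub>0 R \<phi> \<sigma> (gibbs V\<^sub>0 R \<phi> \<sigma> \<psi>) < \<infinity>" for \<psi> using gibbs_finite_energy by blast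
  qed
  define F where "F = free_energy V\<^sub>0 R \<phi> \<sigma>"
  define f where "f = mean_map V\<^sub>0 R \<phi> \<sigma>"
  define I where "I = (\<lambda>\<rho>. fisher_information \<rho> (local_equilibrium V\<^sub>0 R \<phi> \<sigma> \<rho>))"
  have f_eq: "f \<psi> = mean \<phi> (\<gamma> \<psi>)" for \<psi> by (simp add: f_def mean_map_def)
  have fixed: "mean \<phi> (\<gamma> \<psi>\<^sub>s) = \<psi>\<^sub>s"
    using psi_stationary by (simp add: stationary_params_def mean_map_def)
  have one_minus: "0 < 1 - \<alpha>" using alpha by simp
  have part1: "norm (\<psi> - \<psi>\<^sub>s) \<le> 1 / (1 - \<alpha>) * norm (f \<psi> - \<psi>)" if "\<psi> \<in> A'" for \<psi>
  proof -
    have "norm (\<psi> - \<psi>\<^sub>s) \<le> norm (f \<psi> - \<psi>) + norm (f \<psi> - \<psi>\<^sub>s)"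
      using norm_triangle_ineq4[of "f \<psi> - \<psi>\<^sub>s" "f \<psi> - \<psi>"] by simp
    also have "\<dots> \<le> norm (f \<psi> - \<psi>) + \<alpha> * norm (\<psi> - \<psi>\<^sub>s)"
      using contraction that by (simp add: f_def)
    finally have "(1 - \<alpha>) * norm (\<psi> - \<psi>\<^sub>s) \<le> norm (f \<psi> - \<psi>)" by (simp add: left_diff_distrib)
    then show ?thesis using one_minus by (simp add: pos_le_divide_eq mult.commute)
  qed
  have part2: "ennreal (norm (mean \<phi> \<rho> - \<psi>\<^sub>s))
      \<le> ennreal (L / (1 - \<alpha>)) * W2 \<rho> (local_equilibrium V\<^sub>0 R \<phi> \<sigma> \<rho>)"
    if lip: "lipschitz_on L UNIV \<phi>" and rho: "\<rho> \<in> P2" and A': "mean \<phi> \<rho> \<in> A'" for L \<rho>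
  proof -
    have L0: "0 \<le> L" using lip by (simp add: lipschitz_on_def)
    have prob: "prob_space \<rho>" "sets \<rho> = sets borel" using rho by (auto simp: P2_def)
    have "ennreal (norm (mean \<phi> \<rho> - \<psi>\<^sub>s)) \<le> ennreal (1 / (1 - \<alpha>) * norm (f (mean \<phi> \<rho>) - mean \<phi> \<rho>))"
      using part1[OF A'] by (rule ennreal_leI)
    also have "\<dots> = ennreal (1 / (1 - \<alpha>)) * ennreal (norm (mean \<phi> \<rho> - f (mean \<phi> \<rho>)))"
      using one_minus by (subst ennreal_mult) (auto simp: norm_minus_commute)
    also have "\<dots> \<le> ennreal (1 / (1 - \<alpha>)) * (ennreal L * W2 \<rho> (local_equilibrium V\<^sub>0 R \<phi> \<sigma> \<rho>))"
      unfolding f_eq local_equilibrium_def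
      by (intro mult_left_mono mean_difference_le_W2[OF lip prob lipschitz_norm_finite_P2[OF rho lip]
            prob_space_gibbs sets_gibbs gibbs_norm_phi]) simp
    also have "\<dots> = ennreal (L / (1 - \<alpha>)) * W2 \<rho> (local_equilibrium V\<^sub>0 R \<phi> \<sigma> \<rho>)"
      using one_minus L0 by (simp add: mult.assoc[symmetric] ennreal_mult[symmetric])
    finally show ?thesis .
  qed
  have part3: "F \<rho> - F (\<gamma> \<psi>\<^sub>s)
      \<le> ereal (\<eta> * (\<sigma>\<^sup>2 + 4 * \<eta> * \<theta> * L\<^sup>2 / (1 - \<alpha>)\<^sup>2)) * enn2ereal (I \<rho>)"
    if lip: "lipschitz_on L UNIV \<phi>" and eta: "0 < \<eta>" and theta: "0 < \<theta>"
      and lsi: "\<forall>\<nu>\<in>P2. \<forall>\<rho>\<in>P2. relative_entropy \<nu> (local_equilibrium V\<^sub>0 R \<phi> \<sigma> \<rho>)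
              \<le> ereal \<eta> * enn2ereal (fisher_information \<nu> (local_equilibrium V\<^sub>0 R \<phi> \<sigma> \<rho>))"
      and convex: "convex_on UNIV (\<lambda>\<psi>. R \<psi> + \<theta> * (norm \<psi>)\<^sup>2)"
      and rho: "\<rho> \<in> P2" and A': "mean \<phi> \<rho> \<in> A'" for L \<eta> \<theta> \<rho>
  proof (cases "I \<rho>")
    case top
    define C where "C = \<eta> * (\<sigma>\<^sup>2 + 4 * \<eta> * \<theta> * L\<^sup>2 / (1 - \<alpha>)\<^sup>2)"
    have "0 < C" unfolding C_def
      using eta theta sigma_pos by (intro mult_pos_pos add_pos_nonneg) auto
    then show ?thesis using top unfolding C_def[symmetric] by simp
  next
    case (real i)
    define \<psi> where "\<psi> = mean \<phi> \<rho>"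
    have prob: "prob_space \<rho>" "sets \<rho> = sets borel" using rho by (auto simp: P2_def)
    have n: "(\<integral>\<^sup>+x. ennreal (norm (\<phi> x)) \<partial>\<rho>) < \<infinity>" by (rule lipschitz_norm_finite_P2[OF rho lip])
    have loc: "local_equilibrium V\<^sub>0 R \<phi> \<sigma> \<rho> = \<gamma> \<psi>" by (simp add: local_equilibrium_def \<psi>_def)
    define H where "H = (\<integral>x. ln (rel_density (\<gamma> \<psi>) \<rho> x) \<partial>\<rho>)"
    have re_le: "relative_entropy \<rho> (\<gamma> \<psi>) \<le> ereal (\<eta> * i)"
      using lsi[rule_format, OF rho rho] real by (simp add: I_def loc enn2ereal_ennreal)
    then have re: "relative_entropy \<rho> (\<gamma> \<psi>) \<noteq> \<infinity>" by auto
    have "sets \<rho> = sets (\<gamma> \<psi>)" using prob sets_gibbs by simp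
    from relative_entropy_integrable(3)[OF prob_space_gibbs prob(1) this re]
    have H_le: "H \<le> \<eta> * i" using re_le by (simp add: H_def)
    interpret lsi: log_sobolev "\<gamma> \<psi>" \<eta>
    proof (rule gibbs_log_sobolev)
      show "relative_entropy \<nu> (\<gamma> \<psi>) \<le> ereal \<eta> * enn2ereal (fisher_information \<nu> (\<gamma> \<psi>))"
        if "\<nu> \<in> P2" for \<nu>
        using lsi[rule_format, OF that rho] unfolding loc .
    qed (use eta in simp)
    have "(norm (\<psi> - f \<psi>))\<^sup>2 \<le> 4 * \<eta> * L\<^sup>2 * H"
      using lsi.mean_transport_entropy[OF C2_fun_imp_C1_fun[OF phi_C2] lip prob re n gibbs_norm_phi]
      by (simp add: H_def f_eq \<psi>_def)
    also have "\<dots> \<le> 4 * \<eta> * L\<^sup>2 * (\<eta> * i)" using H_le eta by (intro mult_left_mono) auto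
    finally have fix_dist: "(norm (\<psi> - f \<psi>))\<^sup>2 \<le> 4 * \<eta> * L\<^sup>2 * (\<eta> * i)" .
    have "norm (\<psi> - \<psi>\<^sub>s) \<le> 1 / (1 - \<alpha>) * norm (\<psi> - f \<psi>)"
      using part1[OF A'] unfolding \<psi>_def norm_minus_commute[of "f _"] .
    then have "(norm (\<psi> - \<psi>\<^sub>s))\<^sup>2 \<le> (1 / (1 - \<alpha>) * norm (\<psi> - f \<psi>))\<^sup>2" by (intro power_mono) auto
    also have "\<dots> = (1 / (1 - \<alpha>))\<^sup>2 * (norm (\<psi> - f \<psi>))\<^sup>2" by (rule power_mult_distrib)
    also have "\<dots> \<le> (1 / (1 - \<alpha>))\<^sup>2 * (4 * \<eta> * L\<^sup>2 * (\<eta> * i))"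
      by (intro mult_left_mono fix_dist) simp
    finally have dist: "(norm (\<psi> - \<psi>\<^sub>s))\<^sup>2 \<le> (1 / (1 - \<alpha>))\<^sup>2 * (4 * \<eta> * L\<^sup>2 * (\<eta> * i))" .
    have deriv: "energy V\<^sub>0 R \<phi> \<rho> < \<infinity> \<longrightarrow> (\<integral>\<^sup>+x. ennreal \<bar>U \<psi> x\<bar> \<partial>\<rho>) < \<infinity>"
      using derivative_integrable[OF derivative rho] by (simp add: energy_derivative_def \<psi>_def)
    have "F \<rho> - F (\<gamma> \<psi>\<^sub>s) \<le> ereal (\<sigma>\<^sup>2 * H + \<theta> * (norm (\<psi> - \<psi>\<^sub>s))\<^sup>2)"
      unfolding F_def H_def by (rule free_energy_gap[OF rho n \<psi>_def re deriv fixed convex])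
    also have "\<dots> \<le> ereal (\<sigma>\<^sup>2 * (\<eta> * i) + \<theta> * ((1 / (1 - \<alpha>))\<^sup>2 * (4 * \<eta> * L\<^sup>2 * (\<eta> * i))))"
      unfolding ereal_less_eq
      using H_le dist theta by (intro add_mono mult_left_mono) auto
    also have "\<dots> = ereal (\<eta> * (\<sigma>\<^sup>2 + 4 * \<eta> * \<theta> * L\<^sup>2 / (1 - \<alpha>)\<^sup>2)) * enn2ereal (I \<rho>)"
      using real by (simp add: enn2ereal_ennreal power_divide algebra_simps)
    finally show ?thesis .
  qed
  have part4: "\<exists>\<eta>'>0. \<forall>\<rho>\<in>P2_with_mean_in \<phi> A'.
      F \<rho> - (INF \<mu>\<in>P2_with_mean_in \<phi> A'. F \<mu>) \<le> ereal (\<eta>' * \<sigma>^4) * enn2ereal (I \<rho>)"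
    if lip: "lipschitz_on L UNIV \<phi>" and eta: "0 < \<eta>" and theta: "0 < \<theta>"
      and lsi: "\<forall>\<nu>\<in>P2. \<forall>\<rho>\<in>P2. relative_entropy \<nu> (local_equilibrium V\<^sub>0 R \<phi> \<sigma> \<rho>)
              \<le> ereal \<eta> * enn2ereal (fisher_information \<nu> (local_equilibrium V\<^sub>0 R \<phi> \<sigma> \<rho>))"
      and convex: "convex_on UNIV (\<lambda>\<psi>. R \<psi> + \<theta> * (norm \<psi>)\<^sup>2)"
      and min: "F (\<gamma> \<psi>\<^sub>s) \<in> F ` P2_with_mean_in \<phi> A'" "\<forall>\<mu>\<in>P2_with_mean_in \<phi> A'. F (\<gamma> \<psi>\<^sub>s) \<le> F \<mu>"
    for L \<eta> \<theta>
  proof -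
    define C where "C = \<eta> * (\<sigma>\<^sup>2 + 4 * \<eta> * \<theta> * L\<^sup>2 / (1 - \<alpha>)\<^sup>2)"
    have C: "0 < C" unfolding C_def
      using eta theta sigma_pos by (intro mult_pos_pos add_pos_nonneg) auto
    have s4: "0 < \<sigma>^4" using sigma_pos by (simp add: zero_less_power_eq)
    have "(INF \<mu>\<in>P2_with_mean_in \<phi> A'. F \<mu>) = F (\<gamma> \<psi>\<^sub>s)"
      using min by (intro antisym INF_greatest) (auto intro: Inf_lower)
    then have "F \<rho> - (INF \<mu>\<in>P2_with_mean_in \<phi> A'. F \<mu>) \<le> ereal (C / \<sigma>^4 * \<sigma>^4) * enn2ereal (I \<rho>)"
      if "\<rho> \<in> P2_with_mean_in \<phi> A'" for \<rho>
      using part3[OF lip eta theta lsi convex, of \<rho>] that s4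
      by (simp add: P2_with_mean_in_def C_def[symmetric])
    then show ?thesis using C s4 by (intro exI[of _ "C / \<sigma>^4"]) auto
  qed
  show ?thesis
    using part1 part2 part3 part4 unfolding F_def f_def I_def by blast
qed

end
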